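(* Let $E$ be a barreled, Hausdorff, sequentially complete complex locally convex space, and let $C\in L(E)$ (not necessarily injective). Let $\mathcal{G}$ be a pre-(C-DS) in $E$ with (infinitesimal) generator $\mathcal{A}$, and suppose that $\mathcal{G}$ is of finite order. Then, for every $\tau>0$, there exist a number $n_{\tau}\in\mathbb{N}$ and a local $n_{\tau}$-times integrated $C$-semigroup $(S_{n_{\tau}}(t))_{t\in[0,\tau)}\subseteq L(E)$ such that $$\mathcal{G}(\varphi)x=(-1)^{n_{\tau}}\int_{0}^{\infty}\varphi^{(n_{\tau})}(s)\,S_{n_{\tau}}(s)x\,ds,\qquad \varphi\in\mathcal{D}_{(-\tau,\tau)},\ x\in E.$$ Furthermore, $(S_{n_{\tau}}(t))_{t\in[0,\tau)}$ is an $n_{\tau}$-times integrated $C$-existence family with a subgenerator $\mathcal{A}$. Moreover, put $N:=\mathcal{N}(\mathcal{G})$ and suppose that the space $L(N)$ is admissible; let $m\geq n_{\tau}-1$ and let $T_{0},\dots,T_{m}\in L(N)$ be the operators representing the restriction of $\mathcal{G}$ to $N$, i.e. $\mathcal{G}_{|N}=\sum_{j=0}^{m}\delta^{(j)}\otimes T_{j}$. Then, for $x\in N$, one has $S_{n_{\tau}}(t)x=0$ for all $t\in[0,\tau)$ if and only if $T_{i}x=0$ for all $0\leq i\leq n_{\tau}-1$.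
   Context: Notation. $L(E)$ is the space of continuous linear operators on $E$ (with the topology of uniform convergence on bounded sets). $\mathcal{D}=C_0^\infty(\mathbb{R})$ is the usual space of scalar test functions; for $\Omega\subseteq\mathbb{R}$, $\mathcal{D}_\Omega=\{\varphi\in\mathcal{D}:\mathrm{supp}(\varphi)\subseteq\Omega\}$ and $\mathcal{D}_0=\mathcal{D}_{[0,\infty)}$. For a locally convex space $X$, $\mathcal{D}'(X)=L(\mathcal{D},X)$ is the space of $X$-valued distributions, and $\mathcal{D}'_0(X)$ is the subspace of those with support contained in $[0,\infty)$. For locally integrable scalar functions, $(\varphi*_0\psi)(t)=\int_0^t\varphi(t-s)\psi(s)\,ds$, $t\in\mathbb{R}$. For $\alpha>0$, $g_\alpha(t)=t^{\alpha-1}/\Gamma(\alpha)$, $t>0$. Multivalued linear operators. A multivalued linear operator (MLO) $\mathcal{A}$ in $E$ is identified with its graph, a linear subspace of $E\times E$; $\mathcal{A}x=\{y:(x,y)\in\mathcal{A}\}$ and $D(\mathcal{A})=\{x:\mathcal{A}x\neq\emptyset\}$. Pre-(C-DS). A pre-(C-DS) is a $\mathcal{G}\in\mathcal{D}'_0(L(E))$ with $C\mathcal{G}(\varphi)=\mathcal{G}(\varphi)C$ for all $\varphi\in\mathcal{D}$ and $\mathcal{G}(\varphi*_0\psi)C=\mathcal{G}(\varphi)\mathcal{G}(\psi)$ for all $\varphi,\psi\in\mathcal{D}$. Its kernel space is $\mathcal{N}(\mathcal{G})=\bigcap_{\varphi\in\mathcal{D}_0}\ker\mathcal{G}(\varphi)$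 (a closed subspace of $E$). Its (infinitesimal) generator is the closed MLO $$\mathcal{A}=\{(x,y)\in E\times E:\ \mathcal{G}(-\varphi')x=\mathcal{G}(\varphi)y\ \text{ for all }\varphi\in\mathcal{D}_0\}.$$ Finite order. A distribution $G\in\mathcal{D}'(X)$ is of finite order on $(-\tau,\tau)$ if there exist $n\in\mathbb{N}_0$ and a continuous $f:[-\tau,\tau]\to X$ with $G(\varphi)=(-1)^n\int_{-\tau}^{\tau}\varphi^{(n)}(t)f(t)\,dt$ for all $\varphi\in\mathcal{D}_{(-\tau,\tau)}$; $G$ is of finite order if it is of finite order on every finite interval $(-\tau,\tau)$. Here $X=L(E)$. Integrated $C$-semigroups. For $0<\alpha<\infty$ and $0<\tau\le\infty$, a strongly continuous family $(S_\alpha(t))_{t\in[0,\tau)}\subseteq L(E)$ is an $\alpha$-times integrated $C$-semigroup (local if $\tau<\infty$) if $S_\alpha(t)C=CS_\alpha(t)$ for $t\in[0,\tau)$ and, for all $x\in E$ and $t,s\in[0,\tau)$ with $t+s\in[0,\tau)$, $$S_\alpha(t)S_\alpha(s)x=\Big[\int_0^{t+s}-\int_0^t-\int_0^s\Big]g_\alpha(t+s-r)S_\alpha(r)Cx\,dr.$$ A strongly continuous family $(S_\alpha(t))_{t\in[0,\tau)}\subseteq L(E)$ is an $\alpha$-times integrated $C$-existence family with a subgenerator $\mathcal{A}$ (an MLO) if for all $x\in E$ and $t\in[0,\tau)$ one has $\int_0^tS_\alpha(s)x\,ds\in D(\mathcal{A})$ and $S_\alpha(t)x-g_{\alpha+1}(t)Cx\in\mathcal{A}\int_0^tS_\alpha(s)x\,ds$.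 Admissibility and the operators $T_j$. A locally convex space $X$ is called admissible if every $G\in\mathcal{D}'(X)$ with $\mathrm{supp}(G)\subseteq\{0\}$ is a finite sum of distributions of the form $\delta^{(i)}\otimes x_i$ with $x_i\in X$, where $(\delta^{(i)}\otimes x_i)(\varphi)=(-1)^i\varphi^{(i)}(0)x_i$. If $L(\mathcal{N}(\mathcal{G}))$ is admissible, then for $N=\mathcal{N}(\mathcal{G})$ there is an integer $m\in\mathbb{N}$ and unique operators $T_0,\dots,T_m\in L(N)$, commuting with $C$, such that $\mathcal{G}_{|N}=\sum_{j=0}^m\delta^{(j)}\otimes T_j$, i.e. $\mathcal{G}(\varphi)x=\sum_{j=0}^m(-1)^j\varphi^{(j)}(0)T_jx$ for $\varphi\in\mathcal{D}$, $x\in N$; moreover $T_iC^i=(-1)^iT_0^{i+1}$ for $0\le i\le m-1$ and $T_0T_m=T_0^{m+2}=0$. *)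

theory Defs
  imports "HOL-Analysis.Analysis" "HOL-Library.Function_Algebras"
begin

section \<open>Complex locally convex spaces\<close>

text \<open>
  A topological vector space is given by a complex scalar multiplication \<open>s\<close> on an additive type
  and a topology \<open>X\<close>, whose \<open>topspace\<close> is the underlying vector space (a linear subspace of the
  type). A linear subspace \<open>N\<close> of \<open>X\<close> is then the space \<open>subtopology X N\<close>. Function types carry the
  pointwise operations of \<open>Function_Algebras\<close> and the pointwise scalar multiplication \<open>fscale s\<close>.
\<close>

definition convex_wrt :: "(complex \<Rightarrow> 'a::ab_group_add \<Rightarrow> 'a) \<Rightarrow> 'a set \<Rightarrow> bool" where
  "convex_wrt s W \<longleftrightarrow>
     (\<forall>x\<in>W. \<forall>y\<in>W. \<forall>u::real. 0 \<le> u \<and> u \<le> 1 \<longrightarrow> s (of_real u) x + s (of_real (1 - u)) y \<in> W)"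

definition abs_convex_wrt :: "(complex \<Rightarrow> 'a::ab_group_add \<Rightarrow> 'a) \<Rightarrow> 'a set \<Rightarrow> bool" where
  "abs_convex_wrt s W \<longleftrightarrow>
     (\<forall>x\<in>W. \<forall>y\<in>W. \<forall>a b. cmod a + cmod b \<le> 1 \<longrightarrow> s a x + s b y \<in> W)"

definition absorbs :: "(complex \<Rightarrow> 'a \<Rightarrow> 'a) \<Rightarrow> 'a set \<Rightarrow> 'a set \<Rightarrow> bool" where
  "absorbs s W B \<longleftrightarrow> (\<exists>r>0. \<forall>c. r \<le> cmod c \<longrightarrow> B \<subseteq> s c ` W)"

locale complex_lcs = vector_space s
  for s :: "complex \<Rightarrow> 'a::ab_group_add \<Rightarrow> 'a" +
  fixes X :: "'a topology"
  assumes subspace_topspace: "subspace (topspace X)"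
    and continuous_add: "continuous_map (prod_topology X X) X (\<lambda>(x, y). x + y)"
    and continuous_scale: "continuous_map (prod_topology euclidean X) X (\<lambda>(c, x). s c x)"
    and locally_convex: "\<And>U. openin X U \<Longrightarrow> 0 \<in> U \<Longrightarrow>
          \<exists>W. openin X W \<and> 0 \<in> W \<and> W \<subseteq> U \<and> convex_wrt s W"

definition seq_complete :: "'a::ab_group_add topology \<Rightarrow> bool" where
  "seq_complete X \<longleftrightarrow>
     (\<forall>x::nat \<Rightarrow> 'a. range x \<subseteq> topspace X \<and>
        (\<forall>U. openin X U \<and> 0 \<in> U \<longrightarrow> (\<exists>n0. \<forall>m\<ge>n0. \<forall>n\<ge>n0. x m - x n \<in> U))
        \<longrightarrow> (\<exists>l. limitin X x l sequentially))"

definition barrel :: "(complex \<Rightarrow> 'a::ab_group_add \<Rightarrow> 'a) \<Rightarrow> 'a topology \<Rightarrow> 'a set \<Rightarrow> bool" where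
  "barrel s X W \<longleftrightarrow>
     closedin X W \<and> abs_convex_wrt s W \<and> (\<forall>x\<in>topspace X. absorbs s W {x})"

definition barreled :: "(complex \<Rightarrow> 'a::ab_group_add \<Rightarrow> 'a) \<Rightarrow> 'a topology \<Rightarrow> bool" where
  "barreled s X \<longleftrightarrow> (\<forall>W. barrel s X W \<longrightarrow> (\<exists>U. openin X U \<and> 0 \<in> U \<and> U \<subseteq> W))"

definition bounded_wrt :: "(complex \<Rightarrow> 'a::ab_group_add \<Rightarrow> 'a) \<Rightarrow> 'a topology \<Rightarrow> 'a set \<Rightarrow> bool" where
  "bounded_wrt s X B \<longleftrightarrow> B \<subseteq> topspace X \<and> (\<forall>U. openin X U \<and> 0 \<in> U \<longrightarrow> absorbs s U B)"

text \<open>The translation invariant topology on \<open>V\<close> with base \<open>\<B>\<close> of neighbourhoods of zero.\<close>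

definition base_topology :: "'a::ab_group_add set \<Rightarrow> 'a set set \<Rightarrow> 'a topology" where
  "base_topology V \<B> =
     topology (\<lambda>U. U \<subseteq> V \<and> (\<forall>x\<in>U. \<exists>W\<in>\<B>. \<forall>y\<in>V. y - x \<in> W \<longrightarrow> y \<in> U))"

lemma openin_base_topology:
  assumes "\<B> \<noteq> {}" and "\<And>W1 W2. W1 \<in> \<B> \<Longrightarrow> W2 \<in> \<B> \<Longrightarrow> \<exists>W\<in>\<B>. W \<subseteq> W1 \<inter> W2"
  shows "openin (base_topology V \<B>) U \<longleftrightarrow>
           U \<subseteq> V \<and> (\<forall>x\<in>U. \<exists>W\<in>\<B>. \<forall>y\<in>V. y - x \<in> W \<longrightarrow> y \<in> U)"
proof -
  let ?P = "\<lambda>U. U \<subseteq> V \<and> (\<forall>x\<in>U. \<exists>W\<in>\<B>. \<forall>y\<in>V. y - x \<in> W \<longrightarrow> y \<in> U)"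
  have "istopology ?P"
    unfolding istopology_def
  proof (intro conjI allI impI)
    fix S T assume S: "?P S" and T: "?P T"
    show "S \<inter> T \<subseteq> V" using S by blast
    show "\<forall>x\<in>S \<inter> T. \<exists>W\<in>\<B>. \<forall>y\<in>V. y - x \<in> W \<longrightarrow> y \<in> S \<inter> T"
    proof
      fix x assume "x \<in> S \<inter> T"
      then obtain W1 W2 where W: "W1 \<in> \<B>" "W2 \<in> \<B>"
        "\<forall>y\<in>V. y - x \<in> W1 \<longrightarrow> y \<in> S" "\<forall>y\<in>V. y - x \<in> W2 \<longrightarrow> y \<in> T"
        using S T by blast
      obtain W where "W \<in> \<B>" "W \<subseteq> W1 \<inter> W2" using assms(2) W by blast
      then show "\<exists>W\<in>\<B>. \<forall>y\<in>V. y - x \<in> W \<longrightarrow> y \<in> S \<inter> T"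
        using W by blast
    qed
  next
    fix \<K> assume "\<forall>K\<in>\<K>. ?P K"
    then show "\<Union>\<K> \<subseteq> V" "\<forall>x\<in>\<Union>\<K>. \<exists>W\<in>\<B>. \<forall>y\<in>V. y - x \<in> W \<longrightarrow> y \<in> \<Union>\<K>"
      by (blast, metis UnionE UnionI)
  qed
  then show ?thesis
    unfolding base_topology_def by (simp add: topology_inverse')
qed

lemma topspace_base_topology:
  assumes "\<B> \<noteq> {}" and "\<And>W1 W2. W1 \<in> \<B> \<Longrightarrow> W2 \<in> \<B> \<Longrightarrow> \<exists>W\<in>\<B>. W \<subseteq> W1 \<inter> W2"
  shows "topspace (base_topology V \<B>) = V"
proof
  show "topspace (base_topology V \<B>) \<subseteq> V"
    using openin_base_topology[OF assms, of V "topspace (base_topology V \<B>)"] by auto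
  have "openin (base_topology V \<B>) V"
    using assms(1) by (subst openin_base_topology[OF assms]) auto
  then show "V \<subseteq> topspace (base_topology V \<B>)" by (rule openin_subset)
qed


section \<open>Spaces of continuous linear operators\<close>

definition fscale :: "(complex \<Rightarrow> 'b \<Rightarrow> 'b) \<Rightarrow> complex \<Rightarrow> ('a \<Rightarrow> 'b) \<Rightarrow> 'a \<Rightarrow> 'b" where
  "fscale s c f = (\<lambda>x. s c (f x))"

text \<open>
  \<open>L(X, Y)\<close>. Operators are total functions on the type, so they are normalised to vanish outside
  \<open>topspace X\<close>; this makes an operator determined by its values on the space.
\<close>

definition lin_ops ::
  "(complex \<Rightarrow> 'a::ab_group_add \<Rightarrow> 'a) \<Rightarrow> 'a topology \<Rightarrow>
   (complex \<Rightarrow> 'b::ab_group_add \<Rightarrow> 'b) \<Rightarrow> 'b topology \<Rightarrow> ('a \<Rightarrow> 'b) set" where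
  "lin_ops s X t Y = {f. continuous_map X Y f \<and>
     (\<forall>x\<in>topspace X. \<forall>y\<in>topspace X. f (x + y) = f x + f y) \<and>
     (\<forall>c. \<forall>x\<in>topspace X. f (s c x) = t c (f x)) \<and>
     (\<forall>x. x \<notin> topspace X \<longrightarrow> f x = 0)}"

abbreviation end_ops :: "(complex \<Rightarrow> 'a::ab_group_add \<Rightarrow> 'a) \<Rightarrow> 'a topology \<Rightarrow> ('a \<Rightarrow> 'a) set" where
  "end_ops s X \<equiv> lin_ops s X s X"

definition end_ops_base ::
  "(complex \<Rightarrow> 'a::ab_group_add \<Rightarrow> 'a) \<Rightarrow> 'a topology \<Rightarrow> ('a \<Rightarrow> 'a) set set" where
  "end_ops_base s X = {{f \<in> end_ops s X. f ` B \<subseteq> U} | B U. bounded_wrt s X B \<and> openin X U \<and> 0 \<in> U}"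

text \<open>\<open>L(X)\<close> with the topology of uniform convergence on bounded sets.\<close>

definition op_space :: "(complex \<Rightarrow> 'a::ab_group_add \<Rightarrow> 'a) \<Rightarrow> 'a topology \<Rightarrow> ('a \<Rightarrow> 'a) topology" where
  "op_space s X = base_topology (end_ops s X) (end_ops_base s X)"

lemma bounded_wrt_Un:
  assumes "bounded_wrt s X A" "bounded_wrt s X B"
  shows "bounded_wrt s X (A \<union> B)"
proof -
  have "absorbs s U (A \<union> B)" if ab: "absorbs s U A" "absorbs s U B" for U
  proof -
    obtain r1 r2 where "r1 > 0" "r2 > 0"
      "\<forall>c. r1 \<le> cmod c \<longrightarrow> A \<subseteq> s c ` U" "\<forall>c. r2 \<le> cmod c \<longrightarrow> B \<subseteq> s c ` U"
      using ab unfolding absorbs_def by metis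
    then show ?thesis
      unfolding absorbs_def by (intro exI[of _ "max r1 r2"]) auto
  qed
  with assms show ?thesis unfolding bounded_wrt_def by simp
qed

lemma end_ops_base_directed:
  assumes "W1 \<in> end_ops_base s X" "W2 \<in> end_ops_base s X"
  shows "\<exists>W\<in>end_ops_base s X. W \<subseteq> W1 \<inter> W2"
proof -
  obtain B1 U1 B2 U2 where
    1: "W1 = {f \<in> end_ops s X. f ` B1 \<subseteq> U1}" "bounded_wrt s X B1" "openin X U1" "0 \<in> U1" and
    2: "W2 = {f \<in> end_ops s X. f ` B2 \<subseteq> U2}" "bounded_wrt s X B2" "openin X U2" "0 \<in> U2"
    using assms unfolding end_ops_base_def by blast
  have "{f \<in> end_ops s X. f ` (B1 \<union> B2) \<subseteq> U1 \<inter> U2} \<in> end_ops_base s X"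
    unfolding end_ops_base_def using 1 2 by (blast intro: bounded_wrt_Un)
  then show ?thesis
    by (rule bexI[rotated]) (use 1 2 in auto)
qed

lemma end_ops_base_nonempty:
  assumes "0 \<in> topspace X"
  shows "end_ops_base s X \<noteq> {}"
proof -
  have "bounded_wrt s X {}" unfolding bounded_wrt_def absorbs_def by (auto intro: exI[of _ 1])
  then have "{f \<in> end_ops s X. f ` {} \<subseteq> topspace X} \<in> end_ops_base s X"
    unfolding end_ops_base_def using assms openin_topspace by blast
  then show ?thesis by blast
qed

lemma topspace_op_space:
  "0 \<in> topspace X \<Longrightarrow> topspace (op_space s X) = end_ops s X"
  unfolding op_space_def
  by (rule topspace_base_topology[OF end_ops_base_nonempty end_ops_base_directed])

lemma openin_op_space:
  assumes "0 \<in> topspace X"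
  shows "openin (op_space s X) \<U> \<longleftrightarrow> \<U> \<subseteq> end_ops s X \<and>
    (\<forall>f\<in>\<U>. \<exists>W\<in>end_ops_base s X. \<forall>g\<in>end_ops s X. g - f \<in> W \<longrightarrow> g \<in> \<U>)"
  unfolding op_space_def
  by (rule openin_base_topology[OF end_ops_base_nonempty[OF assms] end_ops_base_directed])


section \<open>Integrals of functions with values in a locally convex space\<close>

text \<open>
  The integral over \<open>[a, b]\<close> as the limit of Riemann sums along the division filter, exactly as in
  \<open>has_integral_cbox\<close>. It extends the Riemann integral, so it is the usual one for
  continuous integrands; unlike the latter it also covers integrands with an integrable singularity
  at an end point, such as those involving \<open>g\<^sub>\<alpha>\<close> with \<open>\<alpha> < 1\<close>.
\<close>

definition has_lcs_integral ::
  "(complex \<Rightarrow> 'a::ab_group_add \<Rightarrow> 'a) \<Rightarrow> 'a topology \<Rightarrow> (real \<Rightarrow> 'a) \<Rightarrow> real \<Rightarrow> real \<Rightarrow> 'a \<Rightarrow> bool" where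
  "has_lcs_integral s X f a b I \<longleftrightarrow>
     limitin X (\<lambda>p. \<Sum>(t, k)\<in>p. s (of_real (measure lborel k)) (f t)) I (division_filter {a..b})"

definition has_lcs_integral_at_top ::
  "(complex \<Rightarrow> 'a::ab_group_add \<Rightarrow> 'a) \<Rightarrow> 'a topology \<Rightarrow> (real \<Rightarrow> 'a) \<Rightarrow> real \<Rightarrow> 'a \<Rightarrow> bool" where
  "has_lcs_integral_at_top s X f a I \<longleftrightarrow>
     (\<exists>J. (\<forall>b\<ge>a. has_lcs_integral s X f a b (J b)) \<and> limitin X J I at_top)"


section \<open>Test functions and vector-valued distributions\<close>

definition vderiv :: "(real \<Rightarrow> complex) \<Rightarrow> real \<Rightarrow> complex" where
  "vderiv \<phi> = (\<lambda>t. vector_derivative \<phi> (at t))"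

abbreviation nderiv :: "nat \<Rightarrow> (real \<Rightarrow> complex) \<Rightarrow> real \<Rightarrow> complex" where
  "nderiv n \<phi> \<equiv> (vderiv ^^ n) \<phi>"

definition fsupp :: "(real \<Rightarrow> complex) \<Rightarrow> real set" where
  "fsupp \<phi> = closure {t. \<phi> t \<noteq> 0}"

definition test_functions :: "(real \<Rightarrow> complex) set" where
  "test_functions = {\<phi>. (\<forall>n t. nderiv n \<phi> differentiable (at t)) \<and> compact (fsupp \<phi>)}"

definition test_functions_on :: "real set \<Rightarrow> (real \<Rightarrow> complex) set" where
  "test_functions_on \<Omega> = {\<phi> \<in> test_functions. fsupp \<phi> \<subseteq> \<Omega>}"

text \<open>
  The inductive limit topology of the spaces \<open>\<D>\<^sub>K\<close>: a base of neighbourhoods of zero is formed by the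
  absolutely convex \<open>W\<close> for which each \<open>W \<inter> \<D>\<^sub>K\<close> is a neighbourhood of zero in \<open>\<D>\<^sub>K\<close>.
\<close>

definition test_base :: "(real \<Rightarrow> complex) set set" where
  "test_base = {W. W \<subseteq> test_functions \<and> abs_convex_wrt (fscale (*)) W \<and>
     (\<forall>K. compact K \<longrightarrow> (\<exists>n. \<exists>\<epsilon>>0. \<forall>\<phi>\<in>test_functions_on K.
        (\<forall>i\<le>n. \<forall>t. cmod (nderiv i \<phi> t) < \<epsilon>) \<longrightarrow> \<phi> \<in> W))}"

definition test_space :: "(real \<Rightarrow> complex) topology" where
  "test_space = base_topology test_functions test_base"

lemma test_base_Int:
  assumes "W1 \<in> test_base" "W2 \<in> test_base"
  shows "W1 \<inter> W2 \<in> test_base"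
proof -
  have "\<exists>n. \<exists>\<epsilon>>0. \<forall>\<phi>\<in>test_functions_on K.
          (\<forall>i\<le>n. \<forall>t. cmod (nderiv i \<phi> t) < \<epsilon>) \<longrightarrow> \<phi> \<in> W1 \<inter> W2" if K: "compact K" for K
  proof -
    have "\<exists>n. \<exists>\<epsilon>>0. \<forall>\<phi>\<in>test_functions_on K.
            (\<forall>i\<le>n. \<forall>t. cmod (nderiv i \<phi> t) < \<epsilon>) \<longrightarrow> \<phi> \<in> W" if "W \<in> test_base" for W
      using that K by (simp add: test_base_def)
    from this[OF assms(1)] this[OF assms(2)] obtain n1 e1 n2 e2 where "e1 > 0" "e2 > 0"
      "\<forall>\<phi>\<in>test_functions_on K. (\<forall>i\<le>n1. \<forall>t. cmod (nderiv i \<phi> t) < e1) \<longrightarrow> \<phi> \<in> W1"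
      "\<forall>\<phi>\<in>test_functions_on K. (\<forall>i\<le>n2. \<forall>t. cmod (nderiv i \<phi> t) < e2) \<longrightarrow> \<phi> \<in> W2"
      by (elim exE conjE)
    then show ?thesis
      by (intro exI[of _ "max n1 n2"] exI[of _ "min e1 e2"]) (simp add: le_max_iff_disj)
  qed
  with assms show ?thesis
    unfolding test_base_def by (auto simp: abs_convex_wrt_def)
qed

lemma abs_convex_test_functions: "abs_convex_wrt (fscale (*)) test_functions"
proof -
  have "fscale (*) a \<phi> + fscale (*) b \<psi> \<in> test_functions"
    if \<phi>: "\<phi> \<in> test_functions" and \<psi>: "\<psi> \<in> test_functions" for a b \<phi> \<psi>
  proof -
    have d: "nderiv n \<phi> differentiable (at t)" "nderiv n \<psi> differentiable (at t)" for n t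
      using that unfolding test_functions_def by auto
    have eq: "nderiv n (fscale (*) a \<phi> + fscale (*) b \<psi>)
                = fscale (*) a (nderiv n \<phi>) + fscale (*) b (nderiv n \<psi>)" for n
    proof (induction n)
      case (Suc n)
      have "vderiv (\<lambda>t. a * nderiv n \<phi> t + b * nderiv n \<psi> t) t
              = a * nderiv (Suc n) \<phi> t + b * nderiv (Suc n) \<psi> t" for t
      proof -
        have "(nderiv n \<phi> has_vector_derivative nderiv (Suc n) \<phi> t) (at t)"
             "(nderiv n \<psi> has_vector_derivative nderiv (Suc n) \<psi> t) (at t)"
          using d[of n t] by (simp_all add: vderiv_def vector_derivative_works)
        then show ?thesis
          unfolding vderiv_def[of "\<lambda>t. a * nderiv n \<phi> t + b * nderiv n \<psi> t"]
          by (intro vector_derivative_at has_vector_derivative_add has_vector_derivative_mult_right)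
      qed
      then show ?case
        using Suc by (auto simp: fscale_def plus_fun_def)
    qed simp
    have "fsupp (fscale (*) a \<phi> + fscale (*) b \<psi>) \<subseteq> fsupp \<phi> \<union> fsupp \<psi>"
      unfolding fsupp_def closure_Un[symmetric]
      by (rule closure_mono) (auto simp: fscale_def)
    moreover have "compact (fsupp \<phi> \<union> fsupp \<psi>)"
      using that by (auto simp: test_functions_def)
    ultimately have "compact (fsupp (fscale (*) a \<phi> + fscale (*) b \<psi>))"
      by (metis closed_closure closed_Int_compact fsupp_def inf.absorb1)
    moreover have "(\<lambda>t. a * nderiv n \<phi> t + b * nderiv n \<psi> t) differentiable (at t)" for n t
      using d[of n t] by (intro derivative_intros) auto
    ultimately show ?thesis
      unfolding test_functions_def mem_Collect_eq eq by (simp add: fscale_def plus_fun_def)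
  qed
  then show ?thesis unfolding abs_convex_wrt_def by blast
qed

lemma test_base_nonempty: "test_base \<noteq> {}"
proof -
  have "test_functions \<in> test_base"
    using abs_convex_test_functions
    unfolding test_base_def test_functions_on_def by (auto intro: zero_less_one)
  then show ?thesis by blast
qed

lemma topspace_test_space: "topspace test_space = test_functions"
  unfolding test_space_def
  by (rule topspace_base_topology[OF test_base_nonempty]) (blast intro: test_base_Int)

lemma openin_test_space:
  "openin test_space U \<longleftrightarrow> U \<subseteq> test_functions \<and>
     (\<forall>\<phi>\<in>U. \<exists>W\<in>test_base. \<forall>\<psi>\<in>test_functions. \<psi> - \<phi> \<in> W \<longrightarrow> \<psi> \<in> U)"
  unfolding test_space_def
  by (rule openin_base_topology[OF test_base_nonempty]) (blast intro: test_base_Int)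

text \<open>\<open>\<D>'(X) = L(\<D>, X)\<close>.\<close>

definition distributions ::
  "(complex \<Rightarrow> 'a::ab_group_add \<Rightarrow> 'a) \<Rightarrow> 'a topology \<Rightarrow> ((real \<Rightarrow> complex) \<Rightarrow> 'a) set" where
  "distributions s X = lin_ops (fscale (*)) test_space s X"

definition dsupp :: "((real \<Rightarrow> complex) \<Rightarrow> 'a::zero) \<Rightarrow> real set" where
  "dsupp G = - \<Union>{U. open U \<and> (\<forall>\<phi>\<in>test_functions_on U. G \<phi> = 0)}"

definition distributions0 ::
  "(complex \<Rightarrow> 'a::ab_group_add \<Rightarrow> 'a) \<Rightarrow> 'a topology \<Rightarrow> ((real \<Rightarrow> complex) \<Rightarrow> 'a) set" where
  "distributions0 s X = {G \<in> distributions s X. dsupp G \<subseteq> {0..}}"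

definition finite_order_on ::
  "(complex \<Rightarrow> 'a::ab_group_add \<Rightarrow> 'a) \<Rightarrow> 'a topology \<Rightarrow> real \<Rightarrow> ((real \<Rightarrow> complex) \<Rightarrow> 'a) \<Rightarrow> bool" where
  "finite_order_on s X \<tau> G \<longleftrightarrow>
     (\<exists>n f. continuous_map (top_of_set {-\<tau>..\<tau>}) X f \<and>
        (\<forall>\<phi>\<in>test_functions_on {-\<tau><..<\<tau>}. \<exists>I.
           has_lcs_integral s X (\<lambda>t. s (nderiv n \<phi> t) (f t)) (-\<tau>) \<tau> I \<and> G \<phi> = s ((-1) ^ n) I))"

definition finite_order ::
  "(complex \<Rightarrow> 'a::ab_group_add \<Rightarrow> 'a) \<Rightarrow> 'a topology \<Rightarrow> ((real \<Rightarrow> complex) \<Rightarrow> 'a) \<Rightarrow> bool" where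
  "finite_order s X G \<longleftrightarrow> (\<forall>\<tau>>0. finite_order_on s X \<tau> G)"

text \<open>\<open>\<delta>\<^sup>(\<^sup>i\<^sup>) \<otimes> x\<close>\<close>

definition delta_tensor ::
  "(complex \<Rightarrow> 'a \<Rightarrow> 'a) \<Rightarrow> nat \<Rightarrow> 'a \<Rightarrow> (real \<Rightarrow> complex) \<Rightarrow> 'a" where
  "delta_tensor s i x \<phi> = s ((-1) ^ i * nderiv i \<phi> 0) x"

definition admissible :: "(complex \<Rightarrow> 'a::ab_group_add \<Rightarrow> 'a) \<Rightarrow> 'a topology \<Rightarrow> bool" where
  "admissible s X \<longleftrightarrow>
     (\<forall>G\<in>distributions s X. dsupp G \<subseteq> {0} \<longrightarrow>
        (\<exists>k x. (\<forall>i\<le>k. x i \<in> topspace X) \<and>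
           (\<forall>\<phi>\<in>test_functions. G \<phi> = (\<Sum>i\<le>k. delta_tensor s i (x i) \<phi>))))"


section \<open>Pre-(C-DS)\<close>

definition conv0 :: "(real \<Rightarrow> complex) \<Rightarrow> (real \<Rightarrow> complex) \<Rightarrow> real \<Rightarrow> complex" where
  "conv0 \<phi> \<psi> = (\<lambda>t. LBINT r=0..ereal t. \<phi> (t - r) * \<psi> r)"

definition pre_CDS ::
  "(complex \<Rightarrow> 'a::ab_group_add \<Rightarrow> 'a) \<Rightarrow> 'a topology \<Rightarrow> ('a \<Rightarrow> 'a) \<Rightarrow>
   ((real \<Rightarrow> complex) \<Rightarrow> 'a \<Rightarrow> 'a) \<Rightarrow> bool" where
  "pre_CDS s E C G \<longleftrightarrow>
     G \<in> distributions0 (fscale s) (op_space s E) \<and>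
     (\<forall>\<phi>\<in>test_functions. C \<circ> G \<phi> = G \<phi> \<circ> C) \<and>
     (\<forall>\<phi>\<in>test_functions. \<forall>\<psi>\<in>test_functions. G (conv0 \<phi> \<psi>) \<circ> C = G \<phi> \<circ> G \<psi>)"

definition kernel_space :: "'a::ab_group_add topology \<Rightarrow> ((real \<Rightarrow> complex) \<Rightarrow> 'a \<Rightarrow> 'a) \<Rightarrow> 'a set" where
  "kernel_space E G = {x \<in> topspace E. \<forall>\<phi>\<in>test_functions_on {0..}. G \<phi> x = 0}"

definition generator ::
  "'a::ab_group_add topology \<Rightarrow> ((real \<Rightarrow> complex) \<Rightarrow> 'a \<Rightarrow> 'a) \<Rightarrow> ('a \<times> 'a) set" where
  "generator E G = {(x, y) \<in> topspace E \<times> topspace E.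
     \<forall>\<phi>\<in>test_functions_on {0..}. G (- vderiv \<phi>) x = G \<phi> y}"


section \<open>Integrated \<open>C\<close>-semigroups and existence families\<close>

text \<open>A multivalued linear operator is identified with its graph.\<close>

definition mlo ::
  "(complex \<Rightarrow> 'a::ab_group_add \<Rightarrow> 'a) \<Rightarrow> 'a topology \<Rightarrow> ('a \<times> 'a) set \<Rightarrow> bool" where
  "mlo s E A \<longleftrightarrow> A \<subseteq> topspace E \<times> topspace E \<and> (0, 0) \<in> A \<and>
     (\<forall>(x, y)\<in>A. \<forall>(x', y')\<in>A. (x + x', y + y') \<in> A) \<and> (\<forall>c. \<forall>(x, y)\<in>A. (s c x, s c y) \<in> A)"

definition gfun :: "real \<Rightarrow> real \<Rightarrow> real" where
  "gfun \<alpha> t = t powr (\<alpha> - 1) / Gamma \<alpha>"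

text \<open>
  Families on \<open>[0, \<tau>)\<close>, where \<open>0 < \<tau> \<le> \<infinity>\<close>, are represented by total functions on the reals whose
  values outside \<open>[0, \<tau>)\<close> are irrelevant; the local case is \<open>\<tau> < \<infinity>\<close>.
\<close>

definition strongly_continuous_family ::
  "(complex \<Rightarrow> 'a::ab_group_add \<Rightarrow> 'a) \<Rightarrow> 'a topology \<Rightarrow> ereal \<Rightarrow> (real \<Rightarrow> 'a \<Rightarrow> 'a) \<Rightarrow> bool" where
  "strongly_continuous_family s E \<tau> S \<longleftrightarrow>
     (\<forall>t. 0 \<le> t \<and> ereal t < \<tau> \<longrightarrow> S t \<in> end_ops s E) \<and>
     (\<forall>x\<in>topspace E. continuous_map (top_of_set {t. 0 \<le> t \<and> ereal t < \<tau>}) E (\<lambda>t. S t x))"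

definition integrated_C_semigroup ::
  "(complex \<Rightarrow> 'a::ab_group_add \<Rightarrow> 'a) \<Rightarrow> 'a topology \<Rightarrow> ('a \<Rightarrow> 'a) \<Rightarrow> real \<Rightarrow> ereal \<Rightarrow>
   (real \<Rightarrow> 'a \<Rightarrow> 'a) \<Rightarrow> bool" where
  "integrated_C_semigroup s E C \<alpha> \<tau> S \<longleftrightarrow>
     0 < \<alpha> \<and> 0 < \<tau> \<and> strongly_continuous_family s E \<tau> S \<and>
     (\<forall>t. 0 \<le> t \<and> ereal t < \<tau> \<longrightarrow> S t \<circ> C = C \<circ> S t) \<and>
     (\<forall>x\<in>topspace E. \<forall>t u. 0 \<le> t \<and> 0 \<le> u \<and> ereal (t + u) < \<tau> \<longrightarrow>
        (let h = \<lambda>r. s (of_real (gfun \<alpha> (t + u - r))) (S r (C x)) in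
         \<exists>I1 I2 I3. has_lcs_integral s E h 0 (t + u) I1 \<and>
           has_lcs_integral s E h 0 t I2 \<and> has_lcs_integral s E h 0 u I3 \<and>
           S t (S u x) = I1 - I2 - I3))"

definition integrated_C_existence_family ::
  "(complex \<Rightarrow> 'a::ab_group_add \<Rightarrow> 'a) \<Rightarrow> 'a topology \<Rightarrow> ('a \<Rightarrow> 'a) \<Rightarrow> real \<Rightarrow> ereal \<Rightarrow>
   (real \<Rightarrow> 'a \<Rightarrow> 'a) \<Rightarrow> ('a \<times> 'a) set \<Rightarrow> bool" where
  "integrated_C_existence_family s E C \<alpha> \<tau> S A \<longleftrightarrow>
     0 < \<alpha> \<and> 0 < \<tau> \<and> strongly_continuous_family s E \<tau> S \<and> mlo s E A \<and>
     (\<forall>x\<in>topspace E. \<forall>t. 0 \<le> t \<and> ereal t < \<tau> \<longrightarrow>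
        (\<exists>I. has_lcs_integral s E (\<lambda>r. S r x) 0 t I \<and> I \<in> Domain A \<and>
           (I, S t x - s (of_real (gfun (\<alpha> + 1) t)) (C x)) \<in> A))"

end

theory Submission
  imports Defs
begin

text \<open>
  Write \<open>G\<close> for the given operator-valued distribution. Suppose that it has order \<open>k\<close> on \<open>(-M, M)\<close> with
  \<open>M = \<tau> + 3\<close>. The family is the \<open>k + 2\<close>-fold antiderivative of \<open>G\<close> with support in \<open>[0, \<infinity>)\<close>; informally
  \<open>S t = G (\<phi>\<^sub>t)\<close> with \<open>\<phi>\<^sub>t v = max 0 (t - v) ^ (k + 1) / (k + 1)!\<close>. The function \<open>\<phi>\<^sub>t\<close> is not smooth and
  does not have compact support, so \<open>G\<close> has to be extended.

  The extension rests on the estimate \<open>p (G \<phi> x) \<le> sup\<^sub>[\<^sub>0\<^sub>,\<^sub>M\<^sub>] \<bar>\<phi>\<^sup>(\<^sup>k\<^sup>)\<bar> * q x\<close>, where for each continuous seminorm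
  \<open>p\<close> there is a continuous seminorm \<open>q\<close> that serves all \<open>x\<close> and all \<open>\<phi>\<close>
  supported in \<open>(-M, M)\<close> (\<open>order_estimate\<close>). With the supremum
  over \<open>[-M, M]\<close> this is the representation of \<open>G\<close> by a continuous operator-valued function, which is
  equicontinuous because the space is barreled. The supremum may be restricted to \<open>[0, M]\<close> because \<open>G\<close>
  is supported there: the values of \<open>\<phi>\<^sup>(\<^sup>k\<^sup>)\<close> left of a small negative number can be cut off before \<open>\<phi>\<close>
  is recovered from them by \<open>k\<close> integrations.

  By the estimate, \<open>G \<phi> x\<close> depends only on the continuous function \<open>(-1)\<^sup>k \<phi>\<^sup>(\<^sup>k\<^sup>)\<close> on \<open>[0, M]\<close>, and depends
  on it continuously in the uniform norm. The relation \<open>rep x y l\<close> is the closure of the graph of this map;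
  sequential completeness gives values to all uniform limits \<open>y\<close>. In this picture \<open>S t x\<close> is the value at
  \<open>y v = max 0 (t - v)\<close>. Since \<open>y\<close> depends continuously on \<open>t\<close>, every integral of the form
  \<open>\<integral> c r S r x dr\<close> is the value at the function \<open>\<integral> c r max 0 (r - v) dr\<close>: uniform Riemann sums are carried over
  to Riemann sums in the locally convex space (\<open>rep_integral\<close>). Every assertion about integrals
  of \<open>S\<close> is thereby reduced to an identity between scalar functions of \<open>v\<close>.

  For the representation of \<open>G\<close> the identity is Taylor's formula with remainder. For the
  existence family, \<open>(G \<theta> x, G (- \<theta>') x - \<theta> 0 C x)\<close> lies in the generator for every test function \<open>\<theta>\<close>,
  by partial integration in the convolution, and \<open>\<theta>\<close> is made to approach \<open>max 0 (t - v) ^ (k + 2) / (k + 2)!\<close>.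
  For the semigroup law, \<open>G (\<phi> *\<^sub>0 \<psi>) (C x) = G \<phi> (G \<psi> x)\<close> is applied to test functions approaching \<open>\<phi>\<^sub>t\<close>
  and \<open>\<phi>\<^sub>u\<close>; the \<open>k\<close>-th derivative of the convolution converges uniformly, and the limit is computed
  explicitly (\<open>semigroup_kernel_identity\<close>).

  On the kernel space \<open>G\<close> is a combination of derivatives of the Dirac distribution. The approximants
  of \<open>\<phi>\<^sub>t\<close>, \<open>t > 0\<close>, coincide near \<open>0\<close> with polynomials of degree at most \<open>k + 1\<close>, so \<open>S t x\<close> vanishes if
  \<open>T\<^sub>0 x, \<dots>, T\<^sub>k\<^sub>+\<^sub>1 x\<close> do; conversely the \<open>T\<^sub>i x\<close> are recovered from \<open>G\<close> by test functions with prescribed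
  derivatives at \<open>0\<close>.
\<close>


section \<open>Smooth functions and test functions\<close>

definition smooth :: "(real \<Rightarrow> complex) \<Rightarrow> bool" where
  "smooth \<phi> \<longleftrightarrow> (\<forall>n t. nderiv n \<phi> differentiable (at t))"

text \<open>
  Closure properties of smoothness are proved by induction on the number of derivatives, and
  this is the induction statement: the product rule for \<open>n + 1\<close> derivatives needs the closure under
  products and sums for \<open>n\<close> derivatives only.
\<close>

definition kdiff :: "nat \<Rightarrow> (real \<Rightarrow> complex) \<Rightarrow> bool" where
  "kdiff n \<phi> \<longleftrightarrow> (\<forall>m\<le>n. \<forall>t. nderiv m \<phi> differentiable (at t))"

lemma smooth_kdiff: "smooth \<phi> \<longleftrightarrow> (\<forall>n. kdiff n \<phi>)"
  by (auto simp: smooth_def kdiff_def)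

lemma vderiv_eqI: "(\<And>t. (\<phi> has_vector_derivative \<psi> t) (at t)) \<Longrightarrow> vderiv \<phi> = \<psi>"
  by (auto simp: vderiv_def fun_eq_iff intro: vector_derivative_at)

lemma nderiv_Suc_right: "nderiv (Suc n) \<phi> = nderiv n (vderiv \<phi>)"
  by (simp only: funpow_Suc_right o_apply)

lemma kdiff_0: "kdiff 0 \<phi> \<longleftrightarrow> (\<forall>t. \<phi> differentiable (at t))"
  by (simp add: kdiff_def)

lemma kdiff_Suc: "kdiff (Suc n) \<phi> \<longleftrightarrow> (\<forall>t. \<phi> differentiable (at t)) \<and> kdiff n (vderiv \<phi>)"
proof -
  have "kdiff (Suc n) \<phi> \<longleftrightarrow> (\<forall>t. nderiv 0 \<phi> differentiable (at t)) \<and>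
      (\<forall>m\<le>n. \<forall>t. nderiv (Suc m) \<phi> differentiable (at t))"
    unfolding kdiff_def by (metis Suc_le_mono le0 not0_implies_Suc)
  then show ?thesis by (simp add: kdiff_def nderiv_Suc_right del: funpow.simps(2)) 
qed

lemma kdiff_SucI:
  "(\<And>t. (\<phi> has_vector_derivative \<phi>' t) (at t)) \<Longrightarrow> kdiff n \<phi>' \<Longrightarrow> kdiff (Suc n) \<phi>"
  unfolding kdiff_Suc using vderiv_eqI[of \<phi> \<phi>'] differentiableI_vector by metis

lemma kdiff_D: "kdiff n \<phi> \<Longrightarrow> (\<phi> has_vector_derivative vderiv \<phi> t) (at t)"
  unfolding kdiff_def vderiv_def vector_derivative_works[symmetric] by (metis funpow_0 le0)

lemma kdiff_SucD: "kdiff (Suc n) \<phi> \<Longrightarrow> kdiff n \<phi>"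
  by (auto simp: kdiff_def)

lemma kdiff_0I: "(\<And>t. (\<phi> has_vector_derivative \<phi>' t) (at t)) \<Longrightarrow> kdiff 0 \<phi>"
  by (auto simp: kdiff_0 intro: differentiableI_vector)

lemma kdiff_add: "kdiff n \<phi> \<Longrightarrow> kdiff n \<psi> \<Longrightarrow> kdiff n (\<lambda>t. \<phi> t + \<psi> t)"
proof (induction n arbitrary: \<phi> \<psi>)
  case 0 then show ?case by (auto simp: kdiff_0)
next
  case (Suc n)
  show ?case
    by (rule kdiff_SucI[OF has_vector_derivative_add[OF kdiff_D[OF Suc.prems(1)] kdiff_D[OF Suc.prems(2)]]])
       (use Suc in \<open>auto simp: kdiff_Suc\<close>)
qed

lemma kdiff_mult: "kdiff n \<phi> \<Longrightarrow> kdiff n \<psi> \<Longrightarrow> kdiff n (\<lambda>t. \<phi> t * \<psi> t)"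
proof (induction n arbitrary: \<phi> \<psi>)
  case 0 then show ?case by (auto simp: kdiff_0)
next
  case (Suc n)
  show ?case
    by (rule kdiff_SucI[OF has_vector_derivative_mult[OF kdiff_D[OF Suc.prems(1)] kdiff_D[OF Suc.prems(2)]]])
       (use Suc.prems in \<open>auto intro!: kdiff_add Suc.IH kdiff_SucD[OF Suc.prems(1)] kdiff_SucD[OF Suc.prems(2)] simp: kdiff_Suc\<close>)
qed

lemma kdiff_const: "kdiff n (\<lambda>t. c)"
proof (induction n arbitrary: c)
  case (Suc n) then show ?case by (intro kdiff_SucI[of _ "\<lambda>t. 0"]) auto
qed (auto simp: kdiff_0)

lemma kdiff_of_real: "kdiff n complex_of_real"
proof -
  have d: "(complex_of_real has_vector_derivative 1) (at t)" for t
    using has_vector_derivative_of_real[OF DERIV_ident] by simp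
  show ?thesis
    by (cases n) (auto intro!: kdiff_0I[OF d] kdiff_SucI[OF d] kdiff_const)
qed

lemma kdiff_affine: "kdiff n \<phi> \<Longrightarrow> kdiff n (\<lambda>t. \<phi> (a * t + b))"
proof (induction n arbitrary: \<phi>)
  case 0
  have d: "((\<lambda>t. a * t + b) has_vector_derivative a) (at t)" for t
    by (auto intro!: derivative_eq_intros)
  show ?case
    by (rule kdiff_0I[OF vector_diff_chain_at[OF d kdiff_D[OF 0], unfolded o_def]])
next
  case (Suc n)
  have d: "((\<lambda>t. a * t + b) has_vector_derivative a) (at t)" for t
    by (auto intro!: derivative_eq_intros)
  show ?case
    by (rule kdiff_SucI[OF vector_diff_chain_at[OF d kdiff_D[OF Suc.prems], unfolded o_def]])
       (use Suc in \<open>auto simp: scaleR_conv_of_real kdiff_Suc intro!: kdiff_mult kdiff_const\<close>)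
qed

lemma kdiff_inverse:
  assumes "kdiff n \<phi>" and nz: "\<And>t. \<phi> t \<noteq> 0"
  shows "kdiff n (\<lambda>t. inverse (\<phi> t))"
  using assms(1)
proof (induction n)
  case 0
  then show ?case using nz by (auto simp: kdiff_0 intro!: differentiable_inverse)
next
  case (Suc n)
  have d: "((\<lambda>t. inverse (\<phi> t)) has_vector_derivative - (inverse (\<phi> t) * vderiv \<phi> t * inverse (\<phi> t))) (at t)" for t
    using Deriv.has_derivative_inverse[OF nz kdiff_D[OF Suc.prems, unfolded has_vector_derivative_def]]
    by (simp add: has_vector_derivative_def)
  have "kdiff n (\<lambda>t. - 1 * (inverse (\<phi> t) * vderiv \<phi> t * inverse (\<phi> t)))"
    using Suc.IH[OF kdiff_SucD[OF Suc.prems]] Suc.prems by (intro kdiff_mult kdiff_const) (auto simp: kdiff_Suc)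
  then show ?case by (intro kdiff_SucI[OF d]) simp
qed

lemma smooth_add: "smooth \<phi> \<Longrightarrow> smooth \<psi> \<Longrightarrow> smooth (\<lambda>t. \<phi> t + \<psi> t)"
  and smooth_mult: "smooth \<phi> \<Longrightarrow> smooth \<psi> \<Longrightarrow> smooth (\<lambda>t. \<phi> t * \<psi> t)"
  and smooth_const: "smooth (\<lambda>t. c)"
  and smooth_of_real: "smooth complex_of_real"
  and smooth_affine: "smooth \<phi> \<Longrightarrow> smooth (\<lambda>t. \<phi> (a * t + b))"
  and smooth_inverse: "smooth \<phi> \<Longrightarrow> (\<And>t. \<phi> t \<noteq> 0) \<Longrightarrow> smooth (\<lambda>t. inverse (\<phi> t))"
  by (auto simp: smooth_kdiff intro: kdiff_add kdiff_mult kdiff_const kdiff_of_real kdiff_affine kdiff_inverse)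

lemma smooth_uminus: "smooth \<phi> \<Longrightarrow> smooth (\<lambda>t. - \<phi> t)"
  using smooth_mult[OF smooth_const[of "-1"]] by simp

lemma smooth_diff: "smooth \<phi> \<Longrightarrow> smooth \<psi> \<Longrightarrow> smooth (\<lambda>t. \<phi> t - \<psi> t)"
  using smooth_add[OF _ smooth_uminus] by simp

lemma smooth_power: "smooth \<phi> \<Longrightarrow> smooth (\<lambda>t. \<phi> t ^ n)"
  by (induction n) (auto intro: smooth_mult smooth_const)

lemma smooth_D: "smooth \<phi> \<Longrightarrow> (\<phi> has_vector_derivative vderiv \<phi> t) (at t)"
  unfolding smooth_kdiff using kdiff_D by blast

lemma smooth_vderiv: "smooth \<phi> \<Longrightarrow> smooth (vderiv \<phi>)"
  unfolding smooth_def by (metis nderiv_Suc_right)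

lemma smoothI: "(\<And>t. (\<phi> has_vector_derivative \<phi>' t) (at t)) \<Longrightarrow> smooth \<phi>' \<Longrightarrow> smooth \<phi>"
  unfolding smooth_kdiff by (metis kdiff_SucD kdiff_SucI)

lemma smooth_nderiv: "smooth \<phi> \<Longrightarrow> smooth (nderiv n \<phi>)"
  by (induction n) (auto intro: smooth_vderiv)

lemma smooth_nderiv_D: "smooth \<phi> \<Longrightarrow> (nderiv n \<phi> has_vector_derivative nderiv (Suc n) \<phi> t) (at t)"
  using smooth_D[OF smooth_nderiv] by simp

lemma smooth_continuous: "smooth \<phi> \<Longrightarrow> continuous_on S \<phi>"
  by (meson continuous_at_imp_continuous_on has_vector_derivative_continuous smooth_D)

lemma smooth_nderiv_continuous: "smooth \<phi> \<Longrightarrow> continuous_on S (nderiv n \<phi>)"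
  by (intro smooth_continuous smooth_nderiv)

lemma nderiv_add: "smooth \<phi> \<Longrightarrow> smooth \<psi> \<Longrightarrow>
    nderiv n (\<lambda>t. \<phi> t + \<psi> t) = (\<lambda>t. nderiv n \<phi> t + nderiv n \<psi> t)"
proof (induction n)
  case (Suc n)
  show ?case
    unfolding funpow.simps o_apply Suc.IH[OF Suc.prems]
    by (intro vderiv_eqI has_vector_derivative_add smooth_D smooth_nderiv Suc.prems)
qed simp

lemma nderiv_cmult: "smooth \<phi> \<Longrightarrow> nderiv n (\<lambda>t. c * \<phi> t) = (\<lambda>t. c * nderiv n \<phi> t)"
proof (induction n)
  case (Suc n)
  show ?case
    unfolding funpow.simps o_apply Suc.IH[OF Suc.prems]
    by (intro vderiv_eqI has_vector_derivative_mult_right smooth_D smooth_nderiv Suc.prems)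
qed simp

lemma nderiv_uminus: "smooth \<phi> \<Longrightarrow> nderiv n (\<lambda>t. - \<phi> t) = (\<lambda>t. - nderiv n \<phi> t)"
  using nderiv_cmult[of \<phi> n "-1"] by simp

lemma nderiv_diff: "smooth \<phi> \<Longrightarrow> smooth \<psi> \<Longrightarrow>
    nderiv n (\<lambda>t. \<phi> t - \<psi> t) = (\<lambda>t. nderiv n \<phi> t - nderiv n \<psi> t)"
  using nderiv_add[OF _ smooth_uminus] by (simp add: nderiv_uminus)

lemma nderiv_local:
  assumes "open U" "\<And>t. t \<in> U \<Longrightarrow> \<phi> t = \<psi> t" "t \<in> U"
  shows "nderiv n \<phi> t = nderiv n \<psi> t"
  using assms(3)
proof (induction n arbitrary: t)
  case (Suc n)
  have "eventually (\<lambda>u. u \<in> U) (nhds t)" using assms(1) Suc.prems by (rule eventually_nhds_in_open)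
  then have "eventually (\<lambda>u. nderiv n \<phi> u = nderiv n \<psi> u) (nhds t)"
    by eventually_elim (rule Suc.IH)
  then have "vderiv (nderiv n \<phi>) t = vderiv (nderiv n \<psi>) t"
    unfolding vderiv_def[of "nderiv n \<phi>"] vderiv_def[of "nderiv n \<psi>"]
    by (intro vector_derivative_cong_eq refl) auto
  then show ?case by simp
qed (simp add: assms(2))

lemma nderiv_zero: "nderiv n (\<lambda>t. 0) = (\<lambda>t. 0)"
  using nderiv_cmult[OF smooth_const, of n 0] by simp


text \<open>
  The classical functions \<open>p(1/x) e\<^sup>-\<^sup>1\<^sup>/\<^sup>x\<close>, extended by zero to \<open>x \<le> 0\<close>. The class is closed under
  derivatives, hence all its members are smooth; \<open>p = 1\<close> is the building block of all cutoffs.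
\<close>

definition flat :: "real poly \<Rightarrow> real \<Rightarrow> real" where
  "flat p x = (if x > 0 then poly p (inverse x) * exp (- inverse x) else 0)"

lemma poly_exp_decay: "((\<lambda>y::real. poly p y * exp (- y)) \<longlongrightarrow> 0) at_top"
proof -
  have "((\<lambda>y::real. \<Sum>i\<le>degree p. coeff p i * (y ^ i / exp y)) \<longlongrightarrow> (\<Sum>i\<le>degree p. coeff p i * 0)) at_top"
    by (intro tendsto_sum tendsto_mult tendsto_const tendsto_power_div_exp_0)
  then show ?thesis
    by (simp add: poly_altdef sum_distrib_right exp_minus divide_inverse mult.assoc)
qed

lemma flat_deriv:
  "(flat p has_real_derivative flat (pCons 0 (pCons 0 (p - pderiv p))) x) (at x)"
proof -
  consider "x < 0" | "x = 0" | "x > 0" by linarith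
  then show ?thesis
  proof cases
    case 1
    have "((\<lambda>x. 0) has_real_derivative 0) (at x)" by simp
    moreover have "eventually (\<lambda>y. y \<in> {..<0}) (nhds x)" using 1 by (intro eventually_nhds_in_open) auto
    then have "eventually (\<lambda>y. flat p y = 0) (nhds x)" by eventually_elim (simp add: flat_def)
    ultimately show ?thesis using 1 by (subst DERIV_cong_ev[OF refl, of _ "\<lambda>x. 0" _ _ 0]) (auto simp: flat_def)
  next
    case 3
    let ?f = "\<lambda>x. poly p (inverse x) * exp (- inverse x)"
    have "(?f has_real_derivative flat (pCons 0 (pCons 0 (p - pderiv p))) x) (at x)"
    proof -
      have i: "(inverse has_real_derivative - (inverse x * inverse x)) (at x)"
        using DERIV_inverse[of x UNIV] 3 by (simp add: power2_eq_square)
      note DERIV_mult[OF DERIV_chain2[OF poly_DERIV[of p] i] DERIV_chain2[OF DERIV_exp DERIV_minus[OF i]]]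
      then show ?thesis
        by (rule DERIV_cong) (use 3 in \<open>simp add: flat_def algebra_simps\<close>)
    qed
    moreover have "eventually (\<lambda>y. y \<in> {0<..}) (nhds x)" using 3 by (intro eventually_nhds_in_open) auto
    then have "eventually (\<lambda>y. flat p y = ?f y) (nhds x)" by eventually_elim (simp add: flat_def)
    ultimately show ?thesis by (subst DERIV_cong_ev[OF refl _ refl]) auto
  next
    case 2
    have "((\<lambda>y. poly (pCons 0 p) y * exp (- y)) \<longlongrightarrow> 0) at_top" by (rule poly_exp_decay)
    from filterlim_compose[OF this filterlim_inverse_at_top_right]
    have "((\<lambda>h. flat p h / h) \<longlongrightarrow> 0) (at_right 0)"
      by (rule Lim_transform_eventually)
         (auto simp: eventually_at_filter flat_def divide_inverse mult_ac)
    moreover have "((\<lambda>h. flat p h / h) \<longlongrightarrow> 0) (at_left 0)"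
      by (rule Lim_transform_eventually[OF tendsto_const])
         (auto simp: eventually_at_filter flat_def)
    ultimately have "((\<lambda>h. flat p h / h) \<longlongrightarrow> 0) (at 0)" by (intro filterlim_split_at)
    then show ?thesis using 2 by (simp add: has_field_derivative_iff flat_def)
  qed
qed

lemma smooth_flat: "smooth (\<lambda>x. of_real (flat p x))"
proof -
  have d: "((\<lambda>x. complex_of_real (flat p x)) has_vector_derivative
            of_real (flat (pCons 0 (pCons 0 (p - pderiv p))) x)) (at x)" for p x
    using flat_deriv[of p x] by (auto intro: has_vector_derivative_of_real)
  have "kdiff n (\<lambda>x. of_real (flat p x))" for n
  proof (induction n arbitrary: p)
    case 0 show ?case by (rule kdiff_0I[OF d])
  next
    case (Suc n) show ?case by (rule kdiff_SucI[OF d Suc])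
  qed
  then show ?thesis by (simp add: smooth_kdiff)
qed

text \<open>
  The denominator does not vanish, since one of \<open>x\<close> and \<open>1 - x\<close> is positive.
\<close>

definition smooth_step :: "real \<Rightarrow> complex" where
  "smooth_step x = of_real (flat 1 x) * inverse (of_real (flat 1 x) + of_real (flat 1 (1 - x)))"

lemma flat_1_nonneg: "flat 1 x \<ge> 0" and flat_1_pos: "x > 0 \<Longrightarrow> flat 1 x > 0"
  and flat_1_0: "x \<le> 0 \<Longrightarrow> flat 1 x = 0"
  by (auto simp: flat_def)

lemma smooth_step_denominator: "flat 1 x + flat 1 (1 - x) > 0"
  using flat_1_pos[of x] flat_1_pos[of "1 - x"] flat_1_nonneg[of x] flat_1_nonneg[of "1 - x"]
  by (cases "x > 0") linarith+

lemma smooth_smooth_step: "smooth smooth_step"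
proof -
  have s: "smooth (\<lambda>x. complex_of_real (flat 1 (1 - x)))"
    using smooth_affine[OF smooth_flat, of 1 "-1" 1] by simp
  have nz: "complex_of_real (flat 1 x) + of_real (flat 1 (1 - x)) \<noteq> 0" for x
    unfolding of_real_add[symmetric] of_real_eq_0_iff using smooth_step_denominator[of x] by linarith
  show ?thesis
    unfolding smooth_step_def[abs_def]
    by (rule smooth_mult[OF smooth_flat smooth_inverse[OF smooth_add[OF smooth_flat s] nz]])
qed

lemma smooth_step_0: "x \<le> 0 \<Longrightarrow> smooth_step x = 0"
  by (simp add: smooth_step_def flat_1_0)

lemma smooth_step_1: "x \<ge> 1 \<Longrightarrow> smooth_step x = 1"
  using smooth_step_denominator[of x] by (simp add: smooth_step_def flat_1_0)

lemma smooth_step_unit: "\<exists>u. 0 \<le> u \<and> u \<le> 1 \<and> smooth_step x = of_real u"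
proof (intro exI conjI)
  let ?u = "flat 1 x / (flat 1 x + flat 1 (1 - x))"
  show "0 \<le> ?u" using flat_1_nonneg smooth_step_denominator by (simp add: less_imp_le)
  show "?u \<le> 1" using flat_1_nonneg smooth_step_denominator by (simp add: divide_le_eq)
  show "smooth_step x = of_real ?u" by (simp add: smooth_step_def divide_inverse)
qed

lemma norm_smooth_step: "cmod (smooth_step x) \<le> 1" "cmod (1 - smooth_step x) \<le> 1"
proof -
  obtain u where "0 \<le> u" "u \<le> 1" "smooth_step x = of_real u" using smooth_step_unit by blast
  moreover have "1 - complex_of_real u = of_real (1 - u)" by simp
  ultimately show "cmod (smooth_step x) \<le> 1" "cmod (1 - smooth_step x) \<le> 1"
    by (auto simp del: of_real_diff)
qed

lemma fsupp_subset: "closed S \<Longrightarrow> (\<And>t. t \<notin> S \<Longrightarrow> \<phi> t = 0) \<Longrightarrow> fsupp \<phi> \<subseteq> S"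
  unfolding fsupp_def by (rule closure_minimal) auto

lemma closed_fsupp: "closed (fsupp \<phi>)"
  by (simp add: fsupp_def)

lemma not_in_fsupp: "t \<notin> fsupp \<phi> \<Longrightarrow> \<phi> t = 0"
  using closure_subset[of "{t. \<phi> t \<noteq> 0}"] unfolding fsupp_def by (meson mem_Collect_eq subsetD)

lemma test_functions_iff: "\<phi> \<in> test_functions \<longleftrightarrow> smooth \<phi> \<and> compact (fsupp \<phi>)"
  by (simp add: test_functions_def smooth_def)

lemma compact_fsupp: "fsupp \<phi> \<subseteq> S \<Longrightarrow> compact S \<Longrightarrow> compact (fsupp \<phi>)"
  unfolding fsupp_def by (metis closed_Int_compact closed_closure inf.absorb1)

lemma test_functionsI:
  assumes "smooth \<phi>" "\<And>t. t \<notin> {a..b} \<Longrightarrow> \<phi> t = 0"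
  shows "\<phi> \<in> test_functions_on {a..b}"
proof -
  have *: "fsupp \<phi> \<subseteq> {a..b}" using assms(2) by (intro fsupp_subset) auto
  have "compact (fsupp \<phi>)" by (rule compact_fsupp[OF *]) simp
  then show ?thesis using assms(1) * by (simp add: test_functions_on_def test_functions_iff)
qed

lemma test_functions_on_mono: "\<phi> \<in> test_functions_on A \<Longrightarrow> A \<subseteq> B \<Longrightarrow> \<phi> \<in> test_functions_on B"
  by (auto simp: test_functions_on_def)

lemma test_functions_on_UNIV: "test_functions_on UNIV = test_functions"
  by (auto simp: test_functions_on_def)

lemma test_functions_smooth: "\<phi> \<in> test_functions_on A \<Longrightarrow> smooth \<phi>"
  and test_functions_on_test: "\<phi> \<in> test_functions_on A \<Longrightarrow> \<phi> \<in> test_functions"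
  by (simp_all add: test_functions_on_def test_functions_iff)

lemma test_function_zero:
  "\<phi> \<in> test_functions_on A \<Longrightarrow> t \<notin> A \<Longrightarrow> \<phi> t = 0"
  unfolding test_functions_on_def using not_in_fsupp[of t \<phi>] by blast

lemma nderiv_not_in_fsupp:
  assumes "t \<notin> fsupp \<phi>"
  shows "nderiv n \<phi> t = 0"
proof -
  have "nderiv n \<phi> t = nderiv n (\<lambda>t. 0) t"
  proof (rule nderiv_local)
    show "open (- fsupp \<phi>)" using closed_fsupp by (simp add: open_Compl)
    show "\<phi> u = 0" if "u \<in> - fsupp \<phi>" for u using that not_in_fsupp by simp
  qed (use assms in simp)
  then show ?thesis by (simp add: nderiv_zero)
qed

lemma nderiv_zero_outside: "\<phi> \<in> test_functions_on A \<Longrightarrow> t \<notin> A \<Longrightarrow> nderiv n \<phi> t = 0"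
  unfolding test_functions_on_def using nderiv_not_in_fsupp[of t \<phi> n] by blast

lemma test_functions_on_bounds:
  assumes "\<phi> \<in> test_functions_on {a<..<b}" "a < b"
  obtains c d where "a < c" "c \<le> d" "d < b" "\<phi> \<in> test_functions_on {c..d}"
proof (cases "fsupp \<phi> = {}")
  case True
  then have "\<phi> \<in> test_functions_on {(a+b)/2..(a+b)/2}" using assms by (simp add: test_functions_on_def)
  then show thesis using that[of "(a+b)/2" "(a+b)/2"] assms(2) by simp
next
  case False
  have c: "compact (fsupp \<phi>)" and sub: "fsupp \<phi> \<subseteq> {a<..<b}" and t: "\<phi> \<in> test_functions"
    using assms by (simp_all add: test_functions_on_def test_functions_iff)
  obtain c where c1: "c \<in> fsupp \<phi>" "\<forall>t\<in>fsupp \<phi>. c \<le> t" using compact_attains_inf[OF c False] by blast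
  obtain d where d1: "d \<in> fsupp \<phi>" "\<forall>t\<in>fsupp \<phi>. t \<le> d" using compact_attains_sup[OF c False] by blast
  show thesis
  proof (rule that[of c d])
    show "a < c" "d < b" using c1(1) d1(1) sub by auto
    show "c \<le> d" using c1 d1 by blast
    show "\<phi> \<in> test_functions_on {c..d}" using t c1 d1 by (auto simp: test_functions_on_def)
  qed
qed

lemma test_functions_on_comb:
  assumes "\<phi> \<in> test_functions_on A" "\<psi> \<in> test_functions_on A"
  shows "(\<lambda>t. a * \<phi> t + b * \<psi> t) \<in> test_functions_on A"
proof -
  let ?f = "\<lambda>t. a * \<phi> t + b * \<psi> t"
  have *: "fsupp ?f \<subseteq> fsupp \<phi> \<union> fsupp \<psi>"
    by (rule fsupp_subset) (auto simp: not_in_fsupp intro: closed_fsupp)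
  have s: "fsupp \<phi> \<union> fsupp \<psi> \<subseteq> A" "compact (fsupp \<phi> \<union> fsupp \<psi>)" "smooth \<phi>" "smooth \<psi>"
    using assms by (auto simp: test_functions_on_def test_functions_iff)
  have "smooth ?f" by (intro smooth_add smooth_mult smooth_const s)
  then show ?thesis
    using compact_fsupp[OF * s(2)] * s(1) by (auto simp: test_functions_on_def test_functions_iff)
qed

lemma test_functions_on_cmult: "\<phi> \<in> test_functions_on A \<Longrightarrow> (\<lambda>t. c * \<phi> t) \<in> test_functions_on A"
  using test_functions_on_comb[of \<phi> A \<phi> c 0] by simp

lemma test_functions_on_diff:
  "\<phi> \<in> test_functions_on A \<Longrightarrow> \<psi> \<in> test_functions_on A \<Longrightarrow> (\<lambda>t. \<phi> t - \<psi> t) \<in> test_functions_on A"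
  using test_functions_on_comb[of \<phi> A \<psi> 1 "-1"] by simp

lemma test_functions_on_mult:
  assumes "\<phi> \<in> test_functions_on A" "smooth \<psi>"
  shows "(\<lambda>t. \<psi> t * \<phi> t) \<in> test_functions_on A"
proof -
  let ?f = "\<lambda>t. \<psi> t * \<phi> t"
  have *: "fsupp ?f \<subseteq> fsupp \<phi>"
    by (rule fsupp_subset) (auto simp: not_in_fsupp intro: closed_fsupp)
  have s: "fsupp \<phi> \<subseteq> A" "compact (fsupp \<phi>)" "smooth \<phi>"
    using assms by (auto simp: test_functions_on_def test_functions_iff)
  have "smooth ?f" by (intro smooth_mult assms s)
  then show ?thesis
    using compact_fsupp[OF * s(2)] * s(1) by (auto simp: test_functions_on_def test_functions_iff)
qed

lemma test_functions_on_vderiv: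
  assumes "\<phi> \<in> test_functions_on A" shows "vderiv \<phi> \<in> test_functions_on A"
proof -
  have *: "fsupp (vderiv \<phi>) \<subseteq> fsupp \<phi>"
    by (rule fsupp_subset) (use nderiv_not_in_fsupp[of _ \<phi> 1] in \<open>auto intro: closed_fsupp\<close>)
  have s: "fsupp \<phi> \<subseteq> A" "compact (fsupp \<phi>)" "smooth \<phi>"
    using assms by (auto simp: test_functions_on_def test_functions_iff)
  show ?thesis
    using compact_fsupp[OF * s(2)] * s(1) smooth_vderiv[OF s(3)] by (auto simp: test_functions_on_def test_functions_iff)
qed

lemma nderiv_bounded:
  assumes "smooth \<phi>" obtains B where "B \<ge> 0" "\<And>t. t \<in> {a..b} \<Longrightarrow> cmod (nderiv n \<phi> t) \<le> B"
proof -
  have "bounded (nderiv n \<phi> ` {a..b})"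
    by (intro compact_imp_bounded compact_continuous_image smooth_nderiv_continuous assms) simp
  then obtain B where "B > 0" "\<forall>x\<in>nderiv n \<phi> ` {a..b}. cmod x \<le> B" unfolding bounded_pos by blast
  then show thesis using that[of B] by simp
qed


section \<open>Iterated primitives and approximation of truncated powers\<close>

text \<open>
  The function \<open>v \<mapsto> \<integral>\<^sub>v\<^sup>M y\<close>. It inverts \<open>\<phi> \<mapsto> - \<phi>'\<close> on functions that vanish near and beyond \<open>M\<close>,
  so its iterates recover a test function from any of its derivatives.
\<close>

definition prim :: "real \<Rightarrow> (real \<Rightarrow> complex) \<Rightarrow> real \<Rightarrow> complex" where
  "prim M y v = - (LBINT w=ereal M..ereal v. y w)"

lemma prim_deriv:
  assumes "continuous_on UNIV y"
  shows "(prim M y has_vector_derivative - y v) (at v)"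
proof -
  let ?a = "min v M - 1" and ?b = "max v M + 1"
  have "((\<lambda>u. LBINT w=ereal M..ereal u. y w) has_vector_derivative y v) (at v within {?a..?b})"
    by (intro interval_integral_FTC2 continuous_on_subset[OF assms]) auto
  then have "((\<lambda>u. LBINT w=ereal M..ereal u. y w) has_vector_derivative y v) (at v)"
    by (subst (asm) at_within_interior) (auto simp: min_def max_def)
  then show ?thesis
    unfolding prim_def[abs_def] by (rule has_vector_derivative_minus)
qed

lemma prim_top: "prim M y M = 0"
  by (simp add: prim_def)

lemma prim_unique:
  assumes "continuous_on UNIV y" "\<And>v. (Y has_vector_derivative - y v) (at v)" "Y M = 0"
  shows "prim M y = Y"
proof
  fix v
  have "((\<lambda>v. prim M y v - Y v) has_vector_derivative 0) (at u within UNIV)" for u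
    using has_vector_derivative_diff[OF prim_deriv[OF assms(1)] assms(2)] by simp
  then obtain c where "\<And>u. u \<in> UNIV \<Longrightarrow> prim M y u - Y u = c"
    using has_vector_derivative_zero_constant[of UNIV "\<lambda>v. prim M y v - Y v"] by auto
  from this[of v] this[of M] show "prim M y v = Y v" by (simp add: prim_top assms)
qed

lemma prim_bound:
  assumes "continuous_on UNIV y" "a \<le> b" "\<And>w. a \<le> w \<Longrightarrow> w \<le> b \<Longrightarrow> cmod (y w) \<le> B"
  shows "cmod (prim M y a - prim M y b) \<le> B * (b - a)"
proof -
  have "cmod (prim M y a - prim M y b) \<le> B * norm (a - b)"
  proof (rule differentiable_bound[of "{a..b}"])
    show "(prim M y has_derivative (\<lambda>h. h *\<^sub>R - y x)) (at x within {a..b})" for x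
      using prim_deriv[OF assms(1)] by (auto simp: has_vector_derivative_def intro: has_derivative_at_withinI)
    show "onorm (\<lambda>h. h *\<^sub>R - y x) \<le> B" if "x \<in> {a..b}" for x
    proof (rule onorm_le)
      fix h :: real
      have "\<bar>h\<bar> * cmod (y x) \<le> \<bar>h\<bar> * B" using that assms(3)[of x] by (intro mult_left_mono) auto
      then show "norm (h *\<^sub>R - y x) \<le> B * norm h" by (simp add: mult.commute)
    qed
  qed (use assms in auto)
  then show ?thesis using assms(2) by simp
qed

lemma prim_diff:
  assumes "continuous_on UNIV y" "continuous_on UNIV z"
  shows "prim M (\<lambda>v. y v - z v) = (\<lambda>v. prim M y v - prim M z v)"
  using has_vector_derivative_diff[OF prim_deriv[OF assms(1)] prim_deriv[OF assms(2)]]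
  by (intro prim_unique continuous_intros assms) (auto simp: prim_top algebra_simps)

lemma prim_zero_above:
  assumes "continuous_on UNIV y" "\<And>w. b \<le> w \<Longrightarrow> y w = 0" "b \<le> M" "b \<le> v"
  shows "prim M y v = 0"
proof (cases "v \<le> M")
  case True
  then show ?thesis using prim_bound[of y v M 0 M] assms by (simp add: prim_top)
next
  case False
  then show ?thesis using prim_bound[of y M v 0 M] assms by (simp add: prim_top)
qed

lemma continuous_prim: "continuous_on UNIV y \<Longrightarrow> continuous_on S (prim M y)"
  using prim_deriv[THEN has_vector_derivative_continuous] by (blast intro: continuous_at_imp_continuous_on)

lemma continuous_prim_pow: "continuous_on UNIV y \<Longrightarrow> continuous_on UNIV ((prim M ^^ m) y)"
  by (induction m) (auto intro: continuous_prim)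

lemma prim_pow_diff:
  assumes "continuous_on UNIV y" "continuous_on UNIV z"
  shows "(prim M ^^ m) (\<lambda>v. y v - z v) = (\<lambda>v. (prim M ^^ m) y v - (prim M ^^ m) z v)"
  by (induction m) (simp_all add: prim_diff continuous_prim_pow assms)

lemma prim_pow_zero_above:
  assumes "continuous_on UNIV y" "\<And>w. b \<le> w \<Longrightarrow> y w = 0" "b \<le> M" "b \<le> v"
  shows "(prim M ^^ m) y v = 0"
  using assms(4)
proof (induction m arbitrary: v)
  case (Suc m)
  show ?case unfolding funpow.simps o_apply
    by (rule prim_zero_above[OF continuous_prim_pow[OF assms(1)] Suc.IH assms(3) Suc.prems])
qed (simp add: assms(2))

lemma prim_pow_cong:
  assumes "continuous_on UNIV y" "continuous_on UNIV z" "\<And>w. b \<le> w \<Longrightarrow> y w = z w" "b \<le> M" "b \<le> v"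
  shows "(prim M ^^ m) y v = (prim M ^^ m) z v"
  using prim_pow_zero_above[of "\<lambda>v. y v - z v" b M v m] assms
  by (simp add: prim_pow_diff continuous_intros)

lemma prim_pow_bound:
  assumes "continuous_on UNIV y" "\<And>w. w \<in> {-M..M} \<Longrightarrow> cmod (y w) \<le> B" "v \<in> {-M..M}"
  shows "cmod ((prim M ^^ m) y v) \<le> (2 * M) ^ m * B"
  using assms(3)
proof (induction m arbitrary: v)
  case (Suc m)
  have B: "0 \<le> B" using assms(2)[OF assms(3)] norm_ge_zero[of "y _"] by (meson order_trans)
  have M: "M \<ge> 0" using assms(3) by auto
  have "cmod (prim M ((prim M ^^ m) y) v - prim M ((prim M ^^ m) y) M) \<le> (2 * M) ^ m * B * (M - v)"
    by (rule prim_bound[OF continuous_prim_pow[OF assms(1)]]) (use Suc in auto)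
  also have "\<dots> \<le> (2 * M) ^ m * B * (2 * M)"
    by (rule mult_left_mono) (use Suc.prems B M in auto)
  finally show ?case by (simp add: prim_top mult_ac)
qed (simp add: assms(2))

lemma smooth_prim: "smooth y \<Longrightarrow> smooth (prim M y)"
  by (rule smoothI[OF prim_deriv[OF smooth_continuous] smooth_uminus])

lemma vderiv_prim: "smooth y \<Longrightarrow> vderiv (prim M y) = (\<lambda>v. - y v)"
  by (rule vderiv_eqI[OF prim_deriv[OF smooth_continuous]])

lemma smooth_prim_pow: "smooth y \<Longrightarrow> smooth ((prim M ^^ m) y)"
  by (induction m) (auto intro: smooth_prim)

lemma nderiv_prim_pow:
  assumes "smooth y"
  shows "nderiv i ((prim M ^^ (i + m)) y) = (\<lambda>v. (-1) ^ i * (prim M ^^ m) y v)"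
proof (induction i)
  case (Suc i)
  have "nderiv (Suc i) ((prim M ^^ (Suc i + m)) y) = nderiv i (\<lambda>v. - (prim M ^^ (i + m)) y v)"
    by (subst nderiv_Suc_right) (simp add: vderiv_prim smooth_prim_pow assms)
  then show ?case by (simp add: nderiv_uminus smooth_prim_pow assms Suc)
qed simp

lemma nderiv_prim_pow_beyond:
  assumes "smooth y"
  shows "nderiv (i + m) ((prim M ^^ m) y) = (\<lambda>v. (-1) ^ m * nderiv i y v)"
  using nderiv_prim_pow[OF assms, of m 0 M] nderiv_cmult[OF assms]
  by (simp add: funpow_add)

lemma prim_pow_nderiv:
  assumes "smooth \<phi>" "\<And>v. b \<le> v \<Longrightarrow> \<phi> v = 0" "b < M"
  shows "(prim M ^^ k) (\<lambda>v. (-1) ^ k * nderiv k \<phi> v) = \<phi>"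
proof (induction k)
  case (Suc k)
  have z: "nderiv k \<phi> M = 0"
    using nderiv_local[of "{b<..}" \<phi> "\<lambda>t. 0" M k] assms by (simp add: nderiv_zero)
  have "prim M (\<lambda>v. (-1) ^ Suc k * nderiv (Suc k) \<phi> v) = (\<lambda>v. (-1) ^ k * nderiv k \<phi> v)"
  proof (rule prim_unique)
    show "continuous_on UNIV (\<lambda>v. (-1) ^ Suc k * nderiv (Suc k) \<phi> v)"
      by (intro continuous_intros smooth_nderiv_continuous assms)
    show "((\<lambda>v. (-1) ^ k * nderiv k \<phi> v) has_vector_derivative - ((-1) ^ Suc k * nderiv (Suc k) \<phi> v)) (at v)" for v
      using has_vector_derivative_mult_right[OF smooth_nderiv_D[OF assms(1), of k v], of "(-1)^k"] by simp
  qed (simp add: z)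
  then show ?case by (simp only: funpow_Suc_right o_apply Suc)
qed simp

text \<open>
  The truncated power \<open>(t - v)\<^sub>+\<^sup>m / m!\<close> as a function of \<open>v\<close>; up to the shift of the index this is the
  kernel \<open>g\<^sub>m\<^sub>+\<^sub>1 (t - v)\<close>.
\<close>

definition tpow :: "nat \<Rightarrow> real \<Rightarrow> real \<Rightarrow> real" where
  "tpow m t v = (max 0 (t - v)) ^ m / fact m"

lemma pos_part_power_deriv:
  assumes "m \<ge> 1"
  shows "((\<lambda>x::real. (max 0 x) ^ Suc m) has_real_derivative real (Suc m) * (max 0 x) ^ m) (at x)"
proof -
  consider "x < 0" | "x = 0" | "x > 0" by linarith
  then show ?thesis
  proof cases
    case 1
    then have "eventually (\<lambda>y. y \<in> {..<0}) (nhds x)" by (intro eventually_nhds_in_open) auto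
    then have "eventually (\<lambda>y. (max 0 y) ^ Suc m = 0) (nhds x)" by eventually_elim simp
    then show ?thesis using 1 assms by (subst DERIV_cong_ev[OF refl, of _ "\<lambda>x. 0" _ _ 0]) auto
  next
    case 3
    then have "eventually (\<lambda>y. y \<in> {0<..}) (nhds x)" by (intro eventually_nhds_in_open) auto
    then have "eventually (\<lambda>y. (max 0 y) ^ Suc m = y ^ Suc m) (nhds x)" by eventually_elim simp
    moreover have "((\<lambda>x. x ^ Suc m) has_real_derivative real (Suc m) * (max 0 x) ^ m) (at x)"
      using DERIV_pow[of "Suc m" x UNIV] 3 by simp
    ultimately show ?thesis by (subst DERIV_cong_ev[OF refl _ refl]) auto
  next
    case 2
    have "((\<lambda>h::real. (max 0 h) ^ m) \<longlongrightarrow> (max 0 0) ^ m) (at 0)" by (intro tendsto_intros)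
    then have "((\<lambda>h::real. (max 0 h) ^ m) \<longlongrightarrow> 0) (at 0)" using assms by (simp add: power_0_left)
    then have "((\<lambda>h::real. (max 0 h) ^ Suc m / h) \<longlongrightarrow> 0) (at 0)"
      by (rule Lim_transform_eventually) (use assms in \<open>auto simp: eventually_at_filter max_def power_0_left\<close>)
    then show ?thesis using 2 assms by (simp add: has_field_derivative_iff power_0_left)
  qed
qed

lemma tpow_deriv:
  assumes "m \<ge> 1"
  shows "(tpow (Suc m) t has_real_derivative - tpow m t v) (at v)"
proof -
  have "((\<lambda>v. t - v) has_real_derivative -1) (at v)" by (auto intro!: derivative_eq_intros)
  from DERIV_cdivide[OF DERIV_chain2[OF pos_part_power_deriv[OF assms] this], of "fact (Suc m)"]
  have "((\<lambda>v. (max 0 (t - v)) ^ Suc m / fact (Suc m)) has_real_derivative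
     real (Suc m) * (max 0 (t - v)) ^ m * -1 / fact (Suc m)) (at v)" .
  moreover have "real (Suc m) * (max 0 (t - v)) ^ m * -1 / fact (Suc m) = - tpow m t v"
    unfolding tpow_def fact_Suc by (simp add: field_simps del: of_nat_Suc)
  ultimately show ?thesis unfolding tpow_def[abs_def] by simp
qed

lemma continuous_tpow: "continuous_on S (tpow m t)"
  unfolding tpow_def[abs_def] by (intro continuous_intros) auto

lemma prim_pow_tpow:
  assumes "m \<ge> 1" "t \<le> M"
  shows "(prim M ^^ i) (\<lambda>v. complex_of_real (tpow m t v)) = (\<lambda>v. of_real (tpow (m + i) t v))"
proof (induction i)
  case (Suc i)
  have "prim M (\<lambda>v. complex_of_real (tpow (m + i) t v)) = (\<lambda>v. of_real (tpow (Suc (m + i)) t v))"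
  proof (rule prim_unique)
    show "continuous_on UNIV (\<lambda>v. complex_of_real (tpow (m + i) t v))"
      by (intro continuous_intros continuous_tpow)
    show "((\<lambda>v. complex_of_real (tpow (Suc (m + i)) t v)) has_vector_derivative - complex_of_real (tpow (m + i) t v)) (at v)" for v
      using has_vector_derivative_of_real[OF tpow_deriv[of "m+i" t v]] assms by simp
  qed (use assms in \<open>simp add: tpow_def\<close>)
  then show ?case by (simp add: Suc)
qed simp

definition cut :: "real \<Rightarrow> complex" where "cut v = smooth_step (2 * v + 2)"

lemma smooth_cut: "smooth cut"
  unfolding cut_def[abs_def] by (rule smooth_affine[OF smooth_smooth_step])

lemma cut_0: "v \<le> -1 \<Longrightarrow> cut v = 0" and cut_1: "v \<ge> -1/2 \<Longrightarrow> cut v = 1"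
  by (simp_all add: cut_def smooth_step_0 smooth_step_1)

lemma cut_test:
  assumes "smooth Y" "\<And>v. b < v \<Longrightarrow> Y v = 0"
  shows "(\<lambda>v. cut v * Y v) \<in> test_functions_on {-1..b}"
  by (rule test_functionsI) (use assms in \<open>auto intro!: smooth_mult smooth_cut simp: cut_0 not_le\<close>)

lemma nderiv_cut: "v > -1/2 \<Longrightarrow> nderiv i (\<lambda>v. cut v * Y v) v = nderiv i Y v"
  by (rule nderiv_local[of "{-1/2<..}"]) (auto simp: cut_1)

text \<open>
  No derivative of \<open>y\<close> enters the bound: in the Leibniz expansion of the \<open>k\<close>-th derivative, every term
  contains an iterated primitive of \<open>y\<close>. The induction on \<open>k\<close> avoids this expansion, because one
  derivative of \<open>\<kappa> J\<^sup>k\<^sup>+\<^sup>1 y\<close> is \<open>\<kappa>' J\<^sup>k (J y) - \<kappa> J\<^sup>k y\<close>, where \<open>J\<close> is the primitive.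
\<close>

lemma nderiv_mult_prim_bound:
  assumes "smooth \<kappa>" "M \<ge> 0"
  shows "\<exists>c\<ge>0. \<forall>y B. smooth y \<longrightarrow> (\<forall>v\<in>{-M..M}. cmod (y v) \<le> B) \<longrightarrow>
      (\<forall>v\<in>{-M..M}. cmod (nderiv k (\<lambda>v. \<kappa> v * (prim M ^^ k) y v) v) \<le> c * B)"
  using assms(1)
proof (induction k arbitrary: \<kappa>)
  case 0
  obtain c where "c \<ge> 0" "\<And>t. t \<in> {-M..M} \<Longrightarrow> cmod (nderiv 0 \<kappa> t) \<le> c"
    using nderiv_bounded[OF 0] by blast
  then show ?case
    by (intro exI[of _ c]) (auto simp: norm_mult intro!: mult_mono)
next
  case (Suc k)
  obtain c where c: "c \<ge> 0" "\<And>y B v. smooth y \<Longrightarrow> (\<And>v. v\<in>{-M..M} \<Longrightarrow> cmod (y v) \<le> B) \<Longrightarrow> v\<in>{-M..M} \<Longrightarrow>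
      cmod (nderiv k (\<lambda>v. \<kappa> v * (prim M ^^ k) y v) v) \<le> c * B"
    using Suc.IH[OF Suc.prems] by metis
  obtain c' where c': "c' \<ge> 0" "\<And>y B v. smooth y \<Longrightarrow> (\<And>v. v\<in>{-M..M} \<Longrightarrow> cmod (y v) \<le> B) \<Longrightarrow> v\<in>{-M..M} \<Longrightarrow>
      cmod (nderiv k (\<lambda>v. vderiv \<kappa> v * (prim M ^^ k) y v) v) \<le> c' * B"
    using Suc.IH[OF smooth_vderiv[OF Suc.prems]] by metis
  show ?case
  proof (intro exI[of _ "c' * (2 * M) + c"] conjI allI impI ballI)
    show "0 \<le> c' * (2 * M) + c" using c c' assms by simp
    fix y B v assume y: "smooth y" "\<forall>v\<in>{-M..M}. cmod (y v) \<le> B" and v: "v \<in> {-M..M}"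
    let ?P = "\<lambda>v. vderiv \<kappa> v * (prim M ^^ k) (prim M y) v" and ?Q = "\<lambda>v. \<kappa> v * (prim M ^^ k) y v"
    have "vderiv (\<lambda>v. \<kappa> v * (prim M ^^ Suc k) y v) = (\<lambda>v. ?P v - ?Q v)"
    proof (rule vderiv_eqI)
      fix t
      have "((prim M ^^ Suc k) y has_vector_derivative - (prim M ^^ k) y t) (at t)"
        using prim_deriv[OF continuous_prim_pow[OF smooth_continuous[OF y(1)]]] by simp
      from has_vector_derivative_mult[OF smooth_D[OF Suc.prems] this]
      show "((\<lambda>v. \<kappa> v * (prim M ^^ Suc k) y v) has_vector_derivative ?P t - ?Q t) (at t)"
        by (simp add: funpow_swap1)
    qed
    then have eq: "nderiv (Suc k) (\<lambda>v. \<kappa> v * (prim M ^^ Suc k) y v) v = nderiv k ?P v - nderiv k ?Q v"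
      by (simp add: nderiv_Suc_right nderiv_diff smooth_mult smooth_vderiv smooth_prim_pow smooth_prim y Suc.prems
           del: funpow.simps)
    have "cmod (nderiv k ?P v) \<le> c' * ((2 * M) * B)"
      using prim_pow_bound[OF smooth_continuous[OF y(1)], of M B _ 1] y
      by (intro c' smooth_prim v) auto
    moreover have "cmod (nderiv k ?Q v) \<le> c * B" using y v by (intro c) auto
    ultimately have "cmod (nderiv (Suc k) (\<lambda>v. \<kappa> v * (prim M ^^ Suc k) y v) v) \<le> c' * ((2 * M) * B) + c * B"
      unfolding eq by (rule order_trans[OF norm_triangle_ineq4 add_mono])
    then show "cmod (nderiv (Suc k) (\<lambda>v. \<kappa> v * (prim M ^^ Suc k) y v) v) \<le> (c' * (2 * M) + c) * B"
      by (simp only: distrib_right mult.assoc)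
  qed
qed

text \<open>
  Smooth functions that converge to \<open>(t - v)\<^sub>+\<close> uniformly, as \<open>j\<close> grows, and agree with \<open>t - v\<close> for \<open>v \<le> t\<close>.
\<close>

definition approx :: "real \<Rightarrow> nat \<Rightarrow> real \<Rightarrow> complex" where
  "approx t j v = of_real (t - v) * (1 - smooth_step (real (Suc j) * (v - t)))"

lemma smooth_approx: "smooth (approx t j)"
proof -
  have "smooth (\<lambda>v. smooth_step (real (Suc j) * v + (- (real (Suc j) * t))))"
    by (rule smooth_affine[OF smooth_smooth_step])
  then have s: "smooth (\<lambda>v. smooth_step (real (Suc j) * (v - t)))" by (simp add: right_diff_distrib)
  show ?thesis
    unfolding approx_def[abs_def] of_real_diff
    by (intro smooth_mult smooth_diff smooth_const smooth_of_real s)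
qed

lemma approx_zero: "t + 1 / real (Suc j) \<le> v \<Longrightarrow> approx t j v = 0"
  by (simp add: approx_def smooth_step_1 field_simps del: of_nat_Suc)

lemma approx_left: "v \<le> t \<Longrightarrow> approx t j v = of_real (t - v)"
  by (simp add: approx_def smooth_step_0 mult_nonneg_nonpos)

lemma approx_error: "cmod (approx t j v - of_real (tpow 1 t v)) \<le> 1 / real (Suc j)"
proof -
  consider "v \<le> t" | "t < v" "v < t + 1 / real (Suc j)" | "t + 1 / real (Suc j) \<le> v" by linarith
  then show ?thesis
  proof cases
    case 1 then show ?thesis by (simp add: approx_left tpow_def)
  next
    case 2
    have "cmod (approx t j v) \<le> \<bar>t - v\<bar> * 1"
      unfolding approx_def norm_mult norm_of_real by (rule mult_left_mono[OF norm_smooth_step(2)]) simp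
    then show ?thesis using 2 by (simp add: tpow_def)
  next
    case 3
    have "t \<le> v" using 3 by (smt (verit) divide_nonneg_nonneg of_nat_0_le_iff)
    then show ?thesis using 3 by (simp add: approx_zero tpow_def)
  qed
qed

text \<open>
  Test functions whose first \<open>k\<close> derivatives converge, uniformly on \<open>[0, M]\<close>, to those of the truncated power
  \<open>(t - v)\<^sub>+\<^sup>k\<^sup>+\<^sup>1 / (k + 1)!\<close>. The factor \<open>cut\<close> produces the compact support; it equals \<open>1\<close> near \<open>[0, \<infinity>)\<close>.
\<close>

definition power_test :: "real \<Rightarrow> nat \<Rightarrow> real \<Rightarrow> nat \<Rightarrow> real \<Rightarrow> complex" where
  "power_test M k t j = (\<lambda>v. cut v * (prim M ^^ k) (approx t j) v)"

lemma power_test_test: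
  assumes "t + 1 / real (Suc j) \<le> M"
  shows "power_test M k t j \<in> test_functions_on {-1..t + 1 / real (Suc j)}"
  unfolding power_test_def
  using prim_pow_zero_above[OF smooth_continuous[OF smooth_approx] approx_zero assms]
  by (intro cut_test smooth_prim_pow smooth_approx) auto

lemma nderiv_power_test:
  assumes "-1/2 < v" "i \<le> k"
  shows "nderiv i (power_test M k t j) v = (-1) ^ i * (prim M ^^ (k - i)) (approx t j) v"
proof -
  have "nderiv i (power_test M k t j) v = nderiv i ((prim M ^^ k) (approx t j)) v"
    unfolding power_test_def using assms(1) by (rule nderiv_cut)
  also have "\<dots> = (-1) ^ i * (prim M ^^ (k - i)) (approx t j) v"
    using nderiv_prim_pow[OF smooth_approx, of i "k - i" M t j] assms(2) by simp
  finally show ?thesis .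
qed

lemma nderiv_affine_zero: "nderiv (Suc (Suc i)) (\<lambda>v. complex_of_real (t - v)) = (\<lambda>v. 0)"
proof -
  have "((\<lambda>v. complex_of_real (t - v)) has_vector_derivative -1) (at v)" for v
    using has_vector_derivative_of_real[of "\<lambda>v. t - v" "-1" "at v"] by (auto intro!: derivative_eq_intros)
  then have "vderiv (\<lambda>v. complex_of_real (t - v)) = (\<lambda>v. -1)" by (rule vderiv_eqI)
  moreover have "vderiv (\<lambda>v. -1) = (\<lambda>v. 0)" by (rule vderiv_eqI) simp
  ultimately show ?thesis by (simp only: nderiv_Suc_right nderiv_zero)
qed

text \<open>
  Near \<open>0\<close> the function is a polynomial of degree at most \<open>k + 1\<close>, because \<open>approx t j\<close> is affine there.
\<close>

lemma nderiv_power_test_zero: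
  assumes "0 < t" "k + 2 \<le> i"
  shows "nderiv i (power_test M k t j) 0 = 0"
proof -
  obtain l where i: "i = Suc (Suc l) + k" using assms(2) by (metis add.commute add_2_eq_Suc' add_Suc_shift le_Suc_ex)
  have "nderiv i (power_test M k t j) 0 = nderiv i ((prim M ^^ k) (approx t j)) 0"
    unfolding power_test_def by (rule nderiv_cut) simp
  also have "\<dots> = (-1) ^ k * nderiv (Suc (Suc l)) (approx t j) 0"
    unfolding i using nderiv_prim_pow_beyond[OF smooth_approx, of "Suc (Suc l)" k M t j] by simp
  also have "nderiv (Suc (Suc l)) (approx t j) 0 = nderiv (Suc (Suc l)) (\<lambda>v. complex_of_real (t - v)) 0"
    by (rule nderiv_local[of "{..<t}"]) (use assms approx_left in auto)
  finally show ?thesis by (simp only: nderiv_affine_zero mult_zero_right)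
qed

lemma prim_pow_approx_error:
  assumes "t \<le> M" "v \<in> {-M..M}"
  shows "cmod ((prim M ^^ m) (approx t j) v - of_real (tpow (Suc m) t v)) \<le> (2 * M) ^ m * (1 / real (Suc j))"
proof -
  have c: "continuous_on UNIV (\<lambda>v. complex_of_real (tpow 1 t v))"
    by (intro continuous_intros continuous_tpow)
  have "cmod ((prim M ^^ m) (\<lambda>v. approx t j v - of_real (tpow 1 t v)) v) \<le> (2 * M) ^ m * (1 / real (Suc j))"
    by (rule prim_pow_bound[OF _ approx_error assms(2)])
       (intro continuous_intros c smooth_continuous smooth_approx)
  then show ?thesis
    using prim_pow_diff[OF smooth_continuous[OF smooth_approx] c, of m M t j] prim_pow_tpow[of 1 t M m] assms(1)
    by simp
qed


section \<open>The convolution on the half line\<close>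

text \<open>
  Scaling the variable of integration to \<open>[0, 1]\<close> treats both signs of \<open>t\<close> alike and puts \<open>t\<close> into the
  integrand only, so that differentiation under the integral sign applies.
\<close>

lemma conv0_has_integral:
  assumes "continuous_on UNIV \<phi>" "continuous_on UNIV \<psi>"
  shows "((\<lambda>s. of_real t * (\<phi> (t * (1 - s)) * \<psi> (t * s))) has_integral conv0 \<phi> \<psi> t) {0..1}"
proof -
  let ?f = "\<lambda>r. \<phi> (t - r) * \<psi> r" and ?h = "\<lambda>s. of_real t * (\<phi> (t * (1 - s)) * \<psi> (t * s))"
  note c = continuous_on_compose2[OF assms(1)] continuous_on_compose2[OF assms(2)]
  have "(LBINT x=ereal 0..ereal 1. t *\<^sub>R ?f (t * x)) = (LBINT y=ereal (t * 0)..ereal (t * 1). ?f y)"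
    by (rule interval_integral_substitution_finite)
       (auto intro!: continuous_intros c derivative_eq_intros)
  then have *: "conv0 \<phi> \<psi> t = (LBINT x=ereal 0..ereal 1. ?h x)"
    by (simp add: conv0_def zero_ereal_def right_diff_distrib scaleR_conv_of_real)
  have ch: "continuous_on {0..1} ?h" by (intro continuous_intros c) auto
  have "set_integrable lborel {0..1} ?h"
    by (rule borel_integrable_atLeastAtMost') (rule ch)
  then have "conv0 \<phi> \<psi> t = integral {0..1} ?h"
    unfolding * by (subst interval_integral_eq_integral) auto
  then show ?thesis
    using integrable_integral[OF integrable_continuous_real[OF ch]] by simp
qed

lemma conv0_eq_integral:
  assumes "continuous_on UNIV \<phi>" "continuous_on UNIV \<psi>"
  shows "conv0 \<phi> \<psi> t = of_real t * integral {0..1} (\<lambda>s. \<phi> (t * (1 - s)) * \<psi> (t * s))"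
  using integral_unique[OF conv0_has_integral[OF assms]] by (simp add: integral_mult_right)

lemma conv0_parts:
  assumes "smooth \<phi>" "smooth \<psi>"
  shows "conv0 (vderiv \<phi>) \<psi> t = conv0 \<phi> (vderiv \<psi>) t + \<psi> 0 * \<phi> t - \<phi> 0 * \<psi> t"
proof -
  let ?F = "\<lambda>s. \<phi> (t * (1 - s)) * \<psi> (t * s)"
  have "(?F has_vector_derivative of_real t * (\<phi> (t * (1 - s)) * vderiv \<psi> (t * s))
      - of_real t * (vderiv \<phi> (t * (1 - s)) * \<psi> (t * s))) (at s within {0..1})" for s
  proof -
    have 1: "((\<lambda>s. t * (1 - s)) has_vector_derivative - t) (at s)" "((\<lambda>s. t * s) has_vector_derivative t) (at s)"
      by (auto intro!: derivative_eq_intros)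
    note has_vector_derivative_mult[OF vector_diff_chain_at[OF 1(1) smooth_D[OF assms(1)]]
        vector_diff_chain_at[OF 1(2) smooth_D[OF assms(2)]], unfolded o_def]
    then have "(?F has_vector_derivative \<phi> (t * (1 - s)) * (t *\<^sub>R vderiv \<psi> (t * s)) + (- t *\<^sub>R vderiv \<phi> (t * (1 - s))) * \<psi> (t * s)) (at s)" .
    then show ?thesis
      by (rule has_vector_derivative_at_within[THEN has_vector_derivative_eq_rhs])
         (simp add: scaleR_conv_of_real)
  qed
  then have "((\<lambda>s. of_real t * (\<phi> (t * (1 - s)) * vderiv \<psi> (t * s)) - of_real t * (vderiv \<phi> (t * (1 - s)) * \<psi> (t * s)))
     has_integral (?F 1 - ?F 0)) {0..1}"
    by (intro fundamental_theorem_of_calculus) auto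
  moreover have "((\<lambda>s. of_real t * (\<phi> (t * (1 - s)) * vderiv \<psi> (t * s)) - of_real t * (vderiv \<phi> (t * (1 - s)) * \<psi> (t * s)))
     has_integral (conv0 \<phi> (vderiv \<psi>) t - conv0 (vderiv \<phi>) \<psi> t)) {0..1}"
    by (intro has_integral_diff conv0_has_integral smooth_continuous smooth_vderiv assms)
  ultimately have "?F 1 - ?F 0 = conv0 \<phi> (vderiv \<psi>) t - conv0 (vderiv \<phi>) \<psi> t"
    by (rule has_integral_unique)
  then show ?thesis by (simp add: algebra_simps)
qed

text \<open>
  Differentiation under the integral sign in the scaled form gives terms with derivatives of both factors;
  integrating the derivative of \<open>s \<phi>(t(1 - s)) \<psi>(t s)\<close> over \<open>[0, 1]\<close> turns those of \<open>\<psi>\<close> into the boundary term.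
\<close>

lemma conv0_deriv:
  assumes "smooth \<phi>" "smooth \<psi>"
  shows "(conv0 \<phi> \<psi> has_vector_derivative \<phi> 0 * \<psi> t + conv0 (vderiv \<phi>) \<psi> t) (at t)"
proof -
  let ?f = "\<lambda>t s. \<phi> (t * (1 - s)) * \<psi> (t * s)"
  let ?f' = "\<lambda>t s. of_real s * (\<phi> (t * (1 - s)) * vderiv \<psi> (t * s)) + of_real (1 - s) * (vderiv \<phi> (t * (1 - s)) * \<psi> (t * s))"
  note c = continuous_on_compose2[OF smooth_continuous[OF assms(1), of UNIV]]
    continuous_on_compose2[OF smooth_continuous[OF assms(2), of UNIV]]
    continuous_on_compose2[OF smooth_continuous[OF smooth_vderiv[OF assms(1)], of UNIV]]
    continuous_on_compose2[OF smooth_continuous[OF smooth_vderiv[OF assms(2)], of UNIV]]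
  have "((\<lambda>t. integral (cbox 0 1) (?f t)) has_vector_derivative integral (cbox 0 1) (?f' t)) (at t within UNIV)"
  proof (rule leibniz_rule_vector_derivative)
    fix t s :: real
    have 1: "((\<lambda>t. t * (1 - s)) has_vector_derivative (1 - s)) (at t)" "((\<lambda>t. t * s) has_vector_derivative s) (at t)"
      by (auto intro!: derivative_eq_intros)
    note has_vector_derivative_mult[OF vector_diff_chain_at[OF 1(1) smooth_D[OF assms(1)]]
        vector_diff_chain_at[OF 1(2) smooth_D[OF assms(2)]], unfolded o_def]
    then show "((\<lambda>t. ?f t s) has_vector_derivative ?f' t s) (at t)"
      by (rule has_vector_derivative_eq_rhs) (simp add: scaleR_conv_of_real)
  next
    show "?f t integrable_on cbox 0 1" for t
      by (intro integrable_continuous continuous_intros c) auto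
    show "continuous_on (UNIV \<times> cbox 0 1) (\<lambda>(t, s). ?f' t s)"
      unfolding split_beta by (intro continuous_intros c) auto
  qed auto
  then have d: "((\<lambda>t. integral {0..1} (?f t)) has_vector_derivative integral {0..1} (?f' t)) (at t)" by simp
  have "complex_of_real t * integral {0..1} (?f' t) + integral {0..1} (?f t) = \<phi> 0 * \<psi> t + conv0 (vderiv \<phi>) \<psi> t"
    (is "?l = _")
  proof -
    let ?F = "\<lambda>s. of_real s * ?f t s"
    have "(?F has_vector_derivative ?f t s + of_real t * (of_real s * (\<phi> (t * (1 - s)) * vderiv \<psi> (t * s)))
        - of_real t * (of_real s * (vderiv \<phi> (t * (1 - s)) * \<psi> (t * s)))) (at s within {0..1})" for s
    proof -
      have 1: "((\<lambda>s. t * (1 - s)) has_vector_derivative - t) (at s)" "((\<lambda>s. t * s) has_vector_derivative t) (at s)"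
        "(complex_of_real has_vector_derivative 1) (at s)"
        using has_vector_derivative_of_real[OF DERIV_ident] by (auto intro!: derivative_eq_intros)
      note has_vector_derivative_mult[OF 1(3) has_vector_derivative_mult[OF vector_diff_chain_at[OF 1(1) smooth_D[OF assms(1)]]
          vector_diff_chain_at[OF 1(2) smooth_D[OF assms(2)]], unfolded o_def]]
      then show ?thesis
        by (rule has_vector_derivative_at_within[THEN has_vector_derivative_eq_rhs])
           (simp add: scaleR_conv_of_real algebra_simps)
    qed
    then have "((\<lambda>s. ?f t s + of_real t * (of_real s * (\<phi> (t * (1 - s)) * vderiv \<psi> (t * s)))
        - of_real t * (of_real s * (vderiv \<phi> (t * (1 - s)) * \<psi> (t * s)))) has_integral (?F 1 - ?F 0)) {0..1}"
      by (intro fundamental_theorem_of_calculus) auto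
    from has_integral_add[OF this conv0_has_integral[OF smooth_continuous[OF smooth_vderiv[OF assms(1)]] smooth_continuous[OF assms(2)], of t]]
    have "((\<lambda>s. of_real t * ?f' t s + ?f t s) has_integral (\<phi> 0 * \<psi> t + conv0 (vderiv \<phi>) \<psi> t)) {0..1}"
      by (rule has_integral_eq_rhs[rotated] | simp add: algebra_simps)+
    moreover have "((\<lambda>s. of_real t * ?f' t s + ?f t s) has_integral ?l) {0..1}"
      by (intro has_integral_add has_integral_mult_right integrable_integral integrable_continuous_real continuous_intros c) auto
    ultimately show ?thesis by (rule has_integral_unique[symmetric])
  qed
  moreover have 1: "(complex_of_real has_vector_derivative 1) (at t)"
    using has_vector_derivative_of_real[OF DERIV_ident] by simp
  moreover have "conv0 \<phi> \<psi> = (\<lambda>t. complex_of_real t * integral {0..1} (?f t))"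
    by (intro ext conv0_eq_integral smooth_continuous assms)
  ultimately show ?thesis
    using has_vector_derivative_mult[OF 1 d] by simp
qed

lemma smooth_conv0:
  assumes "smooth \<phi>" "smooth \<psi>" shows "smooth (conv0 \<phi> \<psi>)"
proof -
  have "kdiff n (conv0 \<phi> \<psi>)" if "smooth \<phi>" for n \<phi>
    using that
  proof (induction n arbitrary: \<phi>)
    case 0
    show ?case by (rule kdiff_0I[OF conv0_deriv[OF 0 assms(2)]])
  next
    case (Suc n)
    then have "kdiff n (\<lambda>t. \<phi> 0 * \<psi> t + conv0 (vderiv \<phi>) \<psi> t)"
      using assms(2) by (intro kdiff_add kdiff_mult kdiff_const smooth_vderiv Suc) (auto simp: smooth_kdiff)
    then show ?case by (intro kdiff_SucI[OF conv0_deriv[OF Suc.prems assms(2)]])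
  qed
  then show ?thesis using assms by (simp add: smooth_kdiff)
qed

text \<open>
  The factors need not vanish at \<open>0\<close>, so each differentiation leaves a boundary term. In the limit these
  become the lower order terms in \<open>semigroup_kernel_identity\<close>.
\<close>

lemma nderiv_conv0:
  assumes "smooth \<phi>" "smooth \<psi>"
  shows "nderiv k (conv0 \<phi> \<psi>) = (\<lambda>v. conv0 (nderiv k \<phi>) \<psi> v + (\<Sum>l<k. nderiv l \<phi> 0 * nderiv (k - 1 - l) \<psi> v))"
proof (induction k)
  case (Suc k)
  have "vderiv (\<lambda>v. conv0 (nderiv k \<phi>) \<psi> v + (\<Sum>l<k. nderiv l \<phi> 0 * nderiv (k - 1 - l) \<psi> v))
    = (\<lambda>v. conv0 (nderiv (Suc k) \<phi>) \<psi> v + (\<Sum>l<Suc k. nderiv l \<phi> 0 * nderiv (Suc k - 1 - l) \<psi> v))"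
  proof (rule vderiv_eqI)
    fix t
    have 1: "(conv0 (nderiv k \<phi>) \<psi> has_vector_derivative nderiv k \<phi> 0 * \<psi> t + conv0 (nderiv (Suc k) \<phi>) \<psi> t) (at t)"
      using conv0_deriv[OF smooth_nderiv[OF assms(1)] assms(2), of k t] by simp
    have 2: "((\<lambda>v. \<Sum>l<k. nderiv l \<phi> 0 * nderiv (k - 1 - l) \<psi> v) has_vector_derivative
        (\<Sum>l<k. nderiv l \<phi> 0 * nderiv (Suc (k - 1 - l)) \<psi> t)) (at t)"
      by (intro has_vector_derivative_sum has_vector_derivative_mult_right smooth_nderiv_D assms)
    have 3: "(\<Sum>l<k. nderiv l \<phi> 0 * nderiv (Suc (k - 1 - l)) \<psi> t) = (\<Sum>l<k. nderiv l \<phi> 0 * nderiv (Suc k - 1 - l) \<psi> t)"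
    proof (rule sum.cong[OF refl])
      fix l assume "l \<in> {..<k}"
      then have "Suc (k - 1 - l) = Suc k - 1 - l" by auto
      then show "nderiv l \<phi> 0 * nderiv (Suc (k - 1 - l)) \<psi> t = nderiv l \<phi> 0 * nderiv (Suc k - 1 - l) \<psi> t"
        by (simp only:)
    qed
    show "((\<lambda>v. conv0 (nderiv k \<phi>) \<psi> v + (\<Sum>l<k. nderiv l \<phi> 0 * nderiv (k - 1 - l) \<psi> v)) has_vector_derivative
       conv0 (nderiv (Suc k) \<phi>) \<psi> t + (\<Sum>l<Suc k. nderiv l \<phi> 0 * nderiv (Suc k - 1 - l) \<psi> t)) (at t)"
      by (rule has_vector_derivative_eq_rhs[OF has_vector_derivative_add[OF 1 2]])
         (unfold 3 sum.lessThan_Suc, simp del: funpow.simps(2))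
  qed
  then show ?case by (simp add: Suc)
qed simp

lemma conv0_test:
  assumes "\<phi> \<in> test_functions_on {a..b}" "\<psi> \<in> test_functions_on {a'..b'}"
  shows "conv0 \<phi> \<psi> \<in> test_functions_on {a + a'..b + b'}"
proof (rule test_functionsI)
  have s: "smooth \<phi>" "smooth \<psi>" using assms test_functions_smooth by blast+
  show "smooth (conv0 \<phi> \<psi>)" by (rule smooth_conv0[OF s])
  fix t assume t: "t \<notin> {a + a'..b + b'}"
  have "\<phi> (t * (1 - s)) * \<psi> (t * s) = 0" for s
  proof (rule ccontr)
    assume "\<phi> (t * (1 - s)) * \<psi> (t * s) \<noteq> 0"
    then have "t * (1 - s) \<in> {a..b}" "t * s \<in> {a'..b'}"
      using test_function_zero[OF assms(1)] test_function_zero[OF assms(2)] by fastforce+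
    then show False using t by (simp add: right_diff_distrib) 
  qed
  then have "(\<lambda>s. \<phi> (t * (1 - s)) * \<psi> (t * s)) = (\<lambda>s. 0)" by (intro ext)
  then show "conv0 \<phi> \<psi> t = 0"
    using conv0_eq_integral[OF s[THEN smooth_continuous], of t] by simp
qed

lemma conv0_diff_bound:
  assumes "continuous_on UNIV \<phi>" "continuous_on UNIV \<psi>" "continuous_on UNIV \<phi>'" "continuous_on UNIV \<psi>'"
    and t: "t \<in> {0..M}"
    and "\<And>v. v \<in> {0..M} \<Longrightarrow> cmod (\<phi> v - \<phi>' v) \<le> e" "\<And>v. v \<in> {0..M} \<Longrightarrow> cmod (\<psi> v - \<psi>' v) \<le> e'"
    and "\<And>v. v \<in> {0..M} \<Longrightarrow> cmod (\<phi>' v) \<le> A" "\<And>v. v \<in> {0..M} \<Longrightarrow> cmod (\<psi> v) \<le> B"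
  shows "cmod (conv0 \<phi> \<psi> t - conv0 \<phi>' \<psi>' t) \<le> M * (e * B + A * e')"
proof -
  let ?f = "\<lambda>s. of_real t * (\<phi> (t * (1 - s)) * \<psi> (t * s)) - of_real t * (\<phi>' (t * (1 - s)) * \<psi>' (t * s))"
  have "(?f has_integral (conv0 \<phi> \<psi> t - conv0 \<phi>' \<psi>' t)) {0..1}"
    by (intro has_integral_diff conv0_has_integral assms)
  moreover have "cmod (?f s) \<le> M * (e * B + A * e')" if s: "s \<in> cbox 0 1" for s
  proof -
    have "t * (1 - s) \<le> M * 1" "t * s \<le> M * 1" using s t mult_mono[of t M "1 - s" 1] mult_mono[of t M s 1] by auto
    then have 1: "t * (1 - s) \<in> {0..M}" "t * s \<in> {0..M}" using s t by auto
    have "cmod ((\<phi> (t * (1 - s)) - \<phi>' (t * (1 - s))) * \<psi> (t * s) + \<phi>' (t * (1 - s)) * (\<psi> (t * s) - \<psi>' (t * s))) \<le> e * B + A * e'"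
      by (intro norm_triangle_le add_mono) (auto simp: norm_mult intro!: mult_mono' assms 1)
    then have "M * cmod ((\<phi> (t * (1 - s)) - \<phi>' (t * (1 - s))) * \<psi> (t * s) + \<phi>' (t * (1 - s)) * (\<psi> (t * s) - \<psi>' (t * s))) \<le> M * (e * B + A * e')"
      using t by (intro mult_left_mono) auto
    moreover have "?f s = of_real t * ((\<phi> (t * (1 - s)) - \<phi>' (t * (1 - s))) * \<psi> (t * s) + \<phi>' (t * (1 - s)) * (\<psi> (t * s) - \<psi>' (t * s)))"
      by (simp add: algebra_simps)
    then have "cmod (?f s) \<le> M * cmod ((\<phi> (t * (1 - s)) - \<phi>' (t * (1 - s))) * \<psi> (t * s) + \<phi>' (t * (1 - s)) * (\<psi> (t * s) - \<psi>' (t * s)))"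
      using t by (simp add: norm_mult mult_right_mono)
    ultimately show ?thesis by linarith
  qed
  moreover have "0 \<le> M * (e * B + A * e')"
    using t norm_ge_zero by (intro mult_nonneg_nonneg add_nonneg_nonneg) (use assms(6-9)[of t] in \<open>auto intro: order_trans[OF norm_ge_zero]\<close>)
  ultimately have "cmod (conv0 \<phi> \<psi> t - conv0 \<phi>' \<psi>' t) \<le> M * (e * B + A * e') * measure lborel (cbox 0 (1::real))"
    by (intro has_integral_bound) auto
  then show ?thesis by simp
qed


section \<open>Scalar identities for truncated powers\<close>

lemma conv0_cmult:
  assumes "continuous_on UNIV \<phi>" "continuous_on UNIV \<psi>"
  shows "conv0 (\<lambda>v. c * \<phi> v) \<psi> t = c * conv0 \<phi> \<psi> t"
proof -
  have "continuous_on UNIV (\<lambda>v. c * \<phi> v)" by (intro continuous_intros assms)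
  then show ?thesis using conv0_eq_integral[OF _ assms(2)] assms(1)
    by (simp add: mult.assoc mult.left_commute)
qed

lemma uniform_limit_conv0:
  assumes f: "\<And>n. continuous_on UNIV (f n)" "continuous_on UNIV f'"
    and g: "\<And>n. continuous_on UNIV (g n)" "continuous_on UNIV g'"
    and uf: "uniform_limit {0..M} f f' sequentially" and ug: "uniform_limit {0..M} g g' sequentially"
  shows "uniform_limit {0..M} (\<lambda>n. conv0 (f n) (g n)) (conv0 f' g') sequentially"
proof (cases "M \<ge> 0")
  case False
  then show ?thesis by (intro uniform_limitI) auto
next
  case True
  have bd: "bounded (h ` {0..M})" if "continuous_on UNIV h" for h :: "real \<Rightarrow> complex"
    by (rule compact_imp_bounded[OF compact_continuous_image[OF continuous_on_subset[OF that subset_UNIV] compact_Icc]])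
  note bd[OF f(2)] bd[OF g(2)]
  then obtain A B where A: "A > 0" "\<forall>v\<in>{0..M}. cmod (f' v) \<le> A" and B: "B > 0" "\<forall>v\<in>{0..M}. cmod (g' v) \<le> B"
    unfolding bounded_pos by auto
  show ?thesis
  proof (rule uniform_limitI)
    fix e :: real assume e: "e > 0"
    define d where "d = min 1 (e / (2 * (M + 1) * (B + 1 + A)))"
    have pos: "2 * (M + 1) * (B + 1 + A) > 0" using True A B by (intro mult_pos_pos) auto
    have d0: "d > 0" using e pos by (simp add: d_def)
    have "d \<le> e / (2 * (M + 1) * (B + 1 + A))" by (simp add: d_def)
    then have "d * (2 * (M + 1) * (B + 1 + A)) \<le> e" using pos by (simp only: pos_le_divide_eq)
    then have de: "(M + 1) * (d * (B + 1) + A * d) \<le> e / 2" by (simp add: algebra_simps)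
    have "eventually (\<lambda>n. (\<forall>v\<in>{0..M}. dist (f n v) (f' v) < d) \<and> (\<forall>v\<in>{0..M}. dist (g n v) (g' v) < d)) sequentially"
      using uf ug d0 by (intro eventually_conj) (simp_all add: uniform_limit_iff)
    then show "eventually (\<lambda>n. \<forall>t\<in>{0..M}. dist (conv0 (f n) (g n) t) (conv0 f' g' t) < e) sequentially"
    proof eventually_elim
      case (elim n)
      show ?case
      proof
        fix t assume t: "t \<in> {0..M}"
        have "cmod (g n v) \<le> B + 1" if v: "v \<in> {0..M}" for v
        proof -
          have "cmod (g n v) \<le> cmod (g' v) + cmod (g n v - g' v)" by (rule norm_triangle_sub)
          moreover have "cmod (g n v - g' v) < d" "d \<le> 1" using elim v by (auto simp: dist_norm d_def)
          ultimately show ?thesis using B(2) v by fastforce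
        qed
        then have "cmod (conv0 (f n) (g n) t - conv0 f' g' t) \<le> M * (d * (B + 1) + A * d)"
          using elim A(2) by (intro conv0_diff_bound f g t) (auto simp: dist_norm less_imp_le)
        also have "\<dots> \<le> (M + 1) * (d * (B + 1) + A * d)"
          using A B d0 by (intro mult_right_mono) auto
        also have "\<dots> < e" using de e by simp
        finally show "dist (conv0 (f n) (g n) t) (conv0 f' g' t) < e" by (simp add: dist_norm)
      qed
    qed
  qed
qed

text \<open>
  As a function of \<open>r\<close>, a primitive of \<open>(c - r)\<^sup>k\<^sup>+\<^sup>1 / (k + 1)! * (r - v)\<^sub>+\<close>, obtained by partial integration for
  \<open>r \<ge> v\<close> and constant for \<open>r \<le> v\<close>.
\<close>

definition kernel_prim :: "nat \<Rightarrow> real \<Rightarrow> real \<Rightarrow> real \<Rightarrow> real" where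
  "kernel_prim k c v r = - ((c - max r v) ^ (k + 2) / fact (k + 2) * (max r v - v)) - (c - max r v) ^ (k + 3) / fact (k + 3)"

lemma power_fact_deriv:
  "((\<lambda>m::real. (c - m) ^ Suc n / fact (Suc n)) has_real_derivative - ((c - m) ^ n / fact n)) (at m)"
proof -
  have "((\<lambda>m. c - m) has_real_derivative -1) (at m)" by (auto intro!: derivative_eq_intros)
  from DERIV_cdivide[OF DERIV_power[OF this, of "Suc n"], of "fact (Suc n)"]
  have "((\<lambda>m. (c - m) ^ Suc n / fact (Suc n)) has_real_derivative real (Suc n) * (-1 * (c - m) ^ n) / fact (Suc n)) (at m)"
    by simp
  then show ?thesis by (rule DERIV_cong) (simp add: field_simps del: of_nat_Suc)
qed

lemma kernel_prim_deriv:
  assumes "r \<noteq> v"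
  shows "(kernel_prim k c v has_real_derivative (c - r) ^ (k + 1) / fact (k + 1) * max 0 (r - v)) (at r)"
proof (cases "r < v")
  case True
  then have "eventually (\<lambda>y. y \<in> {..<v}) (nhds r)" by (intro eventually_nhds_in_open) auto
  then have "eventually (\<lambda>y. kernel_prim k c v y = - ((c - v) ^ (k + 3) / fact (k + 3))) (nhds r)"
    by eventually_elim (simp add: kernel_prim_def)
  then show ?thesis using True
    by (subst DERIV_cong_ev[OF refl, of _ "\<lambda>x. - ((c - v) ^ (k + 3) / fact (k + 3))" _ _ 0]) auto
next
  case False
  then have r: "r > v" using assms by simp
  let ?f = "\<lambda>m. - ((c - m) ^ Suc (k + 1) / fact (Suc (k + 1)) * (m - v)) - (c - m) ^ Suc (k + 2) / fact (Suc (k + 2))"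
  have "eventually (\<lambda>y. y \<in> {v<..}) (nhds r)" using r by (intro eventually_nhds_in_open) auto
  then have ev: "eventually (\<lambda>y. kernel_prim k c v y = ?f y) (nhds r)"
    by eventually_elim (simp add: kernel_prim_def eval_nat_numeral)
  have 1: "((\<lambda>m. m - v) has_real_derivative 1) (at r)" by (auto intro!: derivative_eq_intros)
  have "(?f has_real_derivative - (- ((c - r) ^ (k + 1) / fact (k + 1)) * (r - v) + 1 * ((c - r) ^ Suc (k + 1) / fact (Suc (k + 1))))
      - - ((c - r) ^ (k + 2) / fact (k + 2))) (at r)"
    by (intro DERIV_diff DERIV_minus DERIV_mult power_fact_deriv 1)
  then have "(?f has_real_derivative (c - r) ^ (k + 1) / fact (k + 1) * max 0 (r - v)) (at r)"
    by (rule DERIV_cong) (use r in simp)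
  then show ?thesis by (subst DERIV_cong_ev[OF refl ev refl])
qed

lemma continuous_kernel_prim: "continuous_on S (kernel_prim k c v)"
  unfolding kernel_prim_def[abs_def] by (intro continuous_intros) auto

lemma kernel_prim_integral:
  assumes "0 \<le> a"
  shows "((\<lambda>r. (c - r) ^ (k + 1) / fact (k + 1) * tpow 1 r v) has_integral (kernel_prim k c v a - kernel_prim k c v 0)) {0..a}"
proof (rule fundamental_theorem_of_calculus_interior_strong[of "{v}"])
  fix x assume "x \<in> {0<..<a} - {v}"
  then show "(kernel_prim k c v has_vector_derivative (c - x) ^ (k + 1) / fact (k + 1) * tpow 1 x v) (at x)"
    using kernel_prim_deriv[of x v k c] by (simp add: tpow_def has_real_derivative_iff_has_vector_derivative)
qed (use assms continuous_kernel_prim in auto)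

text \<open>
  After the substitution \<open>r + t\<close>, the integrand of the convolution is the one of \<open>kernel_prim\<close>, cut off at
  \<open>r = u\<close> because the second factor is truncated there.
\<close>

lemma conv0_tpow:
  assumes "0 \<le> t" "0 \<le> u" "0 \<le> v"
  shows "conv0 (\<lambda>v. of_real (tpow 1 t v)) (\<lambda>v. of_real (tpow (k + 1) u v)) v
    = of_real (kernel_prim k (t + u) v (min v u + t) - kernel_prim k (t + u) v t)"
proof (cases "v = 0")
  case True
  have c: "continuous_on UNIV (\<lambda>v. complex_of_real (tpow m w v))" for m w
    by (intro continuous_intros continuous_tpow)
  show ?thesis using True assms conv0_eq_integral[OF c c, of 1 t "k + 1" u 0] by simp
next
  case False
  then have v: "v > 0" using assms by simp
  let ?Q = "\<lambda>s. kernel_prim k (t + u) v (min (v * s) u + t)"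
  let ?q = "\<lambda>s. v * (tpow 1 t (v * (1 - s)) * tpow (k + 1) u (v * s))"
  have "(?q has_integral (?Q 1 - ?Q 0)) {0..1}"
  proof (rule fundamental_theorem_of_calculus_interior_strong[of "{u / v, (v - t) / v}"])
    show "continuous_on {0..1} ?Q"
      by (rule continuous_on_compose2[OF continuous_kernel_prim[of UNIV]]) (auto intro!: continuous_intros)
    fix s assume s: "s \<in> {0<..<1} - {u / v, (v - t) / v}"
    then have ne: "v * s \<noteq> u" "v * s + t \<noteq> v" using v by (auto simp: field_simps)
    have "(?Q has_real_derivative ?q s) (at s)"
    proof (cases "v * s < u")
      case True
      have "((\<lambda>s. v * s + t) has_real_derivative v) (at s)" by (auto intro!: derivative_eq_intros)
      from DERIV_chain2[OF kernel_prim_deriv[OF ne(2), of k "t + u"] this]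
      have d: "((\<lambda>s. kernel_prim k (t + u) v (v * s + t)) has_real_derivative ?q s) (at s)"
        by (rule DERIV_cong) (use True in \<open>simp add: tpow_def algebra_simps\<close>)
      have "open {s. v * s < u}" by (intro open_Collect_less continuous_intros)
      then have "eventually (\<lambda>s. s \<in> {s. v * s < u}) (nhds s)" using True by (intro eventually_nhds_in_open) auto
      then have "eventually (\<lambda>s. ?Q s = kernel_prim k (t + u) v (v * s + t)) (nhds s)"
        by eventually_elim simp
      then show ?thesis by (subst DERIV_cong_ev[OF refl _ refl]) (use d in auto)
    next
      case False
      then have gt: "v * s > u" using ne(1) by simp
      have "open {s. u < v * s}" by (intro open_Collect_less continuous_intros)
      then have "eventually (\<lambda>s. s \<in> {s. u < v * s}) (nhds s)" using gt by (intro eventually_nhds_in_open) auto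
      then have "eventually (\<lambda>s. ?Q s = kernel_prim k (t + u) v (u + t)) (nhds s)"
        by eventually_elim simp
      then show ?thesis using gt
        by (subst DERIV_cong_ev[OF refl, of _ "\<lambda>s. kernel_prim k (t + u) v (u + t)" _ _ 0]) (auto simp: tpow_def)
    qed
    then show "(?Q has_vector_derivative ?q s) (at s)"
      by (simp add: has_real_derivative_iff_has_vector_derivative)
  qed auto
  then have "((\<lambda>s. complex_of_real (?q s)) has_integral of_real (?Q 1 - ?Q 0)) {0..1}"
    by (rule has_integral_of_real)
  moreover have c: "continuous_on UNIV (\<lambda>v. complex_of_real (tpow m w v))" for m w
    by (intro continuous_intros continuous_tpow)
  note conv0_has_integral[OF c c, of v 1 t "k + 1" u]
  ultimately show ?thesis using assms by (simp add: has_integral_unique)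
qed

text \<open>
  The binomial theorem for divided powers \<open>a\<^sup>n / n!\<close>, the form in which it meets truncated powers.
\<close>

lemma binomial_fact_sum:
  "(a + b) ^ n / fact n = (\<Sum>i\<le>n. a ^ (n - i) / fact (n - i) * (b ^ i / fact i :: real))"
proof -
  have "(b + a) ^ n / fact n = (\<Sum>i\<le>n. of_nat (n choose i) * b ^ i * a ^ (n - i) / fact n)"
    by (simp add: binomial_ring sum_divide_distrib)
  also have "\<dots> = (\<Sum>i\<le>n. a ^ (n - i) / fact (n - i) * (b ^ i / fact i))"
    by (intro sum.cong refl) (simp add: binomial_fact mult_ac)
  finally show ?thesis by (simp add: add.commute)
qed

text \<open>
  The left side is \<open>(-1)\<^sup>k\<close> times the \<open>k\<close>-th derivative of the convolution of two truncated powers of degree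
  \<open>k + 1\<close>; the right side is what \<open>\<integral>\<^sub>0\<^sup>t\<^sup>+\<^sup>u - \<integral>\<^sub>0\<^sup>t - \<integral>\<^sub>0\<^sup>u\<close> of \<open>g\<^sub>k\<^sub>+\<^sub>2 (t + u - r) (r - v)\<^sub>+\<close> gives. For \<open>v \<ge> u\<close> the
  sum vanishes and so do the contributions of \<open>[0, u]\<close>. For \<open>v < u\<close> the identity is the binomial expansion
  of \<open>(t + (u - v))\<^sup>k\<^sup>+\<^sup>3 / (k + 3)!\<close>, of which all but four terms form the sum over \<open>l\<close>.
\<close>

lemma semigroup_kernel_identity:
  assumes "0 \<le> t" "0 \<le> u" "0 \<le> v"
  shows "conv0 (\<lambda>v. of_real (tpow 1 t v)) (\<lambda>v. of_real (tpow (k + 1) u v)) v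
      - (\<Sum>l<k. of_real (tpow (k + 1 - l) t 0) * of_real (tpow (l + 2) u v))
    = of_real ((kernel_prim k (t + u) v (t + u) - kernel_prim k (t + u) v 0) - (kernel_prim k (t + u) v t - kernel_prim k (t + u) v 0)
      - (kernel_prim k (t + u) v u - kernel_prim k (t + u) v 0))"
proof -
  let ?P = "kernel_prim k (t + u) v"
  have "?P (t + u) - ?P u + ?P 0 - ?P (min v u + t) = - (\<Sum>l<k. tpow (k + 1 - l) t 0 * tpow (l + 2) u v)"
  proof (cases "v < u")
    case False
    then show ?thesis using assms by (simp add: kernel_prim_def tpow_def max_def add.commute)
  next
    case True
    define w where "w = u - v"
    have w: "u = v + w" "w > 0" using True by (simp_all add: w_def)
    have "(t + w) ^ (k + 3) / fact (k + 3) = (\<Sum>i\<le>Suc (Suc (Suc k)). t ^ (k + 3 - i) / fact (k + 3 - i) * (w ^ i / fact i))"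
      using binomial_fact_sum[of t w "k + 3"] by (simp add: eval_nat_numeral)
    also have "\<dots> = (\<Sum>i\<le>Suc k. t ^ (k + 3 - i) / fact (k + 3 - i) * (w ^ i / fact i))
        + t * (w ^ (k + 2) / fact (k + 2)) + w ^ (k + 3) / fact (k + 3)"
      by (simp add: eval_nat_numeral)
    also have "(\<Sum>i\<le>Suc k. t ^ (k + 3 - i) / fact (k + 3 - i) * (w ^ i / fact i))
       = (\<Sum>i<Suc (Suc k). t ^ (k + 3 - i) / fact (k + 3 - i) * (w ^ i / fact i))"
      by (simp only: lessThan_Suc_atMost)
    also have "\<dots> = t ^ (k + 3) / fact (k + 3) + t ^ (k + 2) / fact (k + 2) * w
        + (\<Sum>l<k. t ^ (k + 1 - l) / fact (k + 1 - l) * (w ^ (l + 2) / fact (l + 2)))"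
      unfolding sum.lessThan_Suc_shift by (simp add: eval_nat_numeral)
    finally show ?thesis
      using assms w by (simp add: kernel_prim_def tpow_def max_def algebra_simps)
  qed
  then have "?P (min v u + t) - ?P t - (\<Sum>l<k. tpow (k + 1 - l) t 0 * tpow (l + 2) u v)
    = (?P (t + u) - ?P 0) - (?P t - ?P 0) - (?P u - ?P 0)" by simp
  from arg_cong[OF this, of complex_of_real] show ?thesis
    unfolding conv0_tpow[OF assms] by (simp add: of_real_sum)
qed

lemma nderiv_monomial:
  "nderiv j (\<lambda>v. complex_of_real v ^ i / fact i) = (\<lambda>v. if j \<le> i then of_real v ^ (i - j) / fact (i - j) else 0)"
proof (induction j)
  case (Suc j)
  have "vderiv (\<lambda>v. if j \<le> i then complex_of_real v ^ (i - j) / fact (i - j) else 0)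
    = (\<lambda>v. if Suc j \<le> i then of_real v ^ (i - Suc j) / fact (i - Suc j) else 0)"
  proof (rule vderiv_eqI)
    fix t :: real
    consider "Suc j \<le> i" | "j = i" | "i < j" by linarith
    then show "((\<lambda>v. if j \<le> i then complex_of_real v ^ (i - j) / fact (i - j) else 0) has_vector_derivative
        (if Suc j \<le> i then of_real t ^ (i - Suc j) / fact (i - Suc j) else 0)) (at t)"
    proof cases
      case 1
      then obtain n where n: "i - j = Suc n" "i - Suc j = n" by (metis Suc_diff_le diff_Suc_Suc)
      have "((\<lambda>v. v ^ Suc n / fact (Suc n)) has_real_derivative real (Suc n) * t ^ n / fact (Suc n)) (at t)"
        using DERIV_cdivide[OF DERIV_pow[of "Suc n" t UNIV], of "fact (Suc n)"] by (simp del: fact_Suc power_Suc of_nat_Suc)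
      then have "((\<lambda>v. v ^ Suc n / fact (Suc n)) has_real_derivative t ^ n / fact n) (at t)"
        by (rule DERIV_cong) (simp add: field_simps del: of_nat_Suc)
      then have "((\<lambda>v. complex_of_real (v ^ Suc n / fact (Suc n))) has_vector_derivative complex_of_real (t ^ n / fact n)) (at t)"
        by (rule has_vector_derivative_of_real)
      then show ?thesis using 1 n by (simp del: power_Suc fact_Suc)
    qed auto
  qed
  then show ?case by (simp add: Suc)
qed simp

lemma test_function_with_jet:
  assumes "d > 0"
  obtains \<phi> where "\<phi> \<in> test_functions_on {-d..d}" "\<And>j. nderiv j \<phi> 0 = (if j = i then 1 else 0)"
proof -
  define c where "c v = smooth_step ((2 / d) * v + 2) * smooth_step ((- 2 / d) * v + 2)" for v
  let ?m = "\<lambda>v. complex_of_real v ^ i / fact i"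
  have sc: "smooth c" unfolding c_def[abs_def] by (intro smooth_mult smooth_affine[OF smooth_smooth_step])
  have sm: "smooth ?m" unfolding divide_inverse by (intro smooth_mult smooth_power smooth_of_real smooth_const)
  have "(\<lambda>v. c v * ?m v) \<in> test_functions_on {-d..d}"
  proof (rule test_functionsI)
    show "smooth (\<lambda>v. c v * ?m v)" by (intro smooth_mult sc sm)
    fix t assume "t \<notin> {-d..d}"
    then consider "t < - d" | "t > d" by force
    then have "c t = 0"
      using assms by cases (simp_all add: c_def smooth_step_0 field_simps)
    then show "c t * ?m t = 0" by simp
  qed
  moreover have "nderiv j (\<lambda>v. c v * ?m v) 0 = (if j = i then 1 else 0)" for j
  proof -
    have "nderiv j (\<lambda>v. c v * ?m v) 0 = nderiv j ?m 0"
    proof (rule nderiv_local[of "{-d/2<..<d/2}"])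
      fix t assume "t \<in> {-d/2<..<d/2}"
      then have "c t = 1" using assms by (simp add: c_def smooth_step_1 field_simps)
      then show "c t * ?m t = ?m t" by simp
    qed (use assms in auto)
    then show ?thesis by (auto simp: nderiv_monomial power_0_left)
  qed
  ultimately show thesis by (rule that)
qed


section \<open>Continuous seminorms\<close>

text \<open>
  Continuity at \<open>0\<close> is all that is asked for; subadditivity spreads it to the whole space. The seminorm
  is only controlled on the space itself.
\<close>

definition cseminorm :: "(complex \<Rightarrow> 'a::ab_group_add \<Rightarrow> 'a) \<Rightarrow> 'a topology \<Rightarrow> ('a \<Rightarrow> real) \<Rightarrow> bool" where
  "cseminorm s X p \<longleftrightarrow>
     (\<forall>x\<in>topspace X. \<forall>y\<in>topspace X. p (x + y) \<le> p x + p y) \<and>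
     (\<forall>c. \<forall>x\<in>topspace X. p (s c x) = cmod c * p x) \<and>
     (\<forall>e>0. \<exists>U. openin X U \<and> 0 \<in> U \<and> (\<forall>x\<in>U. p x < e))"

context complex_lcs
begin

abbreviation "TS \<equiv> topspace X"

lemma TS_0: "0 \<in> TS" and TS_add: "x \<in> TS \<Longrightarrow> y \<in> TS \<Longrightarrow> x + y \<in> TS"
  and TS_scale: "x \<in> TS \<Longrightarrow> s c x \<in> TS" and TS_diff: "x \<in> TS \<Longrightarrow> y \<in> TS \<Longrightarrow> x - y \<in> TS"
  and TS_neg: "x \<in> TS \<Longrightarrow> - x \<in> TS"
  and TS_sum: "(\<And>i. i \<in> A \<Longrightarrow> f i \<in> TS) \<Longrightarrow> sum f A \<in> TS"
  using subspace_topspace by (auto intro: subspace_0 subspace_add subspace_scale subspace_diff subspace_neg subspace_sum)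

lemma openin_translate:
  assumes "openin X U" "a \<in> TS"
  shows "openin X {z \<in> TS. z + a \<in> U}"
proof -
  have "continuous_map X X (\<lambda>z. z + a)"
    using continuous_map_compose[OF _ continuous_add, of X "\<lambda>z. (z, a)"] assms(2)
    by (auto simp: o_def continuous_map_pairwise)
  then show ?thesis by (rule openin_continuous_map_preimage) (rule assms)
qed

lemma openin_scale:
  assumes "openin X U"
  shows "openin X {z \<in> TS. s c z \<in> U}"
proof -
  have "continuous_map X X (\<lambda>z. s c z)"
    using continuous_map_compose[OF _ continuous_scale, of X "\<lambda>z. (c, z)"]
    by (auto simp: o_def continuous_map_pairwise)
  then show ?thesis by (rule openin_continuous_map_preimage) (rule assms)
qed

lemma scale_nhds:
  assumes "openin X U" "0 \<in> U" "x \<in> TS"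
  shows "\<exists>d>0. \<exists>V. openin X V \<and> x \<in> V \<and> (\<forall>c y. cmod c < d \<longrightarrow> y \<in> V \<longrightarrow> s c y \<in> U)"
proof -
  define P where "P = {z \<in> topspace (prod_topology euclidean X). (\<lambda>(c, x). s c x) z \<in> U}"
  have P: "s c y \<in> U" if "(c, y) \<in> P" for c y using that by (simp add: P_def)
  have "openin (prod_topology euclidean X) P"
    unfolding P_def by (rule openin_continuous_map_preimage[OF continuous_scale assms(1)])
  then have H: "\<forall>c y. (c, y) \<in> P \<longrightarrow> (\<exists>A V. openin euclidean A \<and> openin X V \<and> c \<in> A \<and> y \<in> V \<and> A \<times> V \<subseteq> P)"
    by (simp only: openin_prod_topology_alt)
  have "(0, x) \<in> P" using assms by (simp add: P_def)
  then obtain A V where A: "openin euclidean A" "openin X V" "0 \<in> A" "x \<in> V" "A \<times> V \<subseteq> P"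
    using H[THEN spec[of _ 0], THEN spec[of _ x]] by auto
  have "open A" using A(1) by simp
  then obtain d where d: "d > 0" "ball 0 d \<subseteq> A" using A(3) by (meson open_contains_ball)
  have "s c y \<in> U" if "cmod c < d" "y \<in> V" for c y
  proof -
    have "(c, y) \<in> A \<times> V" using that d(2) by auto
    then show ?thesis using A(5) P by (meson subsetD)
  qed
  then show ?thesis using A(2,4) d(1) by (intro exI[of _ d] conjI exI[of _ V]) simp_all
qed

lemma cseminormD:
  assumes "cseminorm s X p"
  shows "x \<in> TS \<Longrightarrow> y \<in> TS \<Longrightarrow> p (x + y) \<le> p x + p y"
    and "x \<in> TS \<Longrightarrow> p (s c x) = cmod c * p x"
    and "p 0 = 0"
    and "x \<in> TS \<Longrightarrow> p (- x) = p x"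
    and "x \<in> TS \<Longrightarrow> p x \<ge> 0"
    and "x \<in> TS \<Longrightarrow> y \<in> TS \<Longrightarrow> p (x - y) \<le> p x + p y"
    and "x \<in> TS \<Longrightarrow> y \<in> TS \<Longrightarrow> p x \<le> p y + p (x - y)"
    and "x \<in> TS \<Longrightarrow> y \<in> TS \<Longrightarrow> p (x - y) = p (y - x)"
proof -
  have add: "p (x + y) \<le> p x + p y" if "x \<in> TS" "y \<in> TS" for x y
    using assms that by (simp add: cseminorm_def)
  have sc: "p (s c x) = cmod c * p x" if "x \<in> TS" for x c
    using assms that by (simp add: cseminorm_def)
  have z: "p 0 = 0" using sc[OF TS_0, of 0] by simp
  have neg: "p (- x) = p x" if "x \<in> TS" for x using sc[OF that, of "-1"] by simp
  have nn: "p x \<ge> 0" if "x \<in> TS" for x using add[OF that TS_neg[OF that]] neg[OF that] z by simp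
  show "x \<in> TS \<Longrightarrow> y \<in> TS \<Longrightarrow> p (x + y) \<le> p x + p y" by (rule add)
  show "x \<in> TS \<Longrightarrow> p (s c x) = cmod c * p x" by (rule sc)
  show "p 0 = 0" by (rule z)
  show "x \<in> TS \<Longrightarrow> p (- x) = p x" by (rule neg)
  show "x \<in> TS \<Longrightarrow> p x \<ge> 0" by (rule nn)
  show "x \<in> TS \<Longrightarrow> y \<in> TS \<Longrightarrow> p (x - y) \<le> p x + p y" using add[of x "- y"] neg[of y] TS_neg[of y] by simp
  show "x \<in> TS \<Longrightarrow> y \<in> TS \<Longrightarrow> p x \<le> p y + p (x - y)" using add[of y "x - y"] TS_diff[of x y] by simp
  show "x \<in> TS \<Longrightarrow> y \<in> TS \<Longrightarrow> p (x - y) = p (y - x)" using neg[of "x - y"] TS_diff[of x y] by simp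
qed

lemma cseminorm_sum:
  assumes "cseminorm s X p" "finite A" "\<And>i. i \<in> A \<Longrightarrow> f i \<in> TS"
  shows "p (sum f A) \<le> (\<Sum>i\<in>A. p (f i))"
  using assms(2,3)
proof (induction A rule: finite_induct)
  case (insert i A)
  have "p (f i + sum f A) \<le> p (f i) + p (sum f A)"
    using insert.prems by (intro cseminormD(1)[OF assms(1)] TS_sum) auto
  then show ?case using insert by fastforce
qed (simp add: cseminormD(3)[OF assms(1)])

lemma openin_seminorm_ball:
  assumes "cseminorm s X p" "a \<in> TS"
  shows "openin X {x \<in> TS. p (x - a) < e}"
proof (subst openin_subopen, intro ballI)
  fix y assume y: "y \<in> {x \<in> TS. p (x - a) < e}"
  then have "e - p (y - a) > 0" by simp
  then obtain U where U: "openin X U" "0 \<in> U" "\<forall>x\<in>U. p x < e - p (y - a)"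
    using assms(1) unfolding cseminorm_def by blast
  let ?T = "{z \<in> TS. z + (- y) \<in> U}"
  have "openin X ?T" using U(1) y by (intro openin_translate TS_neg) auto
  moreover have "y \<in> ?T" using y U by simp
  moreover have "?T \<subseteq> {x \<in> TS. p (x - a) < e}"
  proof safe
    fix z assume z: "z \<in> TS" "z + - y \<in> U"
    have "p ((z - y) + (y - a)) \<le> p (z - y) + p (y - a)"
      using z y assms by (intro cseminormD(1)[OF assms(1)] TS_diff) auto
    moreover have "p (z - y) < e - p (y - a)" using U(3) z(2) by simp
    ultimately show "p (z - a) < e" by simp
  qed
  ultimately show "\<exists>T. openin X T \<and> y \<in> T \<and> T \<subseteq> {x \<in> TS. p (x - a) < e}" by blast
qed

text \<open>
  The gauge of the largest balanced subset of a convex neighbourhood \<open>W\<close>: \<open>r\<close> is admitted at \<open>x\<close> if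
  \<open>c x \<in> W\<close> whenever \<open>\<bar>c\<bar> \<le> 1 / r\<close>. Building the balancing into the gauge yields complex homogeneity
  directly, and convexity of \<open>W\<close> gives subadditivity.
\<close>

lemma seminorm_ball_in_nhd:
  assumes "openin X U" "0 \<in> U"
  shows "\<exists>p. cseminorm s X p \<and> (\<forall>x. x \<in> TS \<longrightarrow> p x < 1 \<longrightarrow> x \<in> U)"
proof -
  obtain W where W: "openin X W" "0 \<in> W" "W \<subseteq> U" "convex_wrt s W"
    using locally_convex[OF assms] by blast
  \<comment> \<open>the radii admitted at \<open>x\<close>; the gauge is their infimum\<close>
  define R where "R x = {r::real. r > 0 \<and> (\<forall>c. cmod c * r \<le> 1 \<longrightarrow> s c x \<in> W)}" for x
  define p where "p x = Inf (R x)" for x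
  have bdd: "bdd_below (R x)" for x unfolding R_def by (rule bdd_belowI[of _ 0]) auto
  have ne: "R x \<noteq> {}" if x: "x \<in> TS" for x
  proof -
    obtain d V where d: "d > 0" "openin X V" "x \<in> V" "\<forall>c y. cmod c < d \<longrightarrow> y \<in> V \<longrightarrow> s c y \<in> W"
      using scale_nhds[OF W(1,2) x] by metis
    have "s c x \<in> W" if "cmod c * (2 / d) \<le> 1" for c
    proof -
      have "cmod c < d" using that d(1) by (simp add: divide_simps)
      then show ?thesis using d(3,4) by simp
    qed
    then have "2 / d \<in> R x" unfolding R_def using d(1) by simp
    then show ?thesis by auto
  qed
  have lt: "\<exists>r\<in>R x. r < e" if "x \<in> TS" "p x < e" for x e
    by (rule cInf_lessD[OF ne[OF that(1)]]) (use that(2) in \<open>simp add: p_def\<close>)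
  have le: "p x \<le> r" if "r \<in> R x" for x r unfolding p_def by (rule cInf_lower[OF that bdd])
  have nn: "p x \<ge> 0" if "x \<in> TS" for x unfolding p_def by (rule cInf_greatest[OF ne[OF that]]) (simp add: R_def)
  have add: "p (x + y) \<le> p x + p y" if x: "x \<in> TS" and y: "y \<in> TS" for x y
  proof (rule field_le_epsilon)
    fix e :: real assume "e > 0"
    then obtain r1 r2 where r: "r1 \<in> R x" "r1 < p x + e/2" "r2 \<in> R y" "r2 < p y + e/2"
      using lt[OF x, of "p x + e/2"] lt[OF y, of "p y + e/2"] by auto
    then have pos: "r1 > 0" "r2 > 0" by (auto simp: R_def)
    have "r1 + r2 \<in> R (x + y)" unfolding R_def
    proof (safe)
      show "0 < r1 + r2" using pos by simp
      fix c assume c: "cmod c * (r1 + r2) \<le> 1"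
      let ?u = "r1 / (r1 + r2)"
      have u: "0 \<le> ?u" "?u \<le> 1" "1 - ?u = r2 / (r1 + r2)" using pos by (auto simp: field_simps)
      have "cmod (of_real ((r1 + r2) / r1) * c) * r1 \<le> 1" "cmod (of_real ((r1 + r2) / r2) * c) * r2 \<le> 1"
        unfolding norm_mult norm_of_real using c pos by (simp_all add: mult.commute)
      then have "s (of_real ((r1 + r2) / r1) * c) x \<in> W" "s (of_real ((r1 + r2) / r2) * c) y \<in> W"
        using r(1,3) unfolding R_def by blast+
      then have "s (of_real ?u) (s (of_real ((r1 + r2) / r1) * c) x) + s (of_real (1 - ?u)) (s (of_real ((r1 + r2) / r2) * c) y) \<in> W"
        using W(4) u unfolding convex_wrt_def by blast
      moreover have "?u * ((r1 + r2) / r1) = 1" "(1 - ?u) * ((r1 + r2) / r2) = 1"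
        unfolding u(3) using pos by simp_all
      then have "of_real ?u * (of_real ((r1 + r2) / r1) * c) = c" "of_real (1 - ?u) * (of_real ((r1 + r2) / r2) * c) = c"
        unfolding mult.assoc[symmetric] of_real_mult[symmetric] by simp_all
      ultimately show "s c (x + y) \<in> W" by (simp add: scale_right_distrib)
    qed
    then show "p (x + y) \<le> p x + p y + e" using le r by fastforce
  qed
  have sc_le: "p (s c x) \<le> cmod c * p x" if x: "x \<in> TS" for c x
  proof (rule field_le_epsilon)
    fix e :: real assume e: "e > 0"
    let ?e = "e / 2 / (cmod c + 1)"
    have cp: "cmod c + 1 > 0" by (rule add_nonneg_pos) auto
    have "?e > 0" using e cp by simp
    then obtain r where r: "r \<in> R x" "r < p x + ?e" using lt[OF x, of "p x + ?e"] by auto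
    have rp: "r > 0" using r by (simp add: R_def)
    define d where "d = e / 2 / (r + 1)"
    have d0: "d > 0" using rp e by (simp add: d_def)
    have "d * (r + 1) = e / 2" using rp unfolding d_def by (intro nonzero_eq_divide_eq[THEN iffD1, OF _ refl]) simp
    then have d: "d > 0" "d * r \<le> e / 2" using d0 by (simp_all add: distrib_left)
    have "(cmod c + d) * r \<in> R (s c x)" unfolding R_def
    proof safe
      show "0 < (cmod c + d) * r" using rp d by (intro mult_pos_pos add_nonneg_pos) auto
      fix a assume "cmod a * ((cmod c + d) * r) \<le> 1"
      moreover have "cmod a * (cmod c * r) \<le> cmod a * ((cmod c + d) * r)"
        using rp d by (intro mult_left_mono mult_right_mono) auto
      ultimately have "cmod (a * c) * r \<le> 1" by (simp add: norm_mult mult.assoc)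
      then show "s a (s c x) \<in> W" using r(1) by (simp add: R_def)
    qed
    then have "p (s c x) \<le> cmod c * r + d * r" using le by (simp add: distrib_right)
    moreover have "cmod c * r \<le> cmod c * (p x + ?e)" using r by (intro mult_left_mono) auto
    moreover have "cmod c + 1 \<noteq> 0" using cp by simp
    then have "(cmod c + 1) * ?e = e / 2" by (metis nonzero_mult_div_cancel_left times_divide_eq_right)
    then have "cmod c * ?e \<le> e / 2" using cp e by (simp only: distrib_right) (use \<open>?e > 0\<close> in linarith)
    ultimately show "p (s c x) \<le> cmod c * p x + e" using d by (simp only: distrib_left)
  qed
  have sc: "p (s c x) = cmod c * p x" if x: "x \<in> TS" for c x
  proof (cases "c = 0")
    case True
    then show ?thesis using sc_le[OF x, of 0] nn[OF TS_scale[OF x, of 0]] by simp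
  next
    case False
    have "p x \<le> cmod (inverse c) * p (s c x)" using sc_le[OF TS_scale[OF x], of "inverse c" c] False by simp
    then have "cmod c * p x \<le> cmod c * (cmod (inverse c) * p (s c x))" by (rule mult_left_mono) simp
    then have "cmod c * p x \<le> p (s c x)" using False by (simp add: norm_inverse mult.assoc[symmetric])
    then show ?thesis using sc_le[OF x, of c] by simp
  qed
  have cont: "\<exists>U. openin X U \<and> 0 \<in> U \<and> (\<forall>x\<in>U. p x < e)" if e: "e > 0" for e
  proof -
    obtain d V where d: "d > 0" "openin X V" "0 \<in> V" "\<forall>c y. cmod c < d \<longrightarrow> y \<in> V \<longrightarrow> s c y \<in> W"
      using scale_nhds[OF W(1,2) TS_0] by metis
    have pV: "p y \<le> 2 / d" if y: "y \<in> V" for y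
    proof (rule le)
      have "s c y \<in> W" if "cmod c * (2 / d) \<le> 1" for c
      proof -
        have "cmod c < d" using that d(1) by (simp add: divide_simps)
        then show ?thesis using y d(4) by simp
      qed
      then show "2 / d \<in> R y" unfolding R_def using d(1) by simp
    qed
    let ?k = "of_real (4 / (d * e)) :: complex"
    let ?U = "{z \<in> TS. s ?k z \<in> V}"
    have "p x < e" if "x \<in> ?U" for x
    proof -
      have "x \<in> TS" and kx: "s ?k x \<in> V" using that by simp_all
      have "cmod ?k * p x \<le> 2 / d" using pV[OF kx] unfolding sc[OF \<open>x \<in> TS\<close>] .
      then have "4 / (d * e) * p x \<le> 2 / d" unfolding norm_of_real using d e by simp
      then have "p x \<le> e / 2" using d e by (simp add: field_simps)
      then show ?thesis using e by simp
    qed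
    moreover have "openin X ?U" by (rule openin_scale[OF d(2)])
    moreover have "0 \<in> ?U" using d TS_0 by simp
    ultimately show ?thesis by blast
  qed
  show ?thesis
  proof (intro exI[of _ p] conjI allI impI)
    show "cseminorm s X p" unfolding cseminorm_def by (intro conjI ballI allI impI add sc cont)
  next
    fix x assume x: "x \<in> TS" "p x < 1"
    then obtain r where r: "r \<in> R x" "r < 1" using lt[OF x] by blast
    have "\<forall>c. cmod c * r \<le> 1 \<longrightarrow> s c x \<in> W" using r(1) unfolding R_def by blast
    from this[rule_format, of 1] have "x \<in> W" using r(2) by (simp add: scale_one)
    then show "x \<in> U" by (rule subsetD[OF W(3)])
  qed
qed

lemma limitin_seminorm:
  "limitin X f l F \<longleftrightarrow> l \<in> TS \<and> eventually (\<lambda>i. f i \<in> TS) F \<and>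
     (\<forall>p e. cseminorm s X p \<longrightarrow> e > 0 \<longrightarrow> eventually (\<lambda>i. p (f i - l) < e) F)"
proof safe
  assume l: "limitin X f l F"
  show lT: "l \<in> TS" using l by (rule limitin_topspace)
  show "eventually (\<lambda>i. f i \<in> TS) F" using l openin_topspace by (auto simp: limitin_def)
  fix p and e :: real assume p: "cseminorm s X p" "e > 0"
  have "eventually (\<lambda>i. f i \<in> {x \<in> TS. p (x - l) < e}) F"
    by (rule l[unfolded limitin_def, THEN conjunct2, rule_format])
       (use openin_seminorm_ball[OF p(1) lT, of e] p(2) lT cseminormD(3)[OF p(1)] in simp)
  then show "eventually (\<lambda>i. p (f i - l) < e) F" by eventually_elim simp
next
  assume l: "l \<in> TS" "eventually (\<lambda>i. f i \<in> TS) F"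
    "\<forall>p e. cseminorm s X p \<longrightarrow> e > 0 \<longrightarrow> eventually (\<lambda>i. p (f i - l) < e) F"
  show "limitin X f l F" unfolding limitin_def
  proof (intro conjI allI impI l(1))
    fix U assume U: "openin X U \<and> l \<in> U"
    then have o: "openin X {z \<in> TS. z + l \<in> U}" "0 \<in> {z \<in> TS. z + l \<in> U}"
      using l(1) openin_translate TS_0 by auto
    obtain p where p: "cseminorm s X p" "\<forall>x. x \<in> TS \<longrightarrow> p x < 1 \<longrightarrow> x \<in> {z \<in> TS. z + l \<in> U}"
      using seminorm_ball_in_nhd[OF o] by blast
    have "eventually (\<lambda>i. p (f i - l) < 1) F" using l(3) p(1) by simp
    with l(2) show "eventually (\<lambda>i. f i \<in> U) F"
    proof eventually_elim
      case (elim i)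
      then have "f i - l \<in> {z \<in> TS. z + l \<in> U}" using l(1) by (intro p(2)[rule_format] TS_diff)
      then show ?case by simp
    qed
  qed
qed

lemma seminorms_separate:
  assumes "Hausdorff_space X" "x \<in> TS" "y \<in> TS" "\<And>p e. cseminorm s X p \<Longrightarrow> e > 0 \<Longrightarrow> p (x - y) < e"
  shows "x = y"
proof -
  have "limitin X (\<lambda>n::nat. x) y sequentially" unfolding limitin_seminorm using assms by simp
  moreover have "limitin X (\<lambda>n::nat. x) x sequentially" using assms(2) by (simp add: limitin_def)
  ultimately show ?thesis using assms(1) limitin_Hausdorff_unique trivial_limit_sequentially by metis
qed

lemma seq_complete_seminorm:
  assumes "seq_complete X" "\<And>n::nat. f n \<in> TS"
    and "\<And>p e. cseminorm s X p \<Longrightarrow> e > 0 \<Longrightarrow> \<exists>n0. \<forall>m\<ge>n0. \<forall>n\<ge>n0. p (f m - f n) < e"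
  shows "\<exists>l. limitin X f l sequentially"
proof -
  have "\<exists>n0. \<forall>m\<ge>n0. \<forall>n\<ge>n0. f m - f n \<in> U" if U: "openin X U" "0 \<in> U" for U
  proof -
    obtain p where p: "cseminorm s X p" "\<forall>x. x \<in> TS \<longrightarrow> p x < 1 \<longrightarrow> x \<in> U"
      using seminorm_ball_in_nhd[OF U] by blast
    obtain n0 where "\<forall>m\<ge>n0. \<forall>n\<ge>n0. p (f m - f n) < 1" using assms(3)[OF p(1), of 1] by auto
    then show ?thesis using p(2) TS_diff[OF assms(2) assms(2)] by blast
  qed
  then show ?thesis using assms(1,2) unfolding seq_complete_def by (auto simp: image_subset_iff)
qed

lemma continuous_map_seminorm:
  assumes "\<And>t. t \<in> topspace T \<Longrightarrow> f t \<in> TS"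
    and "\<And>t p e. t \<in> topspace T \<Longrightarrow> cseminorm s X p \<Longrightarrow> e > 0 \<Longrightarrow> \<exists>V. openin T V \<and> t \<in> V \<and> (\<forall>u\<in>V. p (f u - f t) < e)"
  shows "continuous_map T X f"
  unfolding continuous_map_def
proof (intro conjI allI impI)
  show "f \<in> topspace T \<rightarrow> TS" using assms(1) by auto
  fix U assume U: "openin X U"
  show "openin T {x \<in> topspace T. f x \<in> U}"
  proof (subst openin_subopen, intro ballI)
    fix t assume t: "t \<in> {x \<in> topspace T. f x \<in> U}"
    then have ft: "f t \<in> TS" using assms(1) by simp
    have o: "openin X {z \<in> TS. z + f t \<in> U}" "0 \<in> {z \<in> TS. z + f t \<in> U}"
      using t ft U openin_translate TS_0 by auto
    obtain p where p: "cseminorm s X p" "\<forall>x. x \<in> TS \<longrightarrow> p x < 1 \<longrightarrow> x \<in> {z \<in> TS. z + f t \<in> U}"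
      using seminorm_ball_in_nhd[OF o] by blast
    obtain V where V: "openin T V" "t \<in> V" "\<forall>u\<in>V. p (f u - f t) < 1"
      using assms(2)[of t p 1] t p(1) by auto
    have "u \<in> topspace T" "f u \<in> U" if "u \<in> V" for u
    proof -
      show u: "u \<in> topspace T" using that V(1) openin_subset by blast
      have "f u - f t \<in> {z \<in> TS. z + f t \<in> U}" using V(3) that u ft assms(1) by (intro p(2)[rule_format] TS_diff) auto
      then show "f u \<in> U" by simp
    qed
    then show "\<exists>W. openin T W \<and> t \<in> W \<and> W \<subseteq> {x \<in> topspace T. f x \<in> U}" using V by blast
  qed
qed

end


section \<open>Continuous linear operators\<close>

lemma sum_fun_eval: "(\<Sum>i\<in>A. f i) x = (\<Sum>i\<in>A. f i x :: 'b::comm_monoid_add)"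
  by (induction A rule: infinite_finite_induct) auto

context complex_lcs
begin

lemma end_opsD:
  assumes "f \<in> end_ops s X"
  shows "x \<in> TS \<Longrightarrow> f x \<in> TS" "x \<in> TS \<Longrightarrow> y \<in> TS \<Longrightarrow> f (x + y) = f x + f y"
    "x \<in> TS \<Longrightarrow> f (s c x) = s c (f x)" "f 0 = 0" "x \<in> TS \<Longrightarrow> y \<in> TS \<Longrightarrow> f (x - y) = f x - f y"
    "x \<notin> TS \<Longrightarrow> f x = 0"
proof -
  have add: "f (x + y) = f x + f y" if "x \<in> TS" "y \<in> TS" for x y using assms that by (simp add: lin_ops_def)
  have sc: "f (s c x) = s c (f x)" if "x \<in> TS" for c x using assms that by (simp add: lin_ops_def)
  show "x \<in> TS \<Longrightarrow> y \<in> TS \<Longrightarrow> f (x + y) = f x + f y" by (rule add)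
  show "x \<in> TS \<Longrightarrow> f (s c x) = s c (f x)" by (rule sc)
  show "x \<in> TS \<Longrightarrow> f x \<in> TS" using assms by (auto simp: lin_ops_def continuous_map_def)
  show "x \<notin> TS \<Longrightarrow> f x = 0" using assms by (simp add: lin_ops_def)
  show "f 0 = 0" using sc[OF TS_0, of 0] by simp
  show "x \<in> TS \<Longrightarrow> y \<in> TS \<Longrightarrow> f (x - y) = f x - f y"
    using add[of x "- y"] sc[of y "-1"] TS_neg[of y] by simp
qed

lemma cseminorm_comp:
  assumes "f \<in> end_ops s X" "cseminorm s X p"
  shows "cseminorm s X (\<lambda>x. p (f x))"
  unfolding cseminorm_def
proof (intro conjI ballI allI impI)
  fix x y assume "x \<in> TS" "y \<in> TS"
  then show "p (f (x + y)) \<le> p (f x) + p (f y)"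
    using cseminormD(1)[OF assms(2)] end_opsD[OF assms(1)] by simp
next
  fix c x assume "x \<in> TS"
  then show "p (f (s c x)) = cmod c * p (f x)"
    using cseminormD(2)[OF assms(2)] end_opsD[OF assms(1)] by simp
next
  fix e :: real assume e: "e > 0"
  have "continuous_map X X f" using assms(1) by (simp add: lin_ops_def)
  then have "openin X {x \<in> TS. f x \<in> {y \<in> TS. p (y - 0) < e}}"
    by (rule openin_continuous_map_preimage) (rule openin_seminorm_ball[OF assms(2) TS_0])
  moreover have "0 \<in> {x \<in> TS. f x \<in> {y \<in> TS. p (y - 0) < e}}"
    using e TS_0 end_opsD(4)[OF assms(1)] cseminormD(3)[OF assms(2)] by simp
  ultimately show "\<exists>U. openin X U \<and> 0 \<in> U \<and> (\<forall>x\<in>U. p (f x) < e)"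
    by (intro exI[of _ "{x \<in> TS. f x \<in> {y \<in> TS. p (y - 0) < e}}"]) simp
qed

lemma cseminorm_scale:
  assumes "cseminorm s X p" "r \<ge> 0"
  shows "cseminorm s X (\<lambda>x. r * p x)"
proof -
  have "(\<lambda>x. s (of_real r) x) \<in> {f. continuous_map X X f}"
    using continuous_map_compose[OF _ continuous_scale, of X "\<lambda>z. (of_real r, z)"]
    by (auto simp: o_def continuous_map_pairwise)
  then have c: "continuous_map X X (\<lambda>x. s (of_real r) x)" by simp
  show ?thesis
    unfolding cseminorm_def
  proof (intro conjI ballI allI impI)
    fix x y assume "x \<in> TS" "y \<in> TS"
    then show "r * p (x + y) \<le> r * p x + r * p y"
      using mult_left_mono[OF cseminormD(1)[OF assms(1)] assms(2)] by (simp add: distrib_left)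
  next
    fix c x assume "x \<in> TS"
    then show "r * p (s c x) = cmod c * (r * p x)"
      using cseminormD(2)[OF assms(1)] by simp
  next
    fix e :: real assume e: "e > 0"
    then have "e / (r + 1) > 0" using assms(2) by simp
    then obtain U where U: "openin X U" "0 \<in> U" "\<forall>x\<in>U. p x < e / (r + 1)"
      using assms(1) unfolding cseminorm_def by blast
    have "r * p x < e" if "x \<in> U" for x
    proof -
      have "p x < e / (r + 1)" "p x \<ge> 0"
        using U that cseminormD(5)[OF assms(1)] openin_subset by blast+
      then have "(r + 1) * p x < e" using assms(2) by (simp add: pos_less_divide_eq mult.commute)
      then show ?thesis using \<open>p x \<ge> 0\<close> by (simp add: distrib_right)
    qed
    then show "\<exists>U. openin X U \<and> 0 \<in> U \<and> (\<forall>x\<in>U. r * p x < e)" using U by blast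
  qed
qed

lemma bounded_singleton: "x \<in> TS \<Longrightarrow> bounded_wrt s X {x}"
  unfolding bounded_wrt_def
proof (intro conjI allI impI)
  fix U assume x: "x \<in> TS" and "openin X U \<and> 0 \<in> U"
  then obtain d V where d: "d > 0" "x \<in> V" "\<forall>c y. cmod c < d \<longrightarrow> y \<in> V \<longrightarrow> s c y \<in> U"
    using scale_nhds[of U x] by metis
  show "absorbs s U {x}" unfolding absorbs_def
  proof (intro exI[of _ "2 / d"] conjI allI impI)
    show "0 < 2 / d" using d by simp
    fix c assume c: "2 / d \<le> cmod c"
    then have c0: "c \<noteq> 0" using d(1) by auto
    have "cmod (inverse c) < d"
    proof -
      have "2 \<le> d * cmod c" using c d(1) by (simp add: pos_divide_le_eq mult.commute)
      then have "1 / cmod c < d" using c0 by (subst pos_divide_less_eq) auto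
      then show ?thesis by (simp add: inverse_eq_divide norm_divide)
    qed
    then have "s (inverse c) x \<in> U" using d(2,3) by simp
    then have "s c (s (inverse c) x) \<in> s c ` U" by (rule imageI)
    then show "{x} \<subseteq> s c ` U" using c0 by simp
  qed
qed simp

text \<open>
  Singletons are bounded, so uniform convergence on bounded sets implies pointwise convergence. This
  transfers the integral in the operator space to integrals in the underlying space.
\<close>

lemma continuous_eval:
  assumes x: "x \<in> TS"
  shows "continuous_map (op_space s X) X (\<lambda>f. f x)"
proof (rule continuous_map_seminorm)
  note ts = topspace_op_space[OF TS_0, of s]
  fix f assume "f \<in> topspace (op_space s X)"
  then have f: "f \<in> end_ops s X" by (simp add: ts)
  then show "f x \<in> TS" using end_opsD(1)[OF f x] by simp
  fix p and e :: real assume p: "cseminorm s X p" "e > 0"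
  let ?V = "{g \<in> end_ops s X. p (g x - f x) < e}"
  have "openin (op_space s X) ?V"
    unfolding openin_op_space[OF TS_0]
  proof (intro conjI ballI)
    fix g assume g: "g \<in> ?V"
    let ?U = "{z \<in> TS. p (z - 0) < e - p (g x - f x)}"
    let ?W = "{h \<in> end_ops s X. h ` {x} \<subseteq> ?U}"
    have "openin X ?U" by (rule openin_seminorm_ball[OF p(1) TS_0])
    moreover have "0 \<in> ?U" using g TS_0 cseminormD(3)[OF p(1)] by simp
    ultimately have "?W \<in> end_ops_base s X"
      unfolding end_ops_base_def using bounded_singleton[OF x]
      by (intro CollectI exI[of _ "{x}"] exI[of _ ?U]) simp
    moreover have "h \<in> ?V" if h: "h \<in> end_ops s X" "h - g \<in> ?W" for h
    proof -
      have "p (h x - g x) < e - p (g x - f x)" using h(2) by simp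
      moreover have gT: "g \<in> end_ops s X" using g by simp
      have "p ((h x - g x) + (g x - f x)) \<le> p (h x - g x) + p (g x - f x)"
        by (intro cseminormD(1)[OF p(1)] TS_diff end_opsD(1)[OF h(1) x] end_opsD(1)[OF gT x] end_opsD(1)[OF f x])
      ultimately show ?thesis using h(1) by simp
    qed
    ultimately show "\<exists>W\<in>end_ops_base s X. \<forall>h\<in>end_ops s X. h - g \<in> W \<longrightarrow> h \<in> ?V" by (intro bexI[of _ ?W]) simp_all
  qed simp
  moreover have "f \<in> ?V" using f p cseminormD(3)[OF p(1)] by simp
  ultimately show "\<exists>V. openin (op_space s X) V \<and> f \<in> V \<and> (\<forall>g\<in>V. p (g x - f x) < e)"
    by (intro exI[of _ ?V]) simp
qed

lemma limitin_seminorm_le: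
  assumes "limitin X f l F" "F \<noteq> bot" "cseminorm s X p" "eventually (\<lambda>i. p (f i) \<le> B) F"
  shows "p l \<le> B"
proof (rule field_le_epsilon)
  fix e :: real assume "e > 0"
  then have "eventually (\<lambda>i. p (f i - l) < e) F" "eventually (\<lambda>i. f i \<in> TS) F" and l: "l \<in> TS"
    using assms(1,3) unfolding limitin_seminorm by blast+
  with assms(4) have "eventually (\<lambda>i. p (f i) \<le> B \<and> p (f i - l) < e \<and> f i \<in> TS) F"
    by (intro eventually_conj)
  then obtain i where i: "p (f i) \<le> B" "p (f i - l) < e" "f i \<in> TS"
    using assms(2) eventually_happens' by blast
  have "p l \<le> p (f i) + p (l - f i)" by (rule cseminormD(7)[OF assms(3) l i(3)])
  then show "p l \<le> B + e" using i cseminormD(8)[OF assms(3) l i(3)] by simp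
qed

lemma openin_seminorm_gt:
  assumes "cseminorm s X q"
  shows "openin X {x \<in> TS. q x > 1}"
proof (subst openin_subopen, intro ballI)
  fix y assume y: "y \<in> {x \<in> TS. q x > 1}"
  let ?T = "{x \<in> TS. q (x - y) < q y - 1}"
  have "openin X ?T" using y by (intro openin_seminorm_ball[OF assms]) simp
  moreover have "y \<in> ?T" using y cseminormD(3)[OF assms] by simp
  moreover have "?T \<subseteq> {x \<in> TS. q x > 1}"
  proof safe
    fix x assume x: "x \<in> TS" "q (x - y) < q y - 1"
    then show "q x > 1" using cseminormD(7)[OF assms, of y x] cseminormD(8)[OF assms, of x y] y by simp
  qed
  ultimately show "\<exists>T. openin X T \<and> y \<in> T \<and> T \<subseteq> {x \<in> TS. q x > 1}" by blast
qed

text \<open>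
  The Banach-Steinhaus theorem: the set where all \<open>p \<circ> f v\<close> are at most \<open>1\<close> is a barrel.
\<close>

lemma barreled_equicontinuous:
  assumes "barreled s X" "cseminorm s X p" "\<And>v. v \<in> I \<Longrightarrow> f v \<in> end_ops s X"
    and bd: "\<And>x. x \<in> TS \<Longrightarrow> \<exists>B. \<forall>v\<in>I. p (f v x) \<le> B"
  shows "\<exists>q. cseminorm s X q \<and> (\<forall>x\<in>TS. \<forall>v\<in>I. p (f v x) \<le> q x)"
proof -
  define W where "W = {x \<in> TS. \<forall>v\<in>I. p (f v x) \<le> 1}"
  have sc: "p (f v (s c x)) = cmod c * p (f v x)" if "v \<in> I" "x \<in> TS" for v c x
    by (rule cseminormD(2)[OF cseminorm_comp[OF assms(3)[OF that(1)] assms(2)] that(2)])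
  have "TS - W = (\<Union>v\<in>I. {x \<in> TS. p (f v x) > 1})"
    unfolding W_def by (auto simp: not_le)
  moreover have "openin X (\<Union>v\<in>I. {x \<in> TS. p (f v x) > 1})"
    by (intro openin_Union) (auto intro!: openin_seminorm_gt[OF cseminorm_comp] assms)
  ultimately have 1: "closedin X W" unfolding closedin_def by (simp add: W_def)
  have 2: "abs_convex_wrt s W"
    unfolding abs_convex_wrt_def
  proof (intro ballI allI impI)
    fix x y a b assume x: "x \<in> W" and y: "y \<in> W" and ab: "cmod a + cmod b \<le> 1"
    have "p (f v (s a x + s b y)) \<le> 1" if v: "v \<in> I" for v
    proof -
      have "p (f v (s a x + s b y)) \<le> p (f v (s a x)) + p (f v (s b y))"
        using x y by (intro cseminormD(1)[OF cseminorm_comp[OF assms(3)[OF v] assms(2)]] TS_scale) (auto simp: W_def)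
      also have "\<dots> \<le> cmod a * 1 + cmod b * 1"
        using x y v by (intro add_mono) (auto simp: sc W_def intro!: mult_left_le)
      finally show ?thesis using ab by simp
    qed
    then show "s a x + s b y \<in> W" using x y by (auto simp: W_def intro: TS_add TS_scale)
  qed
  have 3: "absorbs s W {x}" if x: "x \<in> TS" for x
  proof -
    obtain B where B: "\<forall>v\<in>I. p (f v x) \<le> B" using bd[OF x] by blast
    show ?thesis unfolding absorbs_def
    proof (intro exI[of _ "\<bar>B\<bar> + 1"] conjI allI impI)
      fix c assume c: "\<bar>B\<bar> + 1 \<le> cmod c"
      then have c0: "c \<noteq> 0" by auto
      have "p (f v (s (inverse c) x)) \<le> 1" if v: "v \<in> I" for v
      proof -
        have "p (f v x) \<le> cmod c" using B v c by fastforce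
        then show ?thesis using c0 by (simp add: sc[OF v x] inverse_eq_divide norm_divide divide_le_eq_1)
      qed
      then have "s (inverse c) x \<in> W" using x by (simp add: W_def TS_scale)
      then have "s c (s (inverse c) x) \<in> s c ` W" by (rule imageI)
      then show "{x} \<subseteq> s c ` W" using c0 by simp
    qed simp
  qed
  have "barrel s X W" unfolding barrel_def using 1 2 3 by blast
  then obtain U where U: "openin X U" "0 \<in> U" "U \<subseteq> W" using assms(1) unfolding barreled_def by blast
  obtain q where q: "cseminorm s X q" "\<forall>x. x \<in> TS \<longrightarrow> q x < 1 \<longrightarrow> x \<in> U"
    using seminorm_ball_in_nhd[OF U(1,2)] by blast
  have "p (f v x) \<le> q x" if x: "x \<in> TS" and v: "v \<in> I" for x v
  proof (rule dense_ge)
    fix r assume r: "q x < r"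
    then have r0: "r > 0" using cseminormD(5)[OF q(1) x] by simp
    have "q (s (of_real (1 / r)) x) < 1" using r r0 by (simp add: cseminormD(2)[OF q(1) x] norm_divide)
    then have "s (of_real (1 / r)) x \<in> W" using q(2) U(3) TS_scale[OF x] by blast
    then have "p (f v (s (of_real (1 / r)) x)) \<le> 1" using v by (simp add: W_def)
    then show "p (f v x) \<le> r" using r0 by (simp only: sc[OF v x] norm_of_real) (simp add: divide_simps)
  qed
  then show ?thesis using q(1) by blast
qed

lemma continuous_family_bounded:
  assumes "continuous_map (top_of_set {a..b::real}) X g" "cseminorm s X p"
  shows "\<exists>B. \<forall>v\<in>{a..b}. p (g v) \<le> B"
proof -
  have gT: "g v \<in> TS" if "v \<in> {a..b}" for v using assms(1) that by (auto simp: continuous_map_def)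
  have "continuous_on {a..b} (\<lambda>v. p (g v))"
    unfolding continuous_on_iff
  proof (intro ballI allI impI)
    fix v and e :: real assume v: "v \<in> {a..b}" and e: "e > 0"
    have "openin (top_of_set {a..b}) {u \<in> topspace (top_of_set {a..b}). g u \<in> {z \<in> TS. p (z - g v) < e}}"
      by (rule openin_continuous_map_preimage[OF assms(1)]) (rule openin_seminorm_ball[OF assms(2) gT[OF v]])
    then obtain O' where O: "open O'" "{u \<in> {a..b}. g u \<in> {z \<in> TS. p (z - g v) < e}} = {a..b} \<inter> O'"
      by (auto simp: openin_open)
    have "v \<in> {u \<in> {a..b}. g u \<in> {z \<in> TS. p (z - g v) < e}}" using v e gT cseminormD(3)[OF assms(2)] by simp
    then have "v \<in> O'" using O(2) by blast
    then obtain d where d: "d > 0" "ball v d \<subseteq> O'" using O(1) by (meson open_contains_ball)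
    show "\<exists>d>0. \<forall>u\<in>{a..b}. dist u v < d \<longrightarrow> dist (p (g u)) (p (g v)) < e"
    proof (intro exI[of _ d] conjI ballI impI d(1))
      fix u assume u: "u \<in> {a..b}" "dist u v < d"
      then have "u \<in> O'" using d(2) by (auto simp: dist_commute)
      then have "p (g u - g v) < e" using O(2) u(1) by blast
      then show "dist (p (g u)) (p (g v)) < e"
        using cseminormD(7)[OF assms(2) gT[OF u(1)] gT[OF v]] cseminormD(7)[OF assms(2) gT[OF v] gT[OF u(1)]]
          cseminormD(8)[OF assms(2) gT[OF v] gT[OF u(1)]] by (simp add: dist_real_def)
    qed
  qed
  then have "bounded ((\<lambda>v. p (g v)) ` {a..b})" by (intro compact_imp_bounded compact_continuous_image compact_Icc)
  then show ?thesis unfolding bounded_iff by (force dest: abs_le_D1)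
qed

end


section \<open>Support and order of a pre-distribution semigroup\<close>

locale pre_cds = complex_lcs s X
  for s :: "complex \<Rightarrow> 'a::ab_group_add \<Rightarrow> 'a" and X :: "'a topology" +
  fixes C :: "'a \<Rightarrow> 'a" and G :: "(real \<Rightarrow> complex) \<Rightarrow> 'a \<Rightarrow> 'a"
  assumes barreled: "barreled s X" and hausdorff: "Hausdorff_space X" and complete: "seq_complete X"
    and C_op: "C \<in> end_ops s X" and cds: "pre_CDS s X C G"
begin

lemma G_lin: "G \<in> lin_ops (fscale (*)) test_space (fscale s) (op_space s X)"
  using cds by (simp add: pre_CDS_def distributions0_def distributions_def)

lemma G_op: "\<phi> \<in> test_functions \<Longrightarrow> G \<phi> \<in> end_ops s X"
  using G_lin topspace_op_space[OF TS_0, of s]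
  by (auto simp: lin_ops_def[of "fscale (*)" test_space] continuous_map_def topspace_test_space)

lemma G_add: "\<phi> \<in> test_functions \<Longrightarrow> \<psi> \<in> test_functions \<Longrightarrow> G (\<lambda>t. \<phi> t + \<psi> t) x = G \<phi> x + G \<psi> x"
  using G_lin by (auto simp: lin_ops_def[of "fscale (*)" test_space] topspace_test_space plus_fun_def)

lemma G_cmult: "\<phi> \<in> test_functions \<Longrightarrow> G (\<lambda>t. c * \<phi> t) x = s c (G \<phi> x)"
  using G_lin by (auto simp: lin_ops_def[of "fscale (*)" test_space] topspace_test_space fscale_def)

lemma G_diff:
  assumes "\<phi> \<in> test_functions" "\<psi> \<in> test_functions"
  shows "G (\<lambda>t. \<phi> t - \<psi> t) x = G \<phi> x - G \<psi> x"
  using G_add[OF assms(1), of "\<lambda>t. -1 * \<psi> t" x] G_cmult[OF assms(2), of "-1" x]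
    test_functions_on_cmult[of \<psi> UNIV "-1"] assms(2) by (simp add: test_functions_on_UNIV)

lemma G_zero: "G (\<lambda>t. 0) x = 0"
  using G_cmult[of "\<lambda>t. 0" 0 x] test_functionsI[of "\<lambda>t. 0" 0 0] smooth_const[of 0]
  by (simp add: test_functions_on_def)

lemma G_T: "\<phi> \<in> test_functions \<Longrightarrow> x \<in> TS \<Longrightarrow> G \<phi> x \<in> TS"
  using end_opsD(1)[OF G_op] by blast

lemma G_conv: "\<phi> \<in> test_functions \<Longrightarrow> \<psi> \<in> test_functions \<Longrightarrow> G (conv0 \<phi> \<psi>) (C x) = G \<phi> (G \<psi> x)"
  using cds unfolding pre_CDS_def by (metis comp_apply)

lemma G_C: "\<phi> \<in> test_functions \<Longrightarrow> C (G \<phi> x) = G \<phi> (C x)"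
  using cds unfolding pre_CDS_def by (metis comp_apply)

text \<open>
  By definition of the support, \<open>G\<close> vanishes only on test functions supported in one of the open sets of a
  cover. The cover is reached by a partition of unity, which in one dimension is a telescoping sum:
  \<open>st i - st (i + 1)\<close> lives on an interval whose length is half a Lebesgue number of the cover.
\<close>

lemma G_negative_support:
  assumes "\<phi> \<in> test_functions_on {a..b}" "b < 0"
  shows "G \<phi> x = 0"
proof -
  let ?K = "fsupp \<phi>"
  define \<U> where "\<U> = {U. open U \<and> (\<forall>\<phi>\<in>test_functions_on U. G \<phi> = 0)}"
  have sm: "smooth \<phi>" and K: "compact ?K" "?K \<subseteq> {a..b}"
    using assms(1) by (auto simp: test_functions_on_def test_functions_iff)
  have "dsupp G \<subseteq> {0..}" using cds by (simp add: pre_CDS_def distributions0_def)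
  then have "{..<0} \<subseteq> \<Union>\<U>" unfolding dsupp_def \<U>_def[symmetric] by auto
  then have "?K \<subseteq> \<Union>\<U>" using K(2) assms(2) by (meson atLeastAtMost_iff lessThan_iff order_le_less_trans subset_iff)
  moreover have "\<And>B. B \<in> \<U> \<Longrightarrow> open B" by (simp add: \<U>_def)
  ultimately obtain e where e: "e > 0" "\<forall>x\<in>?K. \<exists>B\<in>\<U>. ball x e \<subseteq> B"
    using Heine_Borel_lemma[OF K(1)] by metis
  define d where "d = e / 4"
  have d: "d > 0" using e by (simp add: d_def)
  \<comment> \<open>rises from \<open>0\<close> to \<open>1\<close> between \<open>a + (i - 1) d\<close> and \<open>a + i d\<close>\<close>
  define st where "st i v = smooth_step ((1 / d) * v + (1 - real i - a / d))" for i v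
  have sst: "smooth (st i)" for i unfolding st_def[abs_def] by (rule smooth_affine[OF smooth_smooth_step])
  have st1: "st i v = 1" if "a + real i * d \<le> v" for i v
    unfolding st_def using that d by (intro smooth_step_1) (simp add: field_simps)
  have st0: "st i v = 0" if "v \<le> a + (real i - 1) * d" for i v
    unfolding st_def using that d by (intro smooth_step_0) (simp add: field_simps)
  have T: "(\<lambda>v. st i v * \<phi> v) \<in> test_functions" for i
    using test_functions_on_mult[OF assms(1) sst] test_functions_on_test by blast
  have piece: "G (\<lambda>v. st i v * \<phi> v) x = G (\<lambda>v. st (Suc i) v * \<phi> v) x" for i
  proof -
    let ?\<psi> = "\<lambda>v. st i v * \<phi> v - st (Suc i) v * \<phi> v"
    have \<psi>: "?\<psi> \<in> test_functions"
      using test_functions_on_diff[of _ UNIV] T by (simp add: test_functions_on_UNIV)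
    have sub: "fsupp ?\<psi> \<subseteq> ?K \<inter> {a + (real i - 1) * d..a + (real i + 1) * d}"
    proof (rule fsupp_subset)
      show "closed (?K \<inter> {a + (real i - 1) * d..a + (real i + 1) * d})" by (intro closed_Int closed_fsupp closed_atLeastAtMost)
      fix t assume t: "t \<notin> ?K \<inter> {a + (real i - 1) * d..a + (real i + 1) * d}"
      consider "t \<notin> ?K" | "t < a + (real i - 1) * d" | "t > a + (real i + 1) * d" using t by force
      then show "?\<psi> t = 0"
      proof cases
        case 1 then show ?thesis by (simp add: not_in_fsupp)
      next
        case 2
        have "(real i - 1) * d \<le> real i * d" using d by simp
        then show ?thesis using 2 st0[of t i] st0[of t "Suc i"] by simp
      next
        case 3
        have "real i * d \<le> (real i + 1) * d" using d by simp
        then show ?thesis using 3 st1[of i t] st1[of "Suc i" t] by (simp add: add.commute)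
      qed
    qed
    have "G ?\<psi> x = 0"
    proof (cases "fsupp ?\<psi> = {}")
      case True
      then have "?\<psi> = (\<lambda>v. 0)" using not_in_fsupp[of _ ?\<psi>] by (intro ext) simp
      then show ?thesis using G_zero by simp
    next
      case False
      then obtain y where y: "y \<in> fsupp ?\<psi>" by blast
      then obtain B where B: "B \<in> \<U>" "ball y e \<subseteq> B" using e(2) sub by blast
      have "fsupp ?\<psi> \<subseteq> ball y e"
      proof
        fix z assume z: "z \<in> fsupp ?\<psi>"
        have "y \<in> {a + (real i - 1) * d..a + (real i + 1) * d}" "z \<in> {a + (real i - 1) * d..a + (real i + 1) * d}"
          using subsetD[OF sub y] subsetD[OF sub z] by blast+
        then have "\<bar>y - z\<bar> \<le> (real i + 1) * d - (real i - 1) * d" unfolding atLeastAtMost_iff by linarith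
        also have "\<dots> = 2 * d" by (simp add: algebra_simps)
        also have "\<dots> = e / 2" by (simp add: d_def)
        finally show "z \<in> ball y e" using e(1) by (simp add: dist_real_def)
      qed
      then have "?\<psi> \<in> test_functions_on B" using \<psi> B(2) by (auto simp: test_functions_on_def)
      then show ?thesis using B(1) by (simp add: \<U>_def)
    qed
    then show ?thesis using G_diff[OF T T, of i "Suc i" x] by simp
  qed
  have eq: "G (\<lambda>v. st 0 v * \<phi> v) x = G (\<lambda>v. st i v * \<phi> v) x" for i
    by (induction i) (simp_all add: piece[symmetric])
  obtain n where n: "(b - a) / d \<le> real n" using real_arch_simple by blast
  have "(\<lambda>v. st 0 v * \<phi> v) = \<phi>"
    using st1[of 0] test_function_zero[OF assms(1)] by (force intro!: ext)
  moreover have "(\<lambda>v. st (Suc n) v * \<phi> v) = (\<lambda>v. 0)"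
  proof
    fix v
    have "b \<le> a + real n * d" using n d by (simp add: pos_divide_le_eq)
    then show "st (Suc n) v * \<phi> v = 0"
      using st0[of v "Suc n"] test_function_zero[OF assms(1), of v] by (cases "v \<in> {a..b}") auto
  qed
  ultimately show ?thesis using eq[of "Suc n"] G_zero by simp
qed

lemma G_local:
  assumes "\<phi> \<in> test_functions" "\<psi> \<in> test_functions" "d > 0" "\<And>v. - d \<le> v \<Longrightarrow> \<phi> v = \<psi> v"
  shows "G \<phi> x = G \<psi> x"
proof -
  let ?f = "\<lambda>v. \<phi> v - \<psi> v"
  have f: "?f \<in> test_functions_on UNIV"
    using assms by (intro test_functions_on_diff) (simp_all add: test_functions_on_UNIV)
  have "bounded (fsupp ?f)" using f by (simp add: test_functions_on_def test_functions_iff compact_imp_bounded)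
  then obtain B where B: "\<forall>v\<in>fsupp ?f. \<bar>v\<bar> \<le> B" unfolding bounded_iff by auto
  have "?f \<in> test_functions_on {-B..-d}"
  proof (rule test_functionsI)
    show "smooth ?f" by (rule test_functions_smooth[OF f])
    fix t assume t: "t \<notin> {-B..-d}"
    then show "?f t = 0" using assms(4)[of t] not_in_fsupp[of t ?f] B by (cases "t \<in> fsupp ?f") (auto simp: abs_le_iff)
  qed
  then have "G ?f x = 0" using assms(3) by (intro G_negative_support) auto
  then show ?thesis using G_diff[OF assms(1,2)] by simp
qed

text \<open>
  The Riemann sums of the representing integral satisfy the bound by equicontinuity of the representing
  function on the compact interval, and the bound passes to the limit.
\<close>

lemma order_estimate_full:
  assumes "M > 0" "finite_order_on (fscale s) (op_space s X) M G"
  shows "\<exists>k. \<forall>p. cseminorm s X p \<longrightarrow> (\<exists>q. cseminorm s X q \<and>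
    (\<forall>x\<in>TS. \<forall>\<phi>\<in>test_functions_on {-M<..<M}. \<forall>c. (\<forall>v\<in>{-M..M}. cmod (nderiv k \<phi> v) \<le> c) \<longrightarrow> p (G \<phi> x) \<le> c * q x))"
proof -
  obtain k f where f: "continuous_map (top_of_set {-M..M}) (op_space s X) f"
    and I: "\<forall>\<phi>\<in>test_functions_on {-M<..<M}. \<exists>I. has_lcs_integral (fscale s) (op_space s X)
        (\<lambda>t. fscale s (nderiv k \<phi> t) (f t)) (-M) M I \<and> G \<phi> = fscale s ((-1) ^ k) I"
    using assms(2) unfolding finite_order_on_def by blast
  have fop: "f v \<in> end_ops s X" if "v \<in> {-M..M}" for v
    using f that topspace_op_space[OF TS_0, of s] by (auto simp: continuous_map_def)
  have fx: "continuous_map (top_of_set {-M..M}) X (\<lambda>v. f v x)" if "x \<in> TS" for x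
    using continuous_map_compose[OF f continuous_eval[OF that]] by (simp add: o_def)
  show ?thesis
  proof (intro exI[of _ k] allI impI)
    fix p assume p: "cseminorm s X p"
    obtain q where q: "cseminorm s X q" "\<forall>x\<in>TS. \<forall>v\<in>{-M..M}. p (f v x) \<le> q x"
      using barreled_equicontinuous[OF barreled p, of "{-M..M}" f] fop continuous_family_bounded[OF fx p] by blast
    have "p (G \<phi> x) \<le> c * (2 * M * q x)"
      if x: "x \<in> TS" and \<phi>: "\<phi> \<in> test_functions_on {-M<..<M}" and c: "\<forall>v\<in>{-M..M}. cmod (nderiv k \<phi> v) \<le> c" for x \<phi> c
    proof -
      obtain J where J: "has_lcs_integral (fscale s) (op_space s X) (\<lambda>t. fscale s (nderiv k \<phi> t) (f t)) (-M) M J"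
        "G \<phi> = fscale s ((-1) ^ k) J" using I \<phi> by blast
      let ?S = "\<lambda>P. \<Sum>(t, K)\<in>P. s (of_real (measure lborel K)) (s (nderiv k \<phi> t) (f t x))"
      have "limitin X ((\<lambda>F. F x) \<circ> (\<lambda>P. \<Sum>(t, K)\<in>P. fscale s (of_real (measure lborel K)) (fscale s (nderiv k \<phi> t) (f t)))) (J x) (division_filter {-M..M})"
        by (rule continuous_map_limit[OF continuous_eval[OF x] J(1)[unfolded has_lcs_integral_def]])
      then have L: "limitin X ?S (J x) (division_filter {-M..M})"
        by (simp add: o_def sum_fun_eval split_beta fscale_def)
      have "p (J x) \<le> c * (2 * M * q x)"
      proof (rule limitin_seminorm_le[OF L _ p])
        show "division_filter {-M..M} \<noteq> bot"
          using division_filter_not_empty[of "-M" M] by simp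
        have "eventually (\<lambda>P. P tagged_division_of {-M..M}) (division_filter {-M..M})"
          using eventually_division_filter_tagged_division[of "{-M..M}"] by simp
        then show "eventually (\<lambda>P. p (?S P) \<le> c * (2 * M * q x)) (division_filter {-M..M})"
        proof eventually_elim
          fix P assume P: "P tagged_division_of {-M..M}"
          have fin: "finite P" using P by auto
          have tag: "t \<in> {-M..M}" if "(t, K) \<in> P" for t K using tagged_division_ofD(2,3)[OF P that] by blast
          have mem: "s (of_real (measure lborel K)) (s (nderiv k \<phi> t) (f t x)) \<in> TS" if "(t, K) \<in> P" for t K
            using end_opsD(1)[OF fop[OF tag[OF that]] x] by (intro TS_scale)
          have "p (?S P) \<le> (\<Sum>i\<in>P. p (case i of (t, K) \<Rightarrow> s (of_real (measure lborel K)) (s (nderiv k \<phi> t) (f t x))))"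
            by (rule cseminorm_sum[OF p fin]) (use mem in auto)
          also have "\<dots> \<le> (\<Sum>(t, K)\<in>P. measure lborel K * (c * q x))"
          proof (rule sum_mono, clarify)
            fix t K assume tK: "(t, K) \<in> P"
            have fT: "f t x \<in> TS" by (rule end_opsD(1)[OF fop[OF tag[OF tK]] x])
            have "p (s (of_real (measure lborel K)) (s (nderiv k \<phi> t) (f t x))) = measure lborel K * (cmod (nderiv k \<phi> t) * p (f t x))"
              by (simp add: cseminormD(2)[OF p] fT TS_scale norm_mult)
            also have "\<dots> \<le> measure lborel K * (c * q x)"
              using c q(2) tag[OF tK] x cseminormD(5)[OF p fT] by (intro mult_left_mono mult_mono') auto
            finally show "p (s (of_real (measure lborel K)) (s (nderiv k \<phi> t) (f t x))) \<le> measure lborel K * (c * q x)" .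
          qed
          also have "\<dots> = (\<Sum>(t, K)\<in>P. measure lborel K) * (c * q x)"
            by (simp add: sum_distrib_right split_beta)
          also have "(\<Sum>(t, K)\<in>P. measure lborel K) = 2 * M"
            using additive_content_tagged_division[of P "-M" M] P assms(1) by simp
          finally show "p (?S P) \<le> c * (2 * M * q x)" by (simp add: mult_ac)
        qed
      qed
      moreover have "J x \<in> TS" using L by (rule limitin_topspace)
      ultimately show ?thesis using J(2) by (simp add: fscale_def cseminormD(2)[OF p] norm_power)
    qed
    then show "\<exists>q. cseminorm s X q \<and>
      (\<forall>x\<in>TS. \<forall>\<phi>\<in>test_functions_on {-M<..<M}. \<forall>c. (\<forall>v\<in>{-M..M}. cmod (nderiv k \<phi> v) \<le> c) \<longrightarrow> p (G \<phi> x) \<le> c * q x)"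
      using cseminorm_scale[OF q(1), of "2 * M"] assms(1) by (intro exI[of _ "\<lambda>x. 2 * M * q x"]) simp
  qed
qed

text \<open>
  Only the values on \<open>[0, M]\<close> matter. By continuity the bound on \<open>\<phi>\<^sup>(\<^sup>k\<^sup>)\<close> holds, up to \<open>e\<close>, on some \<open>[-d, M]\<close>.
  Cut \<open>\<phi>\<^sup>(\<^sup>k\<^sup>)\<close> off between \<open>-d\<close> and \<open>-d/2\<close> and integrate \<open>k\<close> times: the result agrees with \<open>\<phi>\<close> on
  \<open>[-d/2, \<infinity>)\<close>, hence gives the same value of \<open>G\<close>, and its \<open>k\<close>-th derivative is small everywhere, even after
  multiplication with the fixed factor \<open>cut\<close>. The steepness of the first cutoff, which grows as \<open>d\<close> shrinks,
  does not enter, since the bound of \<open>nderiv_mult_prim_bound\<close> involves no derivative of the integrated function.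
\<close>

lemma order_estimate:
  assumes M: "M > 1" and E: "\<forall>p. cseminorm s X p \<longrightarrow> (\<exists>q. cseminorm s X q \<and>
    (\<forall>x\<in>TS. \<forall>\<phi>\<in>test_functions_on {-M<..<M}. \<forall>c. (\<forall>v\<in>{-M..M}. cmod (nderiv k \<phi> v) \<le> c) \<longrightarrow> p (G \<phi> x) \<le> c * q x))"
    and p: "cseminorm s X p"
  shows "\<exists>q. cseminorm s X q \<and>
    (\<forall>x\<in>TS. \<forall>\<phi>\<in>test_functions_on {-M<..<M}. \<forall>c. (\<forall>v\<in>{0..M}. cmod (nderiv k \<phi> v) \<le> c) \<longrightarrow> p (G \<phi> x) \<le> c * q x)"
proof -
  obtain q where q: "cseminorm s X q" "\<forall>x\<in>TS. \<forall>\<phi>\<in>test_functions_on {-M<..<M}. \<forall>c.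
      (\<forall>v\<in>{-M..M}. cmod (nderiv k \<phi> v) \<le> c) \<longrightarrow> p (G \<phi> x) \<le> c * q x"
    using E[rule_format, OF p] by blast
  have "M \<ge> 0" using M by simp
  then obtain a where a: "a \<ge> 0" "\<forall>y B. smooth y \<longrightarrow> (\<forall>v\<in>{-M..M}. cmod (y v) \<le> B) \<longrightarrow>
      (\<forall>v\<in>{-M..M}. cmod (nderiv k (\<lambda>v. cut v * (prim M ^^ k) y v) v) \<le> a * B)"
    using nderiv_mult_prim_bound[OF smooth_cut, of M k] by blast
  have main: "p (G \<phi> x) \<le> (a * (c + e)) * q x"
    if x: "x \<in> TS" and \<phi>: "\<phi> \<in> test_functions_on {-M<..<M}" and c: "\<forall>v\<in>{0..M}. cmod (nderiv k \<phi> v) \<le> c" and e: "e > 0" for x \<phi> c e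
  proof -
    have sm: "smooth \<phi>" by (rule test_functions_smooth[OF \<phi>])
    have c0: "c \<ge> 0" by (rule order_trans[OF norm_ge_zero c[rule_format, of 0]]) (use M in simp)
    obtain b b' where b: "-M < b'" "b < M" "\<phi> \<in> test_functions_on {b'..b}"
      using test_functions_on_bounds[OF \<phi>] M by (metis neg_less_iff_less less_trans neg_less_0_iff_less zero_less_one)
    have "isCont (nderiv k \<phi>) 0"
      using smooth_nderiv_continuous[OF sm, of UNIV k] by (simp add: continuous_on_eq_continuous_at)
    then obtain d0 where d0: "d0 > 0" "\<And>v. \<bar>v\<bar> < d0 \<Longrightarrow> cmod (nderiv k \<phi> v - nderiv k \<phi> 0) < e"
      using e unfolding continuous_at_eps_delta dist_norm by (metis diff_zero real_norm_def)
    define d where "d = min d0 1 / 2"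
    have d: "0 < d" "d < d0" "d \<le> 1/2" using d0(1) by (auto simp: d_def)
    \<comment> \<open>equal to \<open>0\<close> left of \<open>-d\<close> and to \<open>1\<close> right of \<open>-d/2\<close>\<close>
    define st where "st v = smooth_step ((2 / d) * v + 2)" for v
    have sst: "smooth st" unfolding st_def[abs_def] by (rule smooth_affine[OF smooth_smooth_step])
    have st1: "st v = 1" if "- d / 2 \<le> v" for v
      unfolding st_def using that d by (intro smooth_step_1) (simp add: field_simps)
    have st0: "st v = 0" if "v \<le> - d" for v
      unfolding st_def using that d by (intro smooth_step_0) (simp add: field_simps)
    have stn: "cmod (st v) \<le> 1" for v unfolding st_def by (rule norm_smooth_step)
    define z where "z v = (-1) ^ k * nderiv k \<phi> v" for v
    define y where "y v = st v * z v" for v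
    have sz: "smooth z" unfolding z_def[abs_def] by (intro smooth_mult smooth_const smooth_nderiv sm)
    have sy: "smooth y" unfolding y_def[abs_def] by (intro smooth_mult sst sz)
    have yb: "cmod (y v) \<le> c + e" if v: "v \<in> {-M..M}" for v
    proof (cases "v \<le> - d")
      case True
      then show ?thesis using c0 e by (simp add: y_def st0)
    next
      case False
      have "cmod (nderiv k \<phi> v) \<le> c + e"
      proof (cases "v \<ge> 0")
        case True then show ?thesis using c[rule_format, of v] v e by auto
      next
        case False
        then have "cmod (nderiv k \<phi> v - nderiv k \<phi> 0) < e" using \<open>\<not> v \<le> - d\<close> d by (intro d0(2)) auto
        moreover have "cmod (nderiv k \<phi> 0) \<le> c" using c M by simp
        ultimately show ?thesis using norm_triangle_sub[of "nderiv k \<phi> v" "nderiv k \<phi> 0"] by linarith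
      qed
      then have "cmod (st v) * cmod (z v) \<le> 1 * (c + e)"
        using stn[of v] by (intro mult_mono) (auto simp: z_def norm_mult norm_power)
      then show ?thesis by (simp add: y_def norm_mult)
    qed
    let ?\<psi> = "\<lambda>v. cut v * (prim M ^^ k) y v"
    have y0: "y v = 0" if "b < v" for v
      using that nderiv_zero_outside[OF b(3), of v k] by (simp add: y_def z_def)
    have "(prim M ^^ k) y v = 0" if "b < v" for v
    proof -
      have z: "(prim M ^^ k) y v = 0" if "b < v'" "v' \<le> M" "v' \<le> v" for v'
        by (rule prim_pow_zero_above[OF smooth_continuous[OF sy], of v']) (use y0 that in auto)
      show ?thesis using that b(2) z[of v] z[of M] by (cases "v \<le> M") auto
    qed
    then have "?\<psi> \<in> test_functions_on {-1..b}" by (intro cut_test smooth_prim_pow sy)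
    then have \<psi>: "?\<psi> \<in> test_functions_on {-M<..<M}"
      by (rule test_functions_on_mono) (use M b in auto)
    have "?\<psi> v = \<phi> v" if v: "- (d / 2) \<le> v" for v
    proof -
      have "(prim M ^^ k) y v = (prim M ^^ k) z v"
        using st1 v d M by (intro prim_pow_cong[of _ _ "- (d/2)"] smooth_continuous sy sz) (auto simp: y_def)
      also have "(prim M ^^ k) z = \<phi>" unfolding z_def[abs_def]
      proof (rule prim_pow_nderiv[OF sm, of "(b + M) / 2"])
        show "\<phi> v = 0" if "(b + M) / 2 \<le> v" for v
          using that b(2) by (intro test_function_zero[OF b(3)]) auto
      qed (use b in auto)
      finally show ?thesis using v d by (simp add: cut_1)
    qed
    then have "G \<phi> x = G ?\<psi> x"
      using d by (intro G_local[of _ _ "d / 2"] test_functions_on_test[OF \<phi>] test_functions_on_test[OF \<psi>]) auto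
    also have "p (G ?\<psi> x) \<le> (a * (c + e)) * q x"
      by (rule q(2)[rule_format, OF x \<psi>]) (use a(2)[rule_format, OF sy] yb in blast)
    finally show ?thesis .
  qed
  have "p (G \<phi> x) \<le> c * (a * q x)"
    if x: "x \<in> TS" and \<phi>: "\<phi> \<in> test_functions_on {-M<..<M}" and c: "\<forall>v\<in>{0..M}. cmod (nderiv k \<phi> v) \<le> c" for x \<phi> c
  proof (rule field_le_epsilon)
    fix e :: real assume e: "e > 0"
    have qx: "q x \<ge> 0" by (rule cseminormD(5)[OF q(1) x])
    define r where "r = a * q x + 1"
    have r: "r > 0" using a(1) qx by (simp add: r_def add_nonneg_pos)
    have "p (G \<phi> x) \<le> (a * (c + e / r)) * q x" using main[OF x \<phi> c, of "e / r"] e r by simp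
    also have "\<dots> = c * (a * q x) + (e / r) * (a * q x)" by (simp add: algebra_simps)
    also have "(e / r) * (a * q x) \<le> (e / r) * r" using e r by (intro mult_left_mono) (auto simp: r_def)
    also have "(e / r) * r = e" using r by simp
    finally show "p (G \<phi> x) \<le> c * (a * q x) + e" by simp
  qed
  then show ?thesis using cseminorm_scale[OF q(1) a(1)] by blast
qed

end


section \<open>Extending the distribution by continuity\<close>

instance bcontfun :: (metric_space, banach) banach ..

text \<open>
  The Riemann sums converge in the Banach space of bounded continuous functions, to which the integration
  theory of continuous Banach-space-valued functions applies. Clamping the argument to \<open>[c, d]\<close> turns functions on
  the interval into bounded functions on the line with the same supremum.
\<close>

lemma uniform_riemann_sums:
  fixes Y :: "real \<Rightarrow> real \<Rightarrow> complex"
  assumes Y: "continuous_on ({a..b} \<times> {c..d}) (\<lambda>(r, v). Y r v)" and "c \<le> d" and e: "e > 0"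
  shows "eventually (\<lambda>P. \<forall>v\<in>{c..d}. cmod ((\<Sum>(r, K)\<in>P. of_real (measure lborel K) * Y r v)
    - integral {a..b} (\<lambda>r. Y r v)) < e) (division_filter {a..b})"
proof -
  define cl where "cl v = max c (min d v)" for v :: real
  have cl: "cl v \<in> {c..d}" for v using assms(2) by (auto simp: cl_def)
  have cl_id: "cl v = v" if "v \<in> {c..d}" for v using that by (auto simp: cl_def)
  have ccl: "continuous_on UNIV cl" unfolding cl_def[abs_def] by (intro continuous_intros)
  define g where "g r = Bcontfun (\<lambda>v. Y r (cl v))" for r
  have g: "apply_bcontfun (g r) v = Y r (cl v)" if r: "r \<in> {a..b}" for r v
  proof -
    have Yr: "continuous_on {c..d} (Y r)"
    proof -
      have "continuous_on {c..d} (\<lambda>v. (r, v))" by (intro continuous_on_Pair continuous_on_const continuous_on_id)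
      moreover have "(\<lambda>v. (r, v)) ` {c..d} \<subseteq> {a..b} \<times> {c..d}" using r by auto
      ultimately have "continuous_on {c..d} (\<lambda>v. case (r, v) of (r, v) \<Rightarrow> Y r v)" by (rule continuous_on_compose2[OF Y])
      then show ?thesis by simp
    qed
    have "continuous_on UNIV (\<lambda>v. Y r (cl v))"
      by (rule continuous_on_compose2[OF Yr ccl]) (use cl in auto)
    moreover have "bounded (range (\<lambda>v. Y r (cl v)))"
      by (rule bounded_subset[OF compact_imp_bounded[OF compact_continuous_image[OF Yr compact_Icc]]]) (use cl in auto)
    ultimately have "(\<lambda>v. Y r (cl v)) \<in> bcontfun" by (simp add: bcontfun_def)
    then show ?thesis by (simp add: g_def Bcontfun_inverse)
  qed
  have gc: "continuous_on {a..b} g"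
    unfolding continuous_on_iff
  proof (intro ballI allI impI)
    fix r and e :: real assume r: "r \<in> {a..b}" and e: "e > 0"
    have "uniformly_continuous_on ({a..b} \<times> {c..d}) (\<lambda>(r, v). Y r v)"
      by (rule compact_uniformly_continuous[OF Y]) (intro compact_Times compact_Icc)
    moreover have "e / 2 > 0" using e by simp
    ultimately obtain h where h: "h > 0" "\<forall>x\<in>{a..b} \<times> {c..d}. \<forall>x'\<in>{a..b} \<times> {c..d}. dist x' x < h \<longrightarrow> dist (case x' of (r, v) \<Rightarrow> Y r v) (case x of (r, v) \<Rightarrow> Y r v) < e / 2"
      unfolding uniformly_continuous_on_def by blast
    show "\<exists>h>0. \<forall>r'\<in>{a..b}. dist r' r < h \<longrightarrow> dist (g r') (g r) < e"
    proof (intro exI[of _ h] conjI h(1) ballI impI)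
      fix r' assume r': "r' \<in> {a..b}" "dist r' r < h"
      have "dist (g r') (g r) \<le> e / 2"
      proof (rule dist_bound)
        fix v
        have "dist (r', cl v) (r, cl v) < h" using r' by (simp add: dist_Pair_Pair)
        then show "dist (apply_bcontfun (g r') v) (apply_bcontfun (g r) v) \<le> e / 2"
          using h(2)[rule_format, of "(r, cl v)" "(r', cl v)"] r r' cl g by (simp add: less_imp_le)
      qed
      then show "dist (g r') (g r) < e" using e by simp
    qed
  qed
  have gI: "(g has_integral integral {a..b} g) (cbox a b)"
    using integrable_integral[OF integrable_continuous_real[OF gc]] by simp
  have bl: "bounded_linear (\<lambda>f. apply_bcontfun f v)" for v :: real
    by (rule bounded_linear_intro[of _ 1]) (auto intro: norm_bounded)
  have Iv: "apply_bcontfun (integral {a..b} g) v = integral {a..b} (\<lambda>r. Y r v)" if v: "v \<in> {c..d}" for v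
  proof -
    have "((\<lambda>r. apply_bcontfun (g r) v) has_integral apply_bcontfun (integral {a..b} g) v) {a..b}"
      using has_integral_linear[OF gI bl[of v]] by (simp add: o_def)
    then have "((\<lambda>r. Y r v) has_integral apply_bcontfun (integral {a..b} g) v) {a..b}"
      by (rule has_integral_eq[rotated]) (simp add: g cl_id[OF v])
    then show ?thesis by (simp add: integral_unique)
  qed
  have "eventually (\<lambda>P. norm ((\<Sum>(r, K)\<in>P. measure lborel K *\<^sub>R g r) - integral {a..b} g) < e) (division_filter {a..b})"
    using gI e unfolding has_integral_cbox tendsto_iff dist_norm by simp
  moreover have "eventually (\<lambda>P. P tagged_division_of {a..b}) (division_filter {a..b})"
    using eventually_division_filter_tagged_division[of "{a..b}"] by simp
  ultimately show ?thesis
  proof eventually_elim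
    fix P assume n: "norm ((\<Sum>(r, K)\<in>P. measure lborel K *\<^sub>R g r) - integral {a..b} g) < e" and P: "P tagged_division_of {a..b}"
    show "\<forall>v\<in>{c..d}. cmod ((\<Sum>(r, K)\<in>P. of_real (measure lborel K) * Y r v) - integral {a..b} (\<lambda>r. Y r v)) < e"
    proof
      fix v assume v: "v \<in> {c..d}"
      have "apply_bcontfun ((\<Sum>(r, K)\<in>P. measure lborel K *\<^sub>R g r) - integral {a..b} g) v
        = (\<Sum>(r, K)\<in>P. measure lborel K *\<^sub>R apply_bcontfun (g r) v) - apply_bcontfun (integral {a..b} g) v"
        using linear_sum[OF bounded_linear.linear[OF bl[of v]], of "\<lambda>(r, K). measure lborel K *\<^sub>R g r" P]
        by (simp add: split_beta)
      also have "(\<Sum>(r, K)\<in>P. measure lborel K *\<^sub>R apply_bcontfun (g r) v) = (\<Sum>(r, K)\<in>P. of_real (measure lborel K) * Y r v)"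
      proof (rule sum.cong[OF refl], clarify)
        fix r K assume "(r, K) \<in> P"
        then have "r \<in> {a..b}" using tagged_division_ofD(2,3)[OF P] by blast
        then show "measure lborel K *\<^sub>R apply_bcontfun (g r) v = of_real (measure lborel K) * Y r v"
          using v by (simp add: g cl_id scaleR_conv_of_real)
      qed
      finally have "cmod ((\<Sum>(r, K)\<in>P. of_real (measure lborel K) * Y r v) - integral {a..b} (\<lambda>r. Y r v))
        = cmod (apply_bcontfun ((\<Sum>(r, K)\<in>P. measure lborel K *\<^sub>R g r) - integral {a..b} g) v)"
        using Iv[OF v] by simp
      also have "\<dots> \<le> norm ((\<Sum>(r, K)\<in>P. measure lborel K *\<^sub>R g r) - integral {a..b} g)"
        by (rule norm_bounded)
      finally show "cmod ((\<Sum>(r, K)\<in>P. of_real (measure lborel K) * Y r v) - integral {a..b} (\<lambda>r. Y r v)) < e"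
        using n by simp
    qed
  qed
qed

context complex_lcs
begin

lemma limitin_unique:
  "Hausdorff_space X \<Longrightarrow> limitin X f l F \<Longrightarrow> limitin X f l' F \<Longrightarrow> F \<noteq> bot \<Longrightarrow> l = l'"
  using limitin_Hausdorff_unique by metis

lemma limitin_plus:
  assumes "limitin X f l F" "limitin X g l' F"
  shows "limitin X (\<lambda>i. f i + g i) (l + l') F"
proof -
  have "limitin (prod_topology X X) (\<lambda>i. (f i, g i)) (l, l') F"
    using assms by (simp add: limitin_pairwise o_def)
  from continuous_map_limit[OF continuous_add this] show ?thesis by (simp add: o_def)
qed

lemma limitin_op: "f \<in> end_ops s X \<Longrightarrow> limitin X g l F \<Longrightarrow> limitin X (\<lambda>i. f (g i)) (f l) F"
  using continuous_map_limit[of X X f g l F] by (simp add: lin_ops_def o_def)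

lemma scale_op: "(\<lambda>x. if x \<in> TS then s c x else 0) \<in> end_ops s X"
proof -
  have "continuous_map X X (\<lambda>x. s c x)"
    using continuous_map_compose[OF _ continuous_scale, of X "\<lambda>z. (c, z)"]
    by (auto simp: o_def continuous_map_pairwise)
  then have "continuous_map X X (\<lambda>x. if x \<in> TS then s c x else 0)"
    by (rule continuous_map_eq) simp
  then show ?thesis by (auto simp: lin_ops_def TS_add TS_scale scale_right_distrib mult.commute)
qed

lemma limitin_scale:
  assumes "limitin X f l F"
  shows "limitin X (\<lambda>i. s c (f i)) (s c l) F"
proof -
  have "l \<in> TS" "eventually (\<lambda>i. f i \<in> TS) F" using assms by (simp_all add: limitin_seminorm)
  with limitin_op[OF scale_op[of c] assms] show ?thesis
    by (auto elim!: limitin_transform_eventually[rotated] elim: eventually_mono)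
qed

end

text \<open>
  The margin \<open>3\<close> between \<open>\<tau>\<close> and \<open>M\<close> leaves room for the supports of the approximants, which lie in \<open>[-1, \<tau> + 1]\<close>,
  and of convolutions of two of them with \<open>t + u < \<tau>\<close>, which lie in \<open>[-2, \<tau> + 2]\<close>.
\<close>

locale finite_order_cds = pre_cds s X C G
  for s :: "complex \<Rightarrow> 'a::ab_group_add \<Rightarrow> 'a" and X :: "'a topology"
    and C :: "'a \<Rightarrow> 'a" and G :: "(real \<Rightarrow> complex) \<Rightarrow> 'a \<Rightarrow> 'a" +
  fixes \<tau> M :: real and k :: nat
  assumes tau: "\<tau> > 0" and M_def: "M = \<tau> + 3"
    and est: "\<And>p. cseminorm s X p \<Longrightarrow> \<exists>q. cseminorm s X q \<and> (\<forall>x\<in>TS. \<forall>\<phi>\<in>test_functions_on {-M<..<M}.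
        \<forall>c. (\<forall>v\<in>{0..M}. cmod (nderiv k \<phi> v) \<le> c) \<longrightarrow> p (G \<phi> x) \<le> c * q x)"
begin

abbreviation "DM \<equiv> test_functions_on {-M<..<M}"

text \<open>
  The closure of the graph of \<open>(-1)\<^sup>k \<phi>\<^sup>(\<^sup>k\<^sup>) \<mapsto> G \<phi> x\<close> with respect to uniform convergence on \<open>[0, M]\<close>. Working with
  the relation instead of the extended operator avoids naming the closed subspace on which the latter is defined.
\<close>

definition rep :: "'a \<Rightarrow> (real \<Rightarrow> complex) \<Rightarrow> 'a \<Rightarrow> bool" where
  "rep x y l \<longleftrightarrow> l \<in> TS \<and> (\<forall>p e. cseminorm s X p \<longrightarrow> e > 0 \<longrightarrow>
     (\<exists>\<phi>\<in>DM. (\<forall>v\<in>{0..M}. cmod (y v - (-1) ^ k * nderiv k \<phi> v) < e) \<and> p (G \<phi> x - l) < e))"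

lemma repT: "rep x y l \<Longrightarrow> l \<in> TS" by (simp add: rep_def)

lemma rep_limit:
  assumes "l \<in> TS" "x \<in> TS" and "\<And>p e. cseminorm s X p \<Longrightarrow> e > 0 \<Longrightarrow>
    \<exists>y' l'. rep x y' l' \<and> (\<forall>v\<in>{0..M}. cmod (y v - y' v) < e) \<and> p (l' - l) < e"
  shows "rep x y l"
  unfolding rep_def
proof (intro conjI allI impI assms(1))
  fix p and e :: real assume p: "cseminorm s X p" and "e > 0"
  then have e: "e / 2 > 0" by simp
  obtain y' l' where y': "rep x y' l'" "\<forall>v\<in>{0..M}. cmod (y v - y' v) < e / 2" "p (l' - l) < e / 2"
    using assms(3)[OF p e] by blast
  obtain \<phi> where \<phi>: "\<phi> \<in> DM" "\<forall>v\<in>{0..M}. cmod (y' v - (-1) ^ k * nderiv k \<phi> v) < e / 2" "p (G \<phi> x - l') < e / 2"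
    using y'(1) p e unfolding rep_def by blast
  show "\<exists>\<phi>\<in>DM. (\<forall>v\<in>{0..M}. cmod (y v - (-1) ^ k * nderiv k \<phi> v) < e) \<and> p (G \<phi> x - l) < e"
  proof (intro bexI[OF _ \<phi>(1)] conjI ballI)
    fix v assume "v \<in> {0..M}"
    then have "cmod (y v - y' v) < e / 2" "cmod (y' v - (-1) ^ k * nderiv k \<phi> v) < e / 2"
      using y'(2) \<phi>(2) by auto
    then show "cmod (y v - (-1) ^ k * nderiv k \<phi> v) < e" by (rule norm_triangle_half_l[OF _ norm_minus_commute[THEN ord_eq_less_trans]])
  next
    have "p ((G \<phi> x - l') + (l' - l)) \<le> p (G \<phi> x - l') + p (l' - l)"
      using G_T[OF test_functions_on_test[OF \<phi>(1)] assms(2)] repT[OF y'(1)] assms(1)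
      by (intro cseminormD(1)[OF p] TS_diff)
    then show "p (G \<phi> x - l) < e" using y'(3) \<phi>(3) by simp
  qed
qed

lemma rep_test:
  assumes "\<phi> \<in> DM" "x \<in> TS" shows "rep x (\<lambda>v. (-1) ^ k * nderiv k \<phi> v) (G \<phi> x)"
  unfolding rep_def using assms G_T[OF test_functions_on_test[OF assms(1)] assms(2)]
  by (auto intro!: bexI[of _ \<phi>] simp: cseminormD(3))

lemma rep_cong: "rep x y l \<Longrightarrow> (\<And>v. v \<in> {0..M} \<Longrightarrow> y v = y' v) \<Longrightarrow> rep x y' l"
  by (simp add: rep_def)

lemma nderiv_comb:
  assumes "\<phi> \<in> DM" "\<psi> \<in> DM"
  shows "nderiv k (\<lambda>v. a * \<phi> v + b * \<psi> v) = (\<lambda>v. a * nderiv k \<phi> v + b * nderiv k \<psi> v)"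
  using test_functions_smooth[OF assms(1)] test_functions_smooth[OF assms(2)]
  by (simp add: nderiv_add nderiv_cmult smooth_mult smooth_const)

lemma G_comb:
  assumes "\<phi> \<in> DM" "\<psi> \<in> DM"
  shows "G (\<lambda>v. a * \<phi> v + b * \<psi> v) x = s a (G \<phi> x) + s b (G \<psi> x)"
proof -
  have t: "\<phi> \<in> test_functions" "\<psi> \<in> test_functions" "(\<lambda>v. a * \<phi> v) \<in> test_functions" "(\<lambda>v. b * \<psi> v) \<in> test_functions"
    using test_functions_on_test test_functions_on_cmult assms by blast+
  show ?thesis by (simp add: G_add[OF t(3,4)] G_cmult t)
qed

lemma rep_comb:
  assumes x: "x \<in> TS" and 1: "rep x y l" and 2: "rep x y' l'"
  shows "rep x (\<lambda>v. a * y v + b * y' v) (s a l + s b l')"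
  unfolding rep_def
proof (intro conjI allI impI)
  show "s a l + s b l' \<in> TS" using repT[OF 1] repT[OF 2] by (intro TS_add TS_scale)
  fix p and e :: real assume p: "cseminorm s X p" and e: "e > 0"
  define d where "d = e / (cmod a + cmod b + 1)"
  have pos: "cmod a + cmod b + 1 > 0" by (intro add_nonneg_pos) auto
  have d: "d > 0" "(cmod a + cmod b) * d < e"
    using e pos by (simp_all add: d_def pos_divide_less_eq distrib_left mult.commute)
  obtain \<phi> where \<phi>: "\<phi> \<in> DM" "\<forall>v\<in>{0..M}. cmod (y v - (-1) ^ k * nderiv k \<phi> v) < d" "p (G \<phi> x - l) < d"
    using 1 p d(1) unfolding rep_def by blast
  obtain \<psi> where \<psi>: "\<psi> \<in> DM" "\<forall>v\<in>{0..M}. cmod (y' v - (-1) ^ k * nderiv k \<psi> v) < d" "p (G \<psi> x - l') < d"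
    using 2 p d(1) unfolding rep_def by blast
  have GT: "G \<phi> x \<in> TS" "G \<psi> x \<in> TS" using G_T test_functions_on_test \<phi>(1) \<psi>(1) x by blast+
  have bd: "cmod a * u + cmod b * w < e" if "u < d" "w < d" for u w
  proof -
    have "cmod a * u \<le> cmod a * d" "cmod b * w \<le> cmod b * d" using that by (auto intro!: mult_left_mono)
    then show ?thesis using d(2) by (simp add: distrib_right)
  qed
  show "\<exists>\<phi>\<in>DM. (\<forall>v\<in>{0..M}. cmod (a * y v + b * y' v - (-1) ^ k * nderiv k \<phi> v) < e) \<and> p (G \<phi> x - (s a l + s b l')) < e"
  proof (intro bexI[OF _ test_functions_on_comb[OF \<phi>(1) \<psi>(1), of a b]] conjI ballI)
    fix v assume v: "v \<in> {0..M}"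
    have "a * y v + b * y' v - (-1) ^ k * nderiv k (\<lambda>v. a * \<phi> v + b * \<psi> v) v
      = a * (y v - (-1) ^ k * nderiv k \<phi> v) + b * (y' v - (-1) ^ k * nderiv k \<psi> v)"
      unfolding nderiv_comb[OF \<phi>(1) \<psi>(1)] by (simp add: algebra_simps)
    also have "cmod \<dots> \<le> cmod a * cmod (y v - (-1) ^ k * nderiv k \<phi> v) + cmod b * cmod (y' v - (-1) ^ k * nderiv k \<psi> v)"
      by (metis norm_mult norm_triangle_ineq)
    also have "\<dots> < e" using \<phi>(2) \<psi>(2) v by (intro bd) auto
    finally show "cmod (a * y v + b * y' v - (-1) ^ k * nderiv k (\<lambda>v. a * \<phi> v + b * \<psi> v) v) < e" .
  next
    have "G (\<lambda>v. a * \<phi> v + b * \<psi> v) x - (s a l + s b l') = s a (G \<phi> x - l) + s b (G \<psi> x - l')"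
      unfolding G_comb[OF \<phi>(1) \<psi>(1)] by (simp add: scale_right_diff_distrib)
    also have "p \<dots> \<le> p (s a (G \<phi> x - l)) + p (s b (G \<psi> x - l'))"
      by (intro cseminormD(1)[OF p] TS_scale TS_diff GT repT[OF 1] repT[OF 2])
    also have "\<dots> = cmod a * p (G \<phi> x - l) + cmod b * p (G \<psi> x - l')"
      using GT repT[OF 1] repT[OF 2] by (simp add: cseminormD(2)[OF p] TS_diff)
    also have "\<dots> < e" by (rule bd[OF \<phi>(3) \<psi>(3)])
    finally show "p (G (\<lambda>v. a * \<phi> v + b * \<psi> v) x - (s a l + s b l')) < e" .
  qed
qed

lemma rep_cmult: "x \<in> TS \<Longrightarrow> rep x y l \<Longrightarrow> rep x (\<lambda>v. c * y v) (s c l)"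
  using rep_comb[of x y l y l c 0] by simp

lemma rep_diff: "x \<in> TS \<Longrightarrow> rep x y l \<Longrightarrow> rep x y' l' \<Longrightarrow> rep x (\<lambda>v. y v - y' v) (l - l')"
  using rep_comb[of x y l y' l' 1 "-1"] by simp

lemma rep_zero: "x \<in> TS \<Longrightarrow> rep x (\<lambda>v. 0) 0"
  using rep_test[of "\<lambda>v. 0" x] test_functionsI[of "\<lambda>t. 0" 0 0] smooth_const[of 0] G_zero tau M_def
    test_functions_on_mono[of "\<lambda>t. 0" "{0..0}" "{-M<..<M}"] by (simp add: nderiv_zero)

lemma rep_sum:
  assumes "x \<in> TS" "finite P" "\<And>i. i \<in> P \<Longrightarrow> rep x (y i) (l i)"
  shows "rep x (\<lambda>v. \<Sum>i\<in>P. y i v) (\<Sum>i\<in>P. l i)"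
  using assms(2,3)
proof (induction P rule: finite_induct)
  case empty show ?case using rep_zero[OF assms(1)] by simp
next
  case (insert i P)
  have "rep x (\<lambda>v. 1 * y i v + 1 * (\<Sum>i\<in>P. y i v)) (s 1 (l i) + s 1 (\<Sum>i\<in>P. l i))"
    by (rule rep_comb[OF assms(1)]) (use insert in auto)
  then show ?case using insert by simp
qed

lemma rep_bound:
  assumes p: "cseminorm s X p"
  shows "\<exists>q. cseminorm s X q \<and> (\<forall>x\<in>TS. \<forall>y l c. rep x y l \<longrightarrow> (\<forall>v\<in>{0..M}. cmod (y v) \<le> c) \<longrightarrow> p l \<le> c * q x)"
proof -
  obtain q where q: "cseminorm s X q" "\<forall>x\<in>TS. \<forall>\<phi>\<in>DM. \<forall>c. (\<forall>v\<in>{0..M}. cmod (nderiv k \<phi> v) \<le> c) \<longrightarrow> p (G \<phi> x) \<le> c * q x"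
    using est[OF p] by blast
  have "p l \<le> c * q x" if x: "x \<in> TS" and r: "rep x y l" and c: "\<forall>v\<in>{0..M}. cmod (y v) \<le> c" for x y l c
  proof (rule field_le_epsilon)
    fix e :: real assume e: "e > 0"
    have qx: "q x + 1 > 0" using cseminormD(5)[OF q(1) x] by simp
    define d where "d = e / (q x + 1)"
    have "d * (q x + 1) = e" using qx by (simp add: d_def)
    then have d: "d > 0" "d * q x + d = e" using e qx by (simp_all add: d_def distrib_left)
    obtain \<phi> where \<phi>: "\<phi> \<in> DM" "\<forall>v\<in>{0..M}. cmod (y v - (-1) ^ k * nderiv k \<phi> v) < d" "p (G \<phi> x - l) < d"
      using r p d(1) unfolding rep_def by blast
    have "cmod (nderiv k \<phi> v) \<le> c + d" if v: "v \<in> {0..M}" for v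
    proof -
      have "cmod ((-1) ^ k * nderiv k \<phi> v) \<le> cmod (y v) + cmod (y v - (-1) ^ k * nderiv k \<phi> v)"
        by (metis norm_minus_commute norm_triangle_sub)
      then show ?thesis using c \<phi>(2) v by (fastforce simp: norm_mult norm_power)
    qed
    then have 1: "p (G \<phi> x) \<le> (c + d) * q x" using q(2) x \<phi>(1) by blast
    have GT: "G \<phi> x \<in> TS" using G_T test_functions_on_test \<phi>(1) x by blast
    have "p l \<le> p (G \<phi> x) + p (l - G \<phi> x)" by (rule cseminormD(7)[OF p repT[OF r] GT])
    also have "\<dots> \<le> (c + d) * q x + d" using 1 \<phi>(3) cseminormD(8)[OF p repT[OF r] GT] by simp
    also have "\<dots> = c * q x + e" using d(2) by (simp add: distrib_right)
    finally show "p l \<le> c * q x + e" .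
  qed
  then show ?thesis using q(1) by blast
qed

lemma rep_unique:
  assumes "x \<in> TS" "rep x y l" "rep x y l'"
  shows "l = l'"
proof (rule seminorms_separate[OF hausdorff repT[OF assms(2)] repT[OF assms(3)]])
  fix p and e :: real assume p: "cseminorm s X p" "e > 0"
  obtain q where q: "\<forall>x\<in>TS. \<forall>y l c. rep x y l \<longrightarrow> (\<forall>v\<in>{0..M}. cmod (y v) \<le> c) \<longrightarrow> p l \<le> c * q x"
    using rep_bound[OF p(1)] by blast
  have "rep x (\<lambda>v. 0) (l - l')" using rep_diff[OF assms] by simp
  then have "p (l - l') \<le> 0 * q x" using q assms(1) by (metis norm_zero order_refl)
  then show "p (l - l') < e" using p(2) by simp
qed

lemma rep_tendsto:
  assumes x: "x \<in> TS" and r: "rep x y l" and rn: "\<And>n::nat. rep x (yn n) (lv n)"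
    and u: "\<And>e. e > 0 \<Longrightarrow> eventually (\<lambda>n. \<forall>v\<in>{0..M}. cmod (yn n v - y v) \<le> e) sequentially"
  shows "limitin X lv l sequentially"
  unfolding limitin_seminorm
proof (intro conjI allI impI)
  show "l \<in> TS" by (rule repT[OF r])
  show "eventually (\<lambda>i. lv i \<in> TS) sequentially" using repT[OF rn] by simp
  fix p and e :: real assume p: "cseminorm s X p" and e: "e > 0"
  obtain q where q: "cseminorm s X q" "\<forall>x\<in>TS. \<forall>y l c. rep x y l \<longrightarrow> (\<forall>v\<in>{0..M}. cmod (y v) \<le> c) \<longrightarrow> p l \<le> c * q x"
    using rep_bound[OF p(1)] by blast
  have qx: "q x + 1 > 0" using cseminormD(5)[OF q(1) x] by simp
  have d: "e / (q x + 1) > 0" using e qx by simp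
  show "eventually (\<lambda>i. p (lv i - l) < e) sequentially"
    using u[OF d]
  proof eventually_elim
    case (elim n)
    have "p (lv n - l) \<le> e / (q x + 1) * q x"
      using q(2) x rep_diff[OF x rn[of n] r] elim by blast
    also have "\<dots> < e / (q x + 1) * (q x + 1)" using d by (intro mult_strict_left_mono) auto
    also have "\<dots> = e" using qx by simp
    finally show ?case .
  qed
qed

lemma rep_complete:
  assumes x: "x \<in> TS" and a: "\<And>e. e > 0 \<Longrightarrow> \<exists>y' l'. rep x y' l' \<and> (\<forall>v\<in>{0..M}. cmod (y v - y' v) < e)"
  shows "\<exists>l. rep x y l"
proof -
  have "\<forall>n. \<exists>y' l'. rep x y' l' \<and> (\<forall>v\<in>{0..M}. cmod (y v - y' v) < 1 / real (Suc n))"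
    using a by simp
  then obtain yn lv where n: "\<And>n. rep x (yn n) (lv n)" "\<And>n v. v \<in> {0..M} \<Longrightarrow> cmod (y v - yn n v) < 1 / real (Suc n)"
    by metis
  have small: "\<exists>N. \<forall>n\<ge>N. 1 / real (Suc n) < e" if e: "e > 0" for e :: real
  proof -
    obtain N where N: "1 / real (Suc N) < e" using e nat_approx_posE by blast
    have "1 / real (Suc n) \<le> 1 / real (Suc N)" if "n \<ge> N" for n using that by (simp add: frac_le)
    then show ?thesis using N by (meson order_le_less_trans)
  qed
  have "\<exists>l. limitin X lv l sequentially"
  proof (rule seq_complete_seminorm[OF complete repT[OF n(1)]])
    fix p and e :: real assume p: "cseminorm s X p" and e: "e > 0"
    obtain q where q: "cseminorm s X q" "\<forall>x\<in>TS. \<forall>y l c. rep x y l \<longrightarrow> (\<forall>v\<in>{0..M}. cmod (y v) \<le> c) \<longrightarrow> p l \<le> c * q x"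
      using rep_bound[OF p(1)] by blast
    have qx: "q x \<ge> 0" using cseminormD(5)[OF q(1) x] by simp
    have d: "e / (2 * (q x + 1)) > 0" using e qx by simp
    obtain N where N: "\<forall>n\<ge>N. 1 / real (Suc n) < e / (2 * (q x + 1))" using small[OF d] by blast
    have "p (lv m - lv n') < e" if mn: "m \<ge> N" "n' \<ge> N" for m n'
    proof -
      have "cmod (yn m v - yn n' v) \<le> e / (q x + 1)" if v: "v \<in> {0..M}" for v
      proof -
        have "cmod (yn m v - yn n' v) \<le> cmod (y v - yn n' v) + cmod (y v - yn m v)"
          using norm_triangle_ineq4[of "y v - yn n' v" "y v - yn m v"] by simp
        also have "\<dots> \<le> e / (2 * (q x + 1)) + e / (2 * (q x + 1))"
          using n(2)[OF v, of m] n(2)[OF v, of n'] N mn by (intro add_mono) (meson less_imp_le less_trans)+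
        also have "\<dots> = e / (q x + 1)" 
        proof -
          have "e / (2 * (q x + 1)) = e / (q x + 1) / 2" by simp
          then show ?thesis by (simp only: field_sum_of_halves)
        qed
        finally show ?thesis .
      qed
      then have "p (lv m - lv n') \<le> e / (q x + 1) * q x"
        using q(2) x rep_diff[OF x n(1)[of m] n(1)[of n']] by blast
      also have "\<dots> < e / (q x + 1) * (q x + 1)" using e qx by (intro mult_strict_left_mono) auto
      also have "\<dots> = e" using qx by simp
      finally show ?thesis .
    qed
    then show "\<exists>n0. \<forall>m\<ge>n0. \<forall>n\<ge>n0. p (lv m - lv n) < e" by blast
  qed
  then obtain l where l: "limitin X lv l sequentially" by blast
  have "rep x y l"
  proof (rule rep_limit[OF limitin_topspace[OF l] x])
    fix p and e :: real assume p: "cseminorm s X p" and e: "e > 0"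
    have "eventually (\<lambda>n. p (lv n - l) < e) sequentially" using l p e by (simp add: limitin_seminorm)
    then obtain N1 where N1: "\<forall>n\<ge>N1. p (lv n - l) < e" unfolding eventually_sequentially by blast
    obtain N where N: "\<forall>n\<ge>N. 1 / real (Suc n) < e" using small[OF e] by blast
    let ?n = "max N N1"
    have "1 / real (Suc ?n) < e" using N by (metis max.cobounded1)
    then have "\<forall>v\<in>{0..M}. cmod (y v - yn ?n v) < e" using n(2)[of _ ?n] by (meson less_trans)
    moreover have "p (lv ?n - l) < e" using N1 by simp
    ultimately show "\<exists>y' l'. rep x y' l' \<and> (\<forall>v\<in>{0..M}. cmod (y v - y' v) < e) \<and> p (l' - l) < e"
      using n(1) by blast
  qed
  then show ?thesis by blast
qed

text \<open>
  Riemann sums of \<open>\<sigma>\<close> correspond under \<open>rep\<close> to Riemann sums of \<open>Y\<close>, and these converge uniformly. The integral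
  in the locally convex space therefore exists and need not be constructed separately.
\<close>

lemma rep_integral:
  assumes x: "x \<in> TS" and Y: "continuous_on ({a..b} \<times> {0..M}) (\<lambda>(r, v). Y r v)"
    and r: "\<And>r. r \<in> {a..b} \<Longrightarrow> rep x (Y r) (\<sigma> r)"
  shows "\<exists>l. rep x (\<lambda>v. integral {a..b} (\<lambda>r. Y r v)) l \<and> has_lcs_integral s X \<sigma> a b l"
proof -
  let ?I = "\<lambda>v. integral {a..b} (\<lambda>r. Y r v)" and ?F = "division_filter {a..b}"
  let ?T = "\<lambda>P v. \<Sum>(r, K)\<in>P. of_real (measure lborel K) * Y r v"
  let ?S = "\<lambda>P. \<Sum>(r, K)\<in>P. s (of_real (measure lborel K)) (\<sigma> r)"
  have M0: "0 \<le> M" using tau M_def by simp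
  have bot: "?F \<noteq> bot" using division_filter_not_empty[of a b] by simp
  have td: "eventually (\<lambda>P. P tagged_division_of {a..b}) ?F"
    using eventually_division_filter_tagged_division[of "{a..b}"] by simp
  have repP: "rep x (?T P) (?S P)" if P: "P tagged_division_of {a..b}" for P
  proof -
    have "rep x (\<lambda>v. \<Sum>i\<in>P. (case i of (r, K) \<Rightarrow> of_real (measure lborel K) * Y r v))
       (\<Sum>i\<in>P. (case i of (r, K) \<Rightarrow> s (of_real (measure lborel K)) (\<sigma> r)))"
    proof (rule rep_sum[OF x])
      show "finite P" using P by auto
      fix i assume i: "i \<in> P"
      obtain t K where tK: "i = (t, K)" by (cases i)
      have "t \<in> {a..b}" using tagged_division_ofD(2,3)[OF P] i tK by blast
      from rep_cmult[OF x r[OF this], of "of_real (measure lborel K)"]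
      show "rep x (\<lambda>v. case i of (r, K) \<Rightarrow> of_real (measure lborel K) * Y r v) (case i of (r, K) \<Rightarrow> s (of_real (measure lborel K)) (\<sigma> r))"
        by (simp add: tK)
    qed
    then show ?thesis by simp
  qed
  have ur: "eventually (\<lambda>P. \<forall>v\<in>{0..M}. cmod (?T P v - ?I v) < e) ?F" if "e > 0" for e
    by (rule uniform_riemann_sums[OF Y M0 that])
  have "\<exists>l. rep x ?I l"
  proof (rule rep_complete[OF x])
    fix e :: real assume "e > 0"
    from eventually_happens'[OF bot eventually_conj[OF td ur[OF this]]]
    obtain P where "P tagged_division_of {a..b}" "\<forall>v\<in>{0..M}. cmod (?T P v - ?I v) < e" by blast
    then show "\<exists>y' l'. rep x y' l' \<and> (\<forall>v\<in>{0..M}. cmod (?I v - y' v) < e)"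
      using repP by (intro exI[of _ "?T P"] exI[of _ "?S P"]) (simp add: norm_minus_commute)
  qed
  then obtain l where l: "rep x ?I l" by blast
  have "limitin X ?S l ?F"
    unfolding limitin_seminorm
  proof (intro conjI allI impI)
    show "l \<in> TS" by (rule repT[OF l])
    show "eventually (\<lambda>P. ?S P \<in> TS) ?F" using td by (rule eventually_mono) (rule repT[OF repP])
    fix p and e :: real assume p: "cseminorm s X p" and e: "e > 0"
    obtain q where q: "cseminorm s X q" "\<forall>x\<in>TS. \<forall>y l c. rep x y l \<longrightarrow> (\<forall>v\<in>{0..M}. cmod (y v) \<le> c) \<longrightarrow> p l \<le> c * q x"
      using rep_bound[OF p(1)] by blast
    have qx: "q x + 1 > 0" using cseminormD(5)[OF q(1) x] by simp
    have d: "e / (q x + 1) > 0" using e qx by simp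
    show "eventually (\<lambda>P. p (?S P - l) < e) ?F"
      using td ur[OF d]
    proof eventually_elim
      fix P assume P: "P tagged_division_of {a..b}" and u: "\<forall>v\<in>{0..M}. cmod (?T P v - ?I v) < e / (q x + 1)"
      have "p (?S P - l) \<le> e / (q x + 1) * q x"
        by (rule q(2)[rule_format, OF x rep_diff[OF x repP[OF P] l]]) (use u in \<open>simp add: less_imp_le\<close>)
      also have "\<dots> < e / (q x + 1) * (q x + 1)" using d by (intro mult_strict_left_mono) auto
      also have "\<dots> = e" using qx by simp
      finally show "p (?S P - l) < e" .
    qed
  qed
  then show ?thesis using l unfolding has_lcs_integral_def by blast
qed

end


section \<open>The operator family\<close>

lemma eventually_inverse_Suc_le:
  assumes "e > 0"
  shows "eventually (\<lambda>n. c * (1 / real (Suc n)) \<le> e) sequentially"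
proof -
  have "(\<lambda>n. c * (1 / real (Suc n))) \<longlonglongrightarrow> c * 0"
    by (intro tendsto_mult tendsto_const LIMSEQ_Suc[OF lim_1_over_n])
  then have "eventually (\<lambda>n. c * (1 / real (Suc n)) < e) sequentially"
    by (rule order_tendstoD(2)) (use assms in simp)
  then show ?thesis by eventually_elim simp
qed

lemma uniform_limit_prim_pow_approx:
  assumes "0 \<le> t" "t \<le> M"
  shows "uniform_limit {-M..M} (\<lambda>j. (prim M ^^ m) (approx t j)) (\<lambda>v. of_real (tpow (Suc m) t v)) sequentially"
proof (rule uniform_limitI)
  fix e :: real assume e: "e > 0"
  have "e / 2 > 0" using e by simp
  from eventually_inverse_Suc_le[OF this, of "(2 * M) ^ m"]
  show "eventually (\<lambda>n. \<forall>v\<in>{-M..M}. dist ((prim M ^^ m) (approx t n) v) (of_real (tpow (Suc m) t v)) < e) sequentially"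
  proof eventually_elim
    case (elim j)
    show ?case
    proof
      fix v assume v: "v \<in> {-M..M}"
      show "dist ((prim M ^^ m) (approx t j) v) (of_real (tpow (Suc m) t v)) < e"
        using prim_pow_approx_error[OF assms(2) v, of m j] elim e unfolding dist_norm by linarith
    qed
  qed
qed

lemma test_function_interval:
  assumes "\<phi> \<in> test_functions" obtains a b where "\<phi> \<in> test_functions_on {a..b}"
proof -
  have "bounded (fsupp \<phi>)" using assms by (simp add: test_functions_iff compact_imp_bounded)
  then obtain B where B: "\<forall>v\<in>fsupp \<phi>. \<bar>v\<bar> \<le> B" unfolding bounded_iff by auto
  then have "fsupp \<phi> \<subseteq> {-B..B}" by (auto simp: abs_le_iff)
  then show thesis using assms that by (simp add: test_functions_on_def)
qed

lemma conv0_test_functions: "\<phi> \<in> test_functions \<Longrightarrow> \<psi> \<in> test_functions \<Longrightarrow> conv0 \<phi> \<psi> \<in> test_functions"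
  by (metis conv0_test test_function_interval test_functions_on_test)

lemma test_function_on_nonneg_at_0:
  assumes "\<phi> \<in> test_functions_on {0..}" shows "\<phi> 0 = 0"
proof -
  have "isCont \<phi> 0"
    using smooth_continuous[OF test_functions_smooth[OF assms], of UNIV] by (simp add: continuous_on_eq_continuous_at)
  then have "(\<phi> \<longlongrightarrow> \<phi> 0) (at_left 0)"
    unfolding isCont_def by (rule filterlim_mono[OF _ order_refl at_le]) simp
  moreover have "eventually (\<lambda>v. 0 = \<phi> v) (at_left (0::real))"
    using test_function_zero[OF assms] by (auto simp: eventually_at_filter)
  then have "(\<phi> \<longlongrightarrow> 0) (at_left 0)" by (rule Lim_transform_eventually[OF tendsto_const])
  ultimately show ?thesis using tendsto_unique[OF trivial_limit_at_left_real] by blast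
qed

context complex_lcs
begin

lemma has_lcs_integral_cong:
  assumes "has_lcs_integral s X f a b l" "\<And>r. r \<in> {a..b} \<Longrightarrow> f r = g r"
  shows "has_lcs_integral s X g a b l"
  unfolding has_lcs_integral_def
proof (rule limitin_transform_eventually)
  show "limitin X (\<lambda>p. \<Sum>(t, k)\<in>p. s (of_real (measure lborel k)) (f t)) l (division_filter {a..b})"
    using assms(1) by (simp add: has_lcs_integral_def)
  have "eventually (\<lambda>P. P tagged_division_of {a..b}) (division_filter {a..b})"
    using eventually_division_filter_tagged_division[of "{a..b}"] by simp
  then show "eventually (\<lambda>p. (\<Sum>(t, k)\<in>p. s (of_real (measure lborel k)) (f t)) = (\<Sum>(t, k)\<in>p. s (of_real (measure lborel k)) (g t))) (division_filter {a..b})"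
  proof eventually_elim
    fix P assume P: "P tagged_division_of {a..b}"
    show "(\<Sum>(t, k)\<in>P. s (of_real (measure lborel k)) (f t)) = (\<Sum>(t, k)\<in>P. s (of_real (measure lborel k)) (g t))"
    proof (rule sum.cong[OF refl], clarify)
      fix t k assume "(t, k) \<in> P"
      then have "t \<in> {a..b}" using tagged_division_ofD(2,3)[OF P] by blast
      then show "s (of_real (measure lborel k)) (f t) = s (of_real (measure lborel k)) (g t)" using assms(2) by simp
    qed
  qed
qed

lemma limitin_scalar:
  assumes "c \<longlonglongrightarrow> d" "y \<in> TS"
  shows "limitin X (\<lambda>n. s (c n) y) (s d y) sequentially"
  unfolding limitin_seminorm
proof (intro conjI allI impI)
  show "s d y \<in> TS" by (rule TS_scale[OF assms(2)])
  show "eventually (\<lambda>n. s (c n) y \<in> TS) sequentially" using TS_scale[OF assms(2)] by simp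
  fix p and e :: real assume p: "cseminorm s X p" and e: "e > 0"
  have "(\<lambda>n. cmod (c n - d) * p y) \<longlonglongrightarrow> cmod (d - d) * p y"
    by (intro tendsto_intros assms)
  then have "eventually (\<lambda>n. cmod (c n - d) * p y < e) sequentially"
    by (rule order_tendstoD(2)) (use e in simp)
  then show "eventually (\<lambda>n. p (s (c n) y - s d y) < e) sequentially"
    by (simp add: scale_left_diff_distrib[symmetric] cseminormD(2)[OF p assms(2)])
qed

lemma limitin_minus:
  assumes "limitin X f l F" "limitin X g l' F"
  shows "limitin X (\<lambda>i. f i - g i) (l - l') F"
  using limitin_plus[OF assms(1) limitin_scale[OF assms(2), of "-1"]] by simp

end

context finite_order_cds
begin

text \<open>
  The index is capped at \<open>\<tau>\<close> so that \<open>t \<mapsto> S t x\<close> is continuous on the whole line, which permits integrals over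
  intervals reaching beyond \<open>\<tau>\<close>. The value \<open>0\<close> outside the space is the normalisation of operators.
\<close>

definition S :: "real \<Rightarrow> 'a \<Rightarrow> 'a" where
  "S t x = (if x \<in> TS then THE l. rep x (\<lambda>v. of_real (tpow 1 (min t \<tau>) v)) l else 0)"

lemma power_test_DM: "t \<le> \<tau> \<Longrightarrow> power_test M n t j \<in> DM"
proof -
  assume t: "t \<le> \<tau>"
  have j: "1 / real (Suc j) \<le> 1" by simp
  have lt: "t + 1 / real (Suc j) < M" "1 < M" using t j M_def tau by linarith+
  show ?thesis
    by (rule test_functions_on_mono[OF power_test_test[OF less_imp_le[OF lt(1)]]])
       (use lt in \<open>auto simp del: of_nat_Suc\<close>)
qed

lemma power_test_test_function: "t \<le> \<tau> \<Longrightarrow> power_test M n t j \<in> test_functions"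
  by (rule test_functions_on_test[OF power_test_DM])

lemma power_test_rep:
  assumes "x \<in> TS" "t \<le> \<tau>"
  shows "rep x (approx t j) (G (power_test M k t j) x)"
  by (rule rep_cong[OF rep_test[OF power_test_DM[OF assms(2)] assms(1)]]) (simp add: nderiv_power_test)

lemma M_bounds: "\<tau> \<le> M" "0 \<le> M" "1 < M" using tau M_def by simp_all

lemma S_rep:
  assumes "x \<in> TS" shows "rep x (\<lambda>v. of_real (tpow 1 (min t \<tau>) v)) (S t x)"
proof -
  have "\<exists>l. rep x (\<lambda>v. of_real (tpow 1 (min t \<tau>) v)) l"
  proof (rule rep_complete[OF assms])
    fix e :: real assume "e > 0"
    then obtain j where j: "1 / real (Suc j) < e" using nat_approx_posE by blast
    have "cmod (of_real (tpow 1 (min t \<tau>) v) - approx (min t \<tau>) j v) < e" for v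
      using approx_error[of "min t \<tau>" j v] j by (simp add: norm_minus_commute)
    then show "\<exists>y' l'. rep x y' l' \<and> (\<forall>v\<in>{0..M}. cmod (of_real (tpow 1 (min t \<tau>) v) - y' v) < e)"
      using power_test_rep[OF assms, of "min t \<tau>" j] by (intro exI[of _ "approx (min t \<tau>) j"] exI[of _ "G (power_test M k (min t \<tau>) j) x"]) simp
  qed
  then obtain l where l: "rep x (\<lambda>v. of_real (tpow 1 (min t \<tau>) v)) l" by blast
  then have "(THE l. rep x (\<lambda>v. of_real (tpow 1 (min t \<tau>) v)) l) = l"
    using rep_unique[OF assms] by (intro the_equality) blast+
  then show ?thesis using l assms by (simp add: S_def)
qed

lemma S_T: "x \<in> TS \<Longrightarrow> S t x \<in> TS"
  by (rule repT[OF S_rep])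

lemma G_power_test_S:
  assumes "x \<in> TS" shows "limitin X (\<lambda>j. G (power_test M k (min t \<tau>) j) x) (S t x) sequentially"
proof (rule rep_tendsto[OF assms S_rep[OF assms] power_test_rep[OF assms]])
  fix e :: real assume "e > 0"
  from eventually_inverse_Suc_le[OF this, of 1]
  show "eventually (\<lambda>n. \<forall>v\<in>{0..M}. cmod (approx (min t \<tau>) n v - of_real (tpow 1 (min t \<tau>) v)) \<le> e) sequentially"
  proof eventually_elim
    case (elim n)
    then show ?case using approx_error[of "min t \<tau>" n] by (auto intro: order_trans)
  qed
qed simp

lemma seq_unique: "limitin X f l sequentially \<Longrightarrow> limitin X f l' sequentially \<Longrightarrow> l = l'"
  using limitin_unique[OF hausdorff _ _ trivial_limit_sequentially] by blast

lemma S_lin: "x \<in> TS \<Longrightarrow> y \<in> TS \<Longrightarrow> S t (x + y) = S t x + S t y"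
  and S_scale: "x \<in> TS \<Longrightarrow> S t (s c x) = s c (S t x)"
proof -
  let ?\<phi> = "power_test M k (min t \<tau>)"
  have op: "G (?\<phi> j) \<in> end_ops s X" for j by (rule G_op[OF power_test_test_function]) simp
  show "S t (x + y) = S t x + S t y" if "x \<in> TS" "y \<in> TS"
  proof (rule seq_unique)
    show "limitin X (\<lambda>j. G (?\<phi> j) (x + y)) (S t (x + y)) sequentially" by (rule G_power_test_S[OF TS_add[OF that]])
    show "limitin X (\<lambda>j. G (?\<phi> j) (x + y)) (S t x + S t y) sequentially"
      using limitin_plus[OF G_power_test_S[OF that(1)] G_power_test_S[OF that(2)]] by (simp add: end_opsD(2)[OF op that])
  qed
  show "S t (s c x) = s c (S t x)" if "x \<in> TS"
  proof (rule seq_unique)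
    show "limitin X (\<lambda>j. G (?\<phi> j) (s c x)) (S t (s c x)) sequentially" by (rule G_power_test_S[OF TS_scale[OF that]])
    show "limitin X (\<lambda>j. G (?\<phi> j) (s c x)) (s c (S t x)) sequentially"
      using limitin_scale[OF G_power_test_S[OF that]] by (simp add: end_opsD(3)[OF op that])
  qed
qed

lemma S_bound:
  assumes p: "cseminorm s X p"
  shows "\<exists>q. cseminorm s X q \<and> (\<forall>x\<in>TS. \<forall>t. p (S t x) \<le> \<tau> * q x) \<and> (\<forall>x\<in>TS. \<forall>t u. p (S t x - S u x) \<le> \<bar>t - u\<bar> * q x)"
proof -
  obtain q where q: "cseminorm s X q" "\<forall>x\<in>TS. \<forall>y l c. rep x y l \<longrightarrow> (\<forall>v\<in>{0..M}. cmod (y v) \<le> c) \<longrightarrow> p l \<le> c * q x"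
    using rep_bound[OF p] by blast
  have "p (S t x) \<le> \<tau> * q x" if x: "x \<in> TS" for t x
    by (rule q(2)[rule_format, OF x S_rep[OF x, of t]]) (use tau in \<open>auto simp: tpow_def\<close>)
  moreover have "p (S t x - S u x) \<le> \<bar>t - u\<bar> * q x" if x: "x \<in> TS" for t u x
  proof (rule q(2)[rule_format, OF x rep_diff[OF x S_rep[OF x, of t] S_rep[OF x, of u]]])
    fix v
    have "cmod (of_real (tpow 1 (min t \<tau>) v - tpow 1 (min u \<tau>) v)) \<le> \<bar>t - u\<bar>"
      unfolding norm_of_real tpow_def by auto
    then show "cmod (of_real (tpow 1 (min t \<tau>) v) - of_real (tpow 1 (min u \<tau>) v)) \<le> \<bar>t - u\<bar>" by simp
  qed
  ultimately show ?thesis using q(1) by blast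
qed

lemma S_op: "S t \<in> end_ops s X"
proof -
  have "continuous_map X X (S t)"
  proof (rule continuous_map_seminorm)
    show "S t x \<in> TS" if "x \<in> TS" for x by (rule S_T[OF that])
    fix x p and e :: real assume x: "x \<in> TS" and p: "cseminorm s X p" and e: "e > 0"
    obtain q where q: "cseminorm s X q" "\<forall>x\<in>TS. \<forall>t. p (S t x) \<le> \<tau> * q x"
      using S_bound[OF p] by blast
    let ?V = "{y \<in> TS. q (y - x) < e / (2 * \<tau>)}"
    have "p (S t y - S t x) < e" if y: "y \<in> ?V" for y
    proof -
      have yT: "y \<in> TS" using y by simp
      have "S t y - S t x = S t (y - x)"
        using S_lin[OF TS_diff[OF yT x] x, of t] by (simp add: algebra_simps)
      then have "p (S t y - S t x) \<le> \<tau> * q (y - x)" using q(2) TS_diff[OF yT x] by simp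
      also have "\<dots> \<le> \<tau> * (e / (2 * \<tau>))" using y tau by (intro mult_left_mono) auto
      also have "\<dots> < e" using tau e by simp
      finally show ?thesis .
    qed
    moreover have "openin X ?V" by (rule openin_seminorm_ball[OF q(1) x])
    moreover have "x \<in> ?V" using x e tau cseminormD(3)[OF q(1)] by simp
    ultimately show "\<exists>V. openin X V \<and> x \<in> V \<and> (\<forall>u\<in>V. p (S t u - S t x) < e)" by blast
  qed
  then show ?thesis using S_lin S_scale by (simp add: lin_ops_def S_def)
qed

lemma S_strongly_continuous: "strongly_continuous_family s X (ereal \<tau>) S"
  unfolding strongly_continuous_family_def
proof (intro conjI allI impI ballI S_op)
  fix x assume x: "x \<in> TS"
  show "continuous_map (top_of_set {t. 0 \<le> t \<and> ereal t < ereal \<tau>}) X (\<lambda>t. S t x)"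
  proof (rule continuous_map_seminorm)
    show "S t x \<in> TS" for t by (rule S_T[OF x])
    fix t p and e :: real assume t: "t \<in> topspace (top_of_set {t. 0 \<le> t \<and> ereal t < ereal \<tau>})"
      and p: "cseminorm s X p" and e: "e > 0"
    obtain q where q: "cseminorm s X q" "\<forall>x\<in>TS. \<forall>t u. p (S t x - S u x) \<le> \<bar>t - u\<bar> * q x"
      using S_bound[OF p] by blast
    have qx: "q x + 1 > 0" using cseminormD(5)[OF q(1) x] by simp
    let ?V = "{t. 0 \<le> t \<and> ereal t < ereal \<tau>} \<inter> ball t (e / (q x + 1))"
    have "p (S u x - S t x) < e" if u: "u \<in> ?V" for u
    proof -
      have ut: "\<bar>u - t\<bar> < e / (q x + 1)" using u by (simp add: dist_real_def abs_minus_commute)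
      have "p (S u x - S t x) \<le> \<bar>u - t\<bar> * q x" using q(2) x by blast
      also have "\<dots> \<le> e / (q x + 1) * q x" using ut qx cseminormD(5)[OF q(1) x] by (intro mult_right_mono) auto
      also have "\<dots> < e / (q x + 1) * (q x + 1)" using e qx by (intro mult_strict_left_mono) auto
      also have "\<dots> = e" using qx by simp
      finally show ?thesis .
    qed
    moreover have "openin (top_of_set {t. 0 \<le> t \<and> ereal t < ereal \<tau>}) ?V" by (rule openin_open_Int) simp
    moreover have "t \<in> ?V" using t e qx by simp
    ultimately show "\<exists>V. openin (top_of_set {t. 0 \<le> t \<and> ereal t < ereal \<tau>}) V \<and> t \<in> V \<and> (\<forall>u\<in>V. p (S u x - S t x) < e)" by blast
  qed
qed

lemma S_C: "S t \<circ> C = C \<circ> S t"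
proof
  fix x
  show "(S t \<circ> C) x = (C \<circ> S t) x"
  proof (cases "x \<in> TS")
    case True
    have tf: "power_test M k (min t \<tau>) j \<in> test_functions" for j by (rule power_test_test_function) simp
    have "S t (C x) = C (S t x)"
    proof (rule seq_unique)
      show "limitin X (\<lambda>j. G (power_test M k (min t \<tau>) j) (C x)) (S t (C x)) sequentially"
        by (rule G_power_test_S[OF end_opsD(1)[OF C_op True]])
      show "limitin X (\<lambda>j. G (power_test M k (min t \<tau>) j) (C x)) (C (S t x)) sequentially"
        using limitin_op[OF C_op G_power_test_S[OF True, of t]] by (simp add: G_C tf)
    qed
    then show ?thesis by simp
  next
    case False
    then show ?thesis using end_opsD(4,6)[OF C_op] end_opsD(4)[OF S_op] by (simp add: S_def)
  qed
qed

lemma S_weighted_integral: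
  assumes x: "x \<in> TS" and c: "continuous_on {a..b} c"
  shows "\<exists>l. rep x (\<lambda>v. integral {a..b} (\<lambda>r. c r * of_real (tpow 1 (min r \<tau>) v))) l
    \<and> has_lcs_integral s X (\<lambda>r. s (c r) (S r x)) a b l"
proof (rule rep_integral[OF x])
  have "continuous_on ({a..b} \<times> {0..M}) (\<lambda>z. c (fst z))"
    by (rule continuous_on_compose2[OF c]) (auto intro!: continuous_intros)
  then show "continuous_on ({a..b} \<times> {0..M}) (\<lambda>(r, v). c r * complex_of_real (tpow 1 (min r \<tau>) v))"
    unfolding split_beta tpow_def by (intro continuous_intros) auto
  show "rep x (\<lambda>v. c r * of_real (tpow 1 (min r \<tau>) v)) (s (c r) (S r x))" for r
    by (rule rep_cmult[OF x S_rep[OF x]])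
qed

text \<open>
  Taylor's formula with integral remainder at the upper end point, where all derivatives of \<open>\<phi>\<close> vanish. The cap
  at \<open>\<tau>\<close> is harmless because \<open>\<phi>\<close> vanishes beyond \<open>\<tau>\<close>.
\<close>

lemma nderiv_integral_formula:
  assumes \<phi>: "\<phi> \<in> test_functions_on {-\<tau><..<\<tau>}" and "b \<ge> \<tau>" "v \<ge> 0"
  shows "integral {0..b} (\<lambda>r. nderiv (k + 2) \<phi> r * of_real (tpow 1 (min r \<tau>) v)) = nderiv k \<phi> v"
proof -
  have sm: "smooth \<phi>" by (rule test_functions_smooth[OF \<phi>])
  have z: "nderiv n \<phi> r = 0" if "r \<ge> \<tau>" for n r
    using that by (intro nderiv_zero_outside[OF \<phi>]) auto
  \<comment> \<open>a primitive of \<open>\<phi>\<^sup>(\<^sup>k\<^sup>+\<^sup>2\<^sup>) r (r - v)\<^sub>+\<close>, constant for \<open>r \<le> v\<close>\<close>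
  let ?F = "\<lambda>r. of_real (max r v - v) * nderiv (k + 1) \<phi> (max r v) - nderiv k \<phi> (max r v)"
  have "((\<lambda>r. nderiv (k + 2) \<phi> r * of_real (tpow 1 (min r \<tau>) v)) has_integral (?F b - ?F 0)) {0..b}"
  proof (rule fundamental_theorem_of_calculus_interior_strong[of "{v}"])
    have c: "continuous_on {0..b} (\<lambda>r. nderiv n \<phi> (max r v))" for n
      by (rule continuous_on_compose2[OF smooth_nderiv_continuous[OF sm, of UNIV]]) (auto intro!: continuous_intros)
    show "continuous_on {0..b} ?F"
      by (intro continuous_on_diff continuous_on_mult continuous_on_of_real continuous_on_max continuous_on_const continuous_on_id c)
    fix r assume r: "r \<in> {0<..<b} - {v}"
    show "(?F has_vector_derivative nderiv (k + 2) \<phi> r * of_real (tpow 1 (min r \<tau>) v)) (at r)"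
    proof (cases "r < v")
      case True
      have "((\<lambda>r. ?F v) has_vector_derivative 0) (at r)" by simp
      then have "(?F has_vector_derivative 0) (at r)"
        by (rule has_vector_derivative_transform_within_open[of _ _ _ "{..<v}"]) (use True in auto)
      then show ?thesis using True by (simp add: tpow_def)
    next
      case False
      then have rv: "r > v" using r by simp
      have 1: "((\<lambda>r. complex_of_real (r - v)) has_vector_derivative 1) (at r)"
        using has_vector_derivative_of_real[of "\<lambda>r. r - v" 1 "at r"] by (auto intro!: derivative_eq_intros)
      have "((\<lambda>r. of_real (r - v) * nderiv (k + 1) \<phi> r - nderiv k \<phi> r) has_vector_derivative
        (of_real (r - v) * nderiv (Suc (k + 1)) \<phi> r + 1 * nderiv (k + 1) \<phi> r) - nderiv (Suc k) \<phi> r) (at r)"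
        by (intro has_vector_derivative_diff has_vector_derivative_mult 1 smooth_nderiv_D[OF sm])
      then have "(?F has_vector_derivative
        (of_real (r - v) * nderiv (Suc (k + 1)) \<phi> r + 1 * nderiv (k + 1) \<phi> r) - nderiv (Suc k) \<phi> r) (at r)"
        by (rule has_vector_derivative_transform_within_open[of _ _ _ "{v<..}"]) (use rv in auto)
      moreover have "(of_real (r - v) * nderiv (Suc (k + 1)) \<phi> r + 1 * nderiv (k + 1) \<phi> r) - nderiv (Suc k) \<phi> r
        = nderiv (k + 2) \<phi> r * of_real (tpow 1 (min r \<tau>) v)"
        using z[of r "k + 2"] rv by (cases "r \<le> \<tau>") (simp_all add: tpow_def)
      ultimately show ?thesis by (rule has_vector_derivative_eq_rhs)
    qed
  qed (use assms tau in auto)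
  then have "integral {0..b} (\<lambda>r. nderiv (k + 2) \<phi> r * of_real (tpow 1 (min r \<tau>) v)) = ?F b - ?F 0"
    by (rule integral_unique)
  also have "\<dots> = nderiv k \<phi> v" using assms(2,3) z[of "max b v" k] z[of "max b v" "k + 1"] by (simp add: le_max_iff_disj)
  finally show ?thesis .
qed

lemma S_represents_G:
  assumes \<phi>: "\<phi> \<in> test_functions_on {-\<tau><..<\<tau>}" and x: "x \<in> TS"
  shows "\<exists>I. has_lcs_integral_at_top s X (\<lambda>r. s (nderiv (k + 2) \<phi> r) (S r x)) 0 I \<and> G \<phi> x = s ((-1) ^ (k + 2)) I"
proof -
  have sm: "smooth \<phi>" by (rule test_functions_smooth[OF \<phi>])
  have \<phi>M: "\<phi> \<in> DM" using M_bounds by (intro test_functions_on_mono[OF \<phi>]) auto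
  let ?Y = "\<lambda>b v. integral {0..b} (\<lambda>r. nderiv (k + 2) \<phi> r * of_real (tpow 1 (min r \<tau>) v))"
  have "\<forall>b. \<exists>l. rep x (?Y b) l \<and> has_lcs_integral s X (\<lambda>r. s (nderiv (k + 2) \<phi> r) (S r x)) 0 b l"
    using S_weighted_integral[OF x smooth_nderiv_continuous[OF sm]] by blast
  from choice[OF this] obtain J where J': "\<forall>b. rep x (?Y b) (J b) \<and> has_lcs_integral s X (\<lambda>r. s (nderiv (k + 2) \<phi> r) (S r x)) 0 b (J b)" ..
  then have J: "\<And>b. rep x (?Y b) (J b)" "\<And>b. has_lcs_integral s X (\<lambda>r. s (nderiv (k + 2) \<phi> r) (S r x)) 0 b (J b)" by blast+
  let ?I = "s ((-1) ^ k) (G \<phi> x)"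
  have IT: "?I \<in> TS" using G_T[OF test_functions_on_test[OF \<phi>] x] by (rule TS_scale)
  have Jb: "J b = ?I" if "b \<ge> \<tau>" for b
  proof (rule rep_unique[OF x])
    show "rep x (nderiv k \<phi>) (J b)"
      by (rule rep_cong[OF J(1)]) (use nderiv_integral_formula[OF \<phi> that] in auto)
    show "rep x (nderiv k \<phi>) ?I"
      by (rule rep_cong[OF rep_cmult[OF x rep_test[OF \<phi>M x]]]) simp
  qed
  have ev: "eventually (\<lambda>b. ?I = J b) at_top"
    by (rule eventually_at_top_linorderI[of \<tau>]) (rule Jb[symmetric])
  have "limitin X (\<lambda>b. ?I) ?I at_top" using IT by (simp add: limitin_def)
  then have "limitin X J ?I at_top" using ev by (rule limitin_transform_eventually[rotated])
  moreover have "G \<phi> x = s ((-1) ^ (k + 2)) ?I" by simp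
  ultimately show ?thesis using J(2) unfolding has_lcs_integral_at_top_def by blast
qed

end


section \<open>Existence family, semigroup law and kernel space\<close>

lemma gfun_nat: "w \<ge> 0 \<Longrightarrow> n \<ge> 1 \<Longrightarrow> gfun (real (Suc n)) w = w ^ n / fact n"
  unfolding gfun_def using Gamma_fact[of n, where 'a = real] powr_realpow'[of w n] by simp

context finite_order_cds
begin

text \<open>
  For \<open>\<phi>\<close> supported in \<open>[0, \<infinity>)\<close> one has \<open>\<phi> 0 = 0\<close>, and partial integration in the convolution leaves the single
  boundary term \<open>\<theta> 0 \<phi>\<close>. In other words, \<open>(G \<theta> x, - G \<theta>' x - \<theta> 0 C x)\<close> belongs to the generator.
\<close>

lemma generator_test:
  assumes \<theta>: "\<theta> \<in> test_functions" and \<phi>: "\<phi> \<in> test_functions_on {0..}" and x: "x \<in> TS"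
  shows "G (vderiv \<phi>) (G \<theta> x) = G \<phi> (G (vderiv \<theta>) x) + s (\<theta> 0) (G \<phi> (C x))"
proof -
  have \<phi>T: "\<phi> \<in> test_functions" "vderiv \<phi> \<in> test_functions" "vderiv \<theta> \<in> test_functions"
    using test_functions_on_test[OF \<phi>] test_functions_on_test[OF test_functions_on_vderiv[OF \<phi>]]
      test_functions_on_vderiv[of \<theta> UNIV] \<theta> by (simp_all add: test_functions_on_UNIV)
  have c: "conv0 \<phi> (vderiv \<theta>) \<in> test_functions" by (rule conv0_test_functions[OF \<phi>T(1,3)])
  have m: "(\<lambda>v. \<theta> 0 * \<phi> v) \<in> test_functions"
    using test_functions_on_cmult[OF \<phi>] test_functions_on_test by blast
  have "G (vderiv \<phi>) (G \<theta> x) = G (conv0 (vderiv \<phi>) \<theta>) (C x)" by (rule G_conv[OF \<phi>T(2) \<theta>, symmetric])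
  also have "conv0 (vderiv \<phi>) \<theta> = (\<lambda>v. conv0 \<phi> (vderiv \<theta>) v + \<theta> 0 * \<phi> v)"
    using conv0_parts[of \<phi> \<theta>] test_function_on_nonneg_at_0[OF \<phi>] \<phi>T(1) \<theta>
    by (auto simp: test_functions_iff)
  also have "G \<dots> (C x) = G (conv0 \<phi> (vderiv \<theta>)) (C x) + s (\<theta> 0) (G \<phi> (C x))"
    by (simp add: G_add[OF c m] G_cmult[OF \<phi>T(1)])
  also have "G (conv0 \<phi> (vderiv \<theta>)) (C x) = G \<phi> (G (vderiv \<theta>) x)" by (rule G_conv[OF \<phi>T(1,3)])
  finally show ?thesis .
qed

text \<open>
  The pairs provided by \<open>generator_test\<close> for test functions \<open>\<theta>\<close> approaching \<open>(t - v)\<^sub>+\<^sup>k\<^sup>+\<^sup>2 / (k + 2)!\<close> converge in both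
  components, and the generator is closed: its defining equations only involve continuous operators.
  All \<open>\<phi>\<close> are covered, whatever their support, since no estimate for \<open>G \<phi>\<close> beyond continuity of
  this operator is used.
\<close>

lemma S_existence:
  assumes x: "x \<in> TS" and t: "0 \<le> t" "t < \<tau>"
  shows "\<exists>I. has_lcs_integral s X (\<lambda>r. S r x) 0 t I \<and>
    (I, S t x - s (of_real (gfun (real (k + 2) + 1) t)) (C x)) \<in> generator X G"
proof -
  obtain l where l: "rep x (\<lambda>v. integral {0..t} (\<lambda>r. 1 * of_real (tpow 1 (min r \<tau>) v))) l"
    "has_lcs_integral s X (\<lambda>r. s 1 (S r x)) 0 t l"
    using S_weighted_integral[OF x continuous_on_const, of 0 t 1] by blast
  have l2: "rep x (\<lambda>v. of_real (tpow 2 t v)) l"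
  proof (rule rep_cong[OF l(1)])
    fix v assume v: "v \<in> {0..M}"
    have "((\<lambda>r. tpow 1 (min r \<tau>) v) has_integral (tpow 2 t v - tpow 2 0 v)) {0..t}"
    proof (rule fundamental_theorem_of_calculus)
      fix r assume r: "r \<in> {0..t}"
      have "((\<lambda>r. r - v) has_real_derivative 1) (at r)" by (auto intro!: derivative_eq_intros)
      from DERIV_cdivide[OF DERIV_chain2[OF pos_part_power_deriv[of 1] this], of 2]
      have "((\<lambda>r. tpow 2 r v) has_real_derivative tpow 1 (min r \<tau>) v) (at r)"
        using r t by (simp add: tpow_def power2_eq_square)
      then show "((\<lambda>r. tpow 2 r v) has_vector_derivative tpow 1 (min r \<tau>) v) (at r within {0..t})"
        by (simp add: has_real_derivative_iff_has_vector_derivative has_vector_derivative_at_within)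
    qed (rule t)
    then have "((\<lambda>r. complex_of_real (tpow 1 (min r \<tau>) v)) has_integral complex_of_real (tpow 2 t v - tpow 2 0 v)) {0..t}"
      by (rule has_integral_of_real)
    moreover have "tpow 2 0 v = 0" using v by (simp add: tpow_def)
    ultimately have "((\<lambda>r. complex_of_real (tpow 1 (min r \<tau>) v)) has_integral of_real (tpow 2 t v)) {0..t}" by simp
    then show "integral {0..t} (\<lambda>r. 1 * complex_of_real (tpow 1 (min r \<tau>) v)) = of_real (tpow 2 t v)"
      by (simp add: integral_unique)
  qed
  define \<theta> where "\<theta> j = power_test M (k + 1) t j" for j
  have \<theta>M: "\<theta> j \<in> DM" for j unfolding \<theta>_def by (rule power_test_DM) (use t in simp)
  have \<theta>T: "\<theta> j \<in> test_functions" and \<theta>s: "smooth (\<theta> j)" for j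
    using test_functions_on_test[OF \<theta>M] test_functions_smooth[OF \<theta>M] by auto
  have dM: "vderiv (\<theta> j) \<in> DM" for j by (rule test_functions_on_vderiv[OF \<theta>M])
  have tM: "0 \<le> t" "t \<le> M" using t M_bounds by auto
  have uni: "eventually (\<lambda>n. \<forall>v\<in>{0..M}. cmod ((prim M ^^ m) (approx t n) v - of_real (tpow (Suc m) t v)) \<le> e) sequentially"
    if "e > 0" for e m
    using uniform_limitD[OF uniform_limit_prim_pow_approx[OF tM, of m] that]
    by eventually_elim (use M_bounds in \<open>auto simp: dist_norm less_imp_le\<close>)
  have lim1: "limitin X (\<lambda>j. G (\<theta> j) x) l sequentially"
  proof (rule rep_tendsto[OF x l2])
    show "rep x ((prim M ^^ 1) (approx t j)) (G (\<theta> j) x)" for j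
      by (rule rep_cong[OF rep_test[OF \<theta>M x]]) (simp add: \<theta>_def nderiv_power_test)
  qed (use uni[of _ 1] in \<open>simp add: numeral_2_eq_2\<close>)
  have lim2: "limitin X (\<lambda>j. s (-1) (G (vderiv (\<theta> j)) x)) (S t x) sequentially"
  proof (rule rep_tendsto[OF x S_rep[OF x]])
    show "rep x (approx t j) (s (-1) (G (vderiv (\<theta> j)) x))" for j
    proof (rule rep_cong[OF rep_cmult[OF x rep_test[OF dM x]]])
      fix v assume v: "v \<in> {0..M}"
      have "nderiv k (vderiv (\<theta> j)) v = nderiv (k + 1) (\<theta> j) v" by (simp add: nderiv_Suc_right del: funpow.simps)
      also have "\<dots> = (-1) ^ (k + 1) * approx t j v" using v nderiv_power_test[of v "k + 1" "k + 1" M t j] by (simp add: \<theta>_def)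
      finally show "-1 * ((-1) ^ k * nderiv k (vderiv (\<theta> j)) v) = approx t j v" by simp
    qed
  qed (use uni[of _ 0] t in simp)
  have lim3: "(\<lambda>j. \<theta> j 0) \<longlonglongrightarrow> of_real (tpow (k + 2) t 0)"
  proof -
    have "(\<lambda>j. (prim M ^^ (k + 1)) (approx t j) 0) \<longlonglongrightarrow> of_real (tpow (Suc (k + 1)) t 0)"
      by (rule tendsto_uniform_limitI[OF uniform_limit_prim_pow_approx[OF tM]]) (use M_bounds in simp)
    then show ?thesis by (simp add: \<theta>_def power_test_def cut_1)
  qed
  have Cx: "C x \<in> TS" by (rule end_opsD(1)[OF C_op x])
  have gf: "gfun (real (k + 2) + 1) t = tpow (k + 2) t 0"
    using gfun_nat[of t "k + 2"] t by (simp add: tpow_def add.commute)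
  let ?y = "S t x - s (of_real (gfun (real (k + 2) + 1) t)) (C x)"
  have lim4: "limitin X (\<lambda>j. s (-1) (G (vderiv (\<theta> j)) x) - s (\<theta> j 0) (C x)) ?y sequentially"
    unfolding gf by (rule limitin_minus[OF lim2 limitin_scalar[OF lim3 Cx]])
  have lT: "l \<in> TS" by (rule limitin_topspace[OF lim1])
  have yT: "?y \<in> TS" by (rule limitin_topspace[OF lim4])
  have gen: "G (- vderiv \<phi>) l = G \<phi> ?y" if \<phi>: "\<phi> \<in> test_functions_on {0..}" for \<phi>
  proof -
    have \<phi>T: "\<phi> \<in> test_functions" "vderiv \<phi> \<in> test_functions"
      using test_functions_on_test[OF \<phi>] test_functions_on_test[OF test_functions_on_vderiv[OF \<phi>]] by auto
    have neg: "G (- vderiv \<phi>) z = s (-1) (G (vderiv \<phi>) z)" for z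
      using G_cmult[OF \<phi>T(2), of "-1" z] by (simp add: fun_Compl_def)
    show ?thesis
    proof (rule seq_unique)
      show "limitin X (\<lambda>j. G (- vderiv \<phi>) (G (\<theta> j) x)) (G (- vderiv \<phi>) l) sequentially"
        unfolding neg by (intro limitin_scale limitin_op[OF G_op[OF \<phi>T(2)]] lim1)
      have "G \<phi> (s (-1) (G (vderiv (\<theta> j)) x) - s (\<theta> j 0) (C x)) = G (- vderiv \<phi>) (G (\<theta> j) x)" for j
      proof -
        have \<theta>x: "G (vderiv (\<theta> j)) x \<in> TS" by (rule G_T[OF test_functions_on_test[OF dM] x])
        note lin = end_opsD[OF G_op[OF \<phi>T(1)]]
        have "G \<phi> (s (-1) (G (vderiv (\<theta> j)) x) - s (\<theta> j 0) (C x))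
          = s (-1) (G \<phi> (G (vderiv (\<theta> j)) x)) - s (\<theta> j 0) (G \<phi> (C x))"
          unfolding lin(5)[OF TS_scale[OF \<theta>x] TS_scale[OF Cx]] lin(3)[OF \<theta>x] lin(3)[OF Cx] ..
        also have "\<dots> = s (-1) (G (vderiv \<phi>) (G (\<theta> j) x))"
          unfolding generator_test[OF \<theta>T \<phi> x] by simp
        finally show ?thesis by (simp only: neg)
      qed
      then show "limitin X (\<lambda>j. G (- vderiv \<phi>) (G (\<theta> j) x)) (G \<phi> ?y) sequentially"
        using limitin_op[OF G_op[OF \<phi>T(1)] lim4] by simp
    qed
  qed
  have "(l, ?y) \<in> generator X G"
    unfolding generator_def using lT yT gen by simp
  then show ?thesis using l(2) by auto
qed

lemma generator_mlo: "mlo s X (generator X G)"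
proof -
  have op: "G (- vderiv \<phi>) \<in> end_ops s X" "G \<phi> \<in> end_ops s X" if "\<phi> \<in> test_functions_on {0..}" for \<phi>
  proof -
    show "G \<phi> \<in> end_ops s X" using test_functions_on_test[OF that] by (rule G_op)
    have "- vderiv \<phi> = (\<lambda>v. -1 * vderiv \<phi> v)" by (simp add: fun_Compl_def)
    then show "G (- vderiv \<phi>) \<in> end_ops s X"
      using test_functions_on_cmult[OF test_functions_on_vderiv[OF that], of "-1"] test_functions_on_test
      by (metis G_op)
  qed
  show ?thesis
    unfolding mlo_def
  proof (intro conjI allI)
    show "generator X G \<subseteq> TS \<times> TS" by (auto simp: generator_def)
    show "(0, 0) \<in> generator X G" using end_opsD(4)[OF op(1)] end_opsD(4)[OF op(2)] TS_0 by (simp add: generator_def)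
    show "\<forall>(x, y)\<in>generator X G. \<forall>(x', y')\<in>generator X G. (x + x', y + y') \<in> generator X G"
      by (auto simp: generator_def TS_add end_opsD(2)[OF op(1)] end_opsD(2)[OF op(2)])
    show "\<forall>(x, y)\<in>generator X G. (s c x, s c y) \<in> generator X G" for c
      by (auto simp: generator_def TS_scale end_opsD(3)[OF op(1)] end_opsD(3)[OF op(2)])
  qed
qed

lemma S_existence_family: "integrated_C_existence_family s X C (real (k + 2)) (ereal \<tau>) S (generator X G)"
  unfolding integrated_C_existence_family_def
proof (intro conjI ballI allI impI)
  fix x t assume "x \<in> TS" "0 \<le> t \<and> ereal t < ereal \<tau>"
  then show "\<exists>I. has_lcs_integral s X (\<lambda>r. S r x) 0 t I \<and> I \<in> Domain (generator X G) \<and>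
      (I, S t x - s (of_real (gfun (real (k + 2) + 1) t)) (C x)) \<in> generator X G"
    using S_existence[of x t] by auto
qed (use tau S_strongly_continuous generator_mlo in auto)

text \<open>
  The operators \<open>G (power_test M k t j)\<close> are equicontinuous in \<open>j\<close>, so both limits may be taken along the same index.
\<close>

lemma S_product_limit:
  assumes x: "x \<in> TS" and t: "0 \<le> t" "t \<le> \<tau>" and u: "u \<le> \<tau>"
  shows "limitin X (\<lambda>j. G (power_test M k t j) (G (power_test M k u j) x)) (S t (S u x)) sequentially"
  unfolding limitin_seminorm
proof (intro conjI allI impI)
  let ?\<phi> = "\<lambda>j. power_test M k t j" and ?\<psi> = "\<lambda>j. power_test M k u j"
  have op: "G (?\<phi> j) \<in> end_ops s X" for j by (rule G_op[OF power_test_test_function[OF t(2)]])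
  have \<psi>x: "G (?\<psi> j) x \<in> TS" for j by (rule G_T[OF power_test_test_function[OF u] x])
  have Sx: "S u x \<in> TS" by (rule S_T[OF x])
  show "S t (S u x) \<in> TS" by (rule S_T[OF Sx])
  show "eventually (\<lambda>j. G (?\<phi> j) (G (?\<psi> j) x) \<in> TS) sequentially"
    using end_opsD(1)[OF op \<psi>x] by simp
  fix p and e :: real assume p: "cseminorm s X p" and e: "e > 0"
  obtain q where q: "cseminorm s X q" "\<forall>x\<in>TS. \<forall>y l c. rep x y l \<longrightarrow> (\<forall>v\<in>{0..M}. cmod (y v) \<le> c) \<longrightarrow> p l \<le> c * q x"
    using rep_bound[OF p] by blast
  have bd: "p (G (?\<phi> j) z) \<le> (\<tau> + 1) * q z" if z: "z \<in> TS" for j z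
  proof (rule q(2)[rule_format, OF z power_test_rep[OF z t(2)]])
    fix v assume v: "v \<in> {0..M}"
    have "cmod (approx t j v) \<le> cmod (of_real (tpow 1 t v)) + cmod (approx t j v - of_real (tpow 1 t v))"
      by (rule norm_triangle_sub)
    also have "cmod (of_real (tpow 1 t v)) \<le> \<tau>" unfolding norm_of_real using t v tau by (simp add: tpow_def)
    also have "cmod (approx t j v - of_real (tpow 1 t v)) \<le> 1"
      by (rule order_trans[OF approx_error]) simp
    finally show "cmod (approx t j v) \<le> \<tau> + 1" by simp
  qed
  have d: "e / (2 * (\<tau> + 1)) > 0" using e tau by simp
  have "limitin X (\<lambda>j. G (?\<psi> j) x) (S u x) sequentially" using G_power_test_S[OF x, of u] u by (simp add: min_absorb1)
  then have e1: "eventually (\<lambda>j. q (G (?\<psi> j) x - S u x) < e / (2 * (\<tau> + 1))) sequentially"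
    using q(1) d by (simp add: limitin_seminorm)
  have "limitin X (\<lambda>j. G (?\<phi> j) (S u x)) (S t (S u x)) sequentially" using G_power_test_S[OF Sx, of t] t by (simp add: min_absorb1)
  then have e2: "eventually (\<lambda>j. p (G (?\<phi> j) (S u x) - S t (S u x)) < e / 2) sequentially"
    using p half_gt_zero[OF e] unfolding limitin_seminorm by blast
  show "eventually (\<lambda>j. p (G (?\<phi> j) (G (?\<psi> j) x) - S t (S u x)) < e) sequentially"
    using e1 e2
  proof eventually_elim
    case (elim j)
    have "p (G (?\<phi> j) (G (?\<psi> j) x - S u x)) \<le> (\<tau> + 1) * q (G (?\<psi> j) x - S u x)"
      by (rule bd[OF TS_diff[OF \<psi>x Sx]])
    also have "\<dots> \<le> (\<tau> + 1) * (e / (2 * (\<tau> + 1)))" using elim(1) tau by (intro mult_left_mono) auto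
    also have "\<dots> = e / 2" using tau by (simp add: divide_eq_eq algebra_simps)
    finally have 1: "p (G (?\<phi> j) (G (?\<psi> j) x) - G (?\<phi> j) (S u x)) \<le> e / 2"
      by (simp add: end_opsD(5)[OF op \<psi>x Sx])
    have "p ((G (?\<phi> j) (G (?\<psi> j) x) - G (?\<phi> j) (S u x)) + (G (?\<phi> j) (S u x) - S t (S u x)))
      \<le> p (G (?\<phi> j) (G (?\<psi> j) x) - G (?\<phi> j) (S u x)) + p (G (?\<phi> j) (S u x) - S t (S u x))"
      by (intro cseminormD(1)[OF p] TS_diff end_opsD(1)[OF op \<psi>x] end_opsD(1)[OF op Sx] S_T[OF Sx])
    then show ?case using 1 elim(2) by simp
  qed
qed

text \<open>
  By \<open>nderiv_conv0\<close>, this is \<open>(-1)\<^sup>k\<close> times the \<open>k\<close>-th derivative of the convolution of the truncated powers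
  \<open>(t - v)\<^sub>+\<^sup>k\<^sup>+\<^sup>1 / (k + 1)!\<close> and \<open>(u - v)\<^sub>+\<^sup>k\<^sup>+\<^sup>1 / (k + 1)!\<close>, written without derivatives.
\<close>

definition kernel_limit :: "real \<Rightarrow> real \<Rightarrow> real \<Rightarrow> complex" where
  "kernel_limit t u v = conv0 (\<lambda>v. of_real (tpow 1 t v)) (\<lambda>v. of_real (tpow (k + 1) u v)) v
      - (\<Sum>l<k. of_real (tpow (k + 1 - l) t 0) * of_real (tpow (l + 2) u v))"

text \<open>
  The formula for the \<open>k\<close>-th derivative of a convolution involves derivatives of order at most \<open>k\<close> of the first
  factor and less than \<open>k\<close> of the second, and all of these converge uniformly on \<open>[0, M]\<close>.
\<close>

lemma uniform_limit_conv0_power_test: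
  assumes t: "0 \<le> t" "t \<le> \<tau>" and u: "0 \<le> u" "u \<le> \<tau>"
  shows "uniform_limit {0..M} (\<lambda>j v. (-1) ^ k * nderiv k (conv0 (power_test M k t j) (power_test M k u j)) v)
    (kernel_limit t u) sequentially"
proof -
  let ?\<phi> = "\<lambda>j. power_test M k t j" and ?\<psi> = "\<lambda>j. power_test M k u j"
  have sm: "smooth (?\<phi> j)" "smooth (?\<psi> j)" for j
    using test_functions_smooth[OF power_test_DM] t u by blast+
  have tM: "t \<le> M" "u \<le> M" using t u M_bounds by auto
  have U: "uniform_limit {0..M} (\<lambda>j. (prim M ^^ m) (approx w j)) (\<lambda>v. of_real (tpow (Suc m) w v)) sequentially"
    if "0 \<le> w" "w \<le> M" for m w
    by (rule uniform_limit_on_subset[OF uniform_limit_prim_pow_approx[OF that]]) (use M_bounds in auto)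
  have cont: "continuous_on UNIV (\<lambda>v. complex_of_real (tpow m w v))" for m w
    by (intro continuous_intros continuous_tpow)
  have bnd: "bounded ((\<lambda>v. complex_of_real (tpow m w v)) ` {0..M})" for m w
    by (rule compact_imp_bounded[OF compact_continuous_image[OF continuous_on_subset[OF cont subset_UNIV] compact_Icc]])
  have f: "uniform_limit {0..M} (\<lambda>j v. (-1) ^ k * nderiv k (?\<phi> j) v) (\<lambda>v. of_real (tpow 1 t v)) sequentially"
    by (rule uniform_limit_cong'[THEN iffD1, OF _ _ U[OF t(1) tM(1), of 0]]) (auto simp: nderiv_power_test)
  have g: "uniform_limit {0..M} ?\<psi> (\<lambda>v. of_real (tpow (k + 1) u v)) sequentially"
    by (rule uniform_limit_cong'[THEN iffD1, OF _ _ U[OF u(1) tM(2), of k]]) (auto simp: power_test_def cut_1)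
  have conv: "uniform_limit {0..M} (\<lambda>j. conv0 (\<lambda>v. (-1) ^ k * nderiv k (?\<phi> j) v) (?\<psi> j))
      (conv0 (\<lambda>v. of_real (tpow 1 t v)) (\<lambda>v. of_real (tpow (k + 1) u v))) sequentially"
    by (rule uniform_limit_conv0[OF _ cont _ cont f g])
       (intro continuous_intros smooth_nderiv_continuous smooth_continuous sm)+
  have tm: "uniform_limit {0..M} (\<lambda>j v. (prim M ^^ (k - l)) (approx t j) 0 * (prim M ^^ (l + 1)) (approx u j) v)
      (\<lambda>v. of_real (tpow (Suc (k - l)) t 0) * of_real (tpow (Suc (l + 1)) u v)) sequentially" for l
  proof (rule uniform_lim_mult)
    have "(\<lambda>j. (prim M ^^ (k - l)) (approx t j) 0) \<longlonglongrightarrow> of_real (tpow (Suc (k - l)) t 0)"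
      by (rule tendsto_uniform_limitI[OF U[OF t(1) tM(1)]]) (use M_bounds in simp)
    then show "uniform_limit {0..M} (\<lambda>j v. (prim M ^^ (k - l)) (approx t j) 0) (\<lambda>v. of_real (tpow (Suc (k - l)) t 0)) sequentially"
      by (auto intro!: uniform_limitI dest: tendstoD elim: eventually_mono)
    show "uniform_limit {0..M} (\<lambda>j. (prim M ^^ (l + 1)) (approx u j)) (\<lambda>v. of_real (tpow (Suc (l + 1)) u v)) sequentially"
      by (rule U[OF u(1) tM(2)])
    show "bounded ((\<lambda>v. complex_of_real (tpow (Suc (k - l)) t 0)) ` {0..M})"
      by (rule finite_imp_bounded) (rule finite_subset[of _ "{complex_of_real (tpow (Suc (k - l)) t 0)}"], auto)
  qed (rule bnd)
  have sums: "uniform_limit {0..M} (\<lambda>j v. \<Sum>l<n. (prim M ^^ (k - l)) (approx t j) 0 * (prim M ^^ (l + 1)) (approx u j) v)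
      (\<lambda>v. \<Sum>l<n. of_real (tpow (Suc (k - l)) t 0) * of_real (tpow (Suc (l + 1)) u v)) sequentially" for n
  proof (induction n)
    case (Suc n)
    from uniform_limit_add[OF Suc tm[of n]] show ?case by simp
  qed (simp add: uniform_limit_const)
  have eq: "conv0 (\<lambda>v. (-1) ^ k * nderiv k (?\<phi> j) v) (?\<psi> j) v
      - (\<Sum>l<k. (prim M ^^ (k - l)) (approx t j) 0 * (prim M ^^ (l + 1)) (approx u j) v)
      = (-1) ^ k * nderiv k (conv0 (?\<phi> j) (?\<psi> j)) v" if v: "v \<in> {0..M}" for j v
  proof -
    have "(-1) ^ k * (nderiv l (?\<phi> j) 0 * nderiv (k - 1 - l) (?\<psi> j) v)
        = - ((prim M ^^ (k - l)) (approx t j) 0 * (prim M ^^ (l + 1)) (approx u j) v)" if l: "l < k" for l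
    proof -
      have "k - (k - 1 - l) = l + 1" using l by simp
      then have e1: "nderiv (k - 1 - l) (?\<psi> j) v = (-1) ^ (k - 1 - l) * (prim M ^^ (l + 1)) (approx u j) v"
        using nderiv_power_test[of v "k - 1 - l" k M u j] v by simp
      have e2: "nderiv l (?\<phi> j) 0 = (-1) ^ l * (prim M ^^ (k - l)) (approx t j) 0"
        using nderiv_power_test[of 0 l k M t j] l by simp
      have e3: "(-1) ^ k * ((-1) ^ l * (-1) ^ (k - 1 - l)) = (-1 :: complex)"
      proof -
        have "(-1) ^ k * ((-1) ^ l * (-1) ^ (k - 1 - l)) = (-1 :: complex) ^ (k + (l + (k - 1 - l)))"
          by (simp only: power_add)
        also have "k + (l + (k - 1 - l)) = Suc (2 * (k - 1))" using l by simp
        finally show ?thesis by simp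
      qed
      have "(-1) ^ k * (nderiv l (?\<phi> j) 0 * nderiv (k - 1 - l) (?\<psi> j) v)
        = ((-1) ^ k * ((-1) ^ l * (-1) ^ (k - 1 - l))) * ((prim M ^^ (k - l)) (approx t j) 0 * (prim M ^^ (l + 1)) (approx u j) v)"
        unfolding e1 e2 by (simp only: mult_ac)
      then show ?thesis unfolding e3 by simp
    qed
    then have "(\<Sum>l<k. (-1) ^ k * (nderiv l (?\<phi> j) 0 * nderiv (k - 1 - l) (?\<psi> j) v))
      = (\<Sum>l<k. - ((prim M ^^ (k - l)) (approx t j) 0 * (prim M ^^ (l + 1)) (approx u j) v))"
      by (intro sum.cong) auto
    then show ?thesis
      by (simp only: nderiv_conv0[OF sm] distrib_left sum_distrib_left sum_negf
          conv0_cmult[OF smooth_nderiv_continuous[OF sm(1)] smooth_continuous[OF sm(2)]]) simp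
  qed
  have lim: "kernel_limit t u v = conv0 (\<lambda>v. of_real (tpow 1 t v)) (\<lambda>v. of_real (tpow (k + 1) u v)) v
     - (\<Sum>l<k. of_real (tpow (Suc (k - l)) t 0) * of_real (tpow (Suc (l + 1)) u v))" for v
    unfolding kernel_limit_def by (intro arg_cong2[of _ _ _ _ minus] refl sum.cong) (auto simp: Suc_diff_le)
  show ?thesis
    by (rule uniform_limit_cong'[THEN iffD1, OF _ _ uniform_limit_minus[OF conv sums[of k]]]) (use eq lim in auto)
qed

text \<open>
  Both sides are the value at the same function \<open>kernel_limit t u\<close>, the left one as a limit of
  \<open>G \<phi> (G \<psi> x)\<close> and the right one by \<open>rep_integral\<close>. The vector in question is \<open>C x\<close>, as in the convolution
  equation for \<open>G\<close>.
\<close>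

lemma S_semigroup:
  assumes x: "x \<in> TS" and t: "0 \<le> t" and u: "0 \<le> u" and tu: "t + u < \<tau>"
  shows "\<exists>I1 I2 I3. has_lcs_integral s X (\<lambda>r. s (of_real (gfun (real (k + 2)) (t + u - r))) (S r (C x))) 0 (t + u) I1 \<and>
    has_lcs_integral s X (\<lambda>r. s (of_real (gfun (real (k + 2)) (t + u - r))) (S r (C x))) 0 t I2 \<and>
    has_lcs_integral s X (\<lambda>r. s (of_real (gfun (real (k + 2)) (t + u - r))) (S r (C x))) 0 u I3 \<and>
    S t (S u x) = I1 - I2 - I3"
proof -
  have Cx: "C x \<in> TS" by (rule end_opsD(1)[OF C_op x])
  let ?g = "\<lambda>r. complex_of_real ((t + u - r) ^ (k + 1) / fact (k + 1))"
  let ?h = "\<lambda>r. s (of_real (gfun (real (k + 2)) (t + u - r))) (S r (C x))"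
  let ?P = "\<lambda>v. kernel_prim k (t + u) v"
  have I: "\<exists>l. rep (C x) (\<lambda>v. of_real (?P v a - ?P v 0)) l \<and> has_lcs_integral s X ?h 0 a l" if a: "0 \<le> a" "a \<le> t + u" for a
  proof -
    have c: "continuous_on {0..a} ?g" by (intro continuous_intros) auto
    obtain l where l: "rep (C x) (\<lambda>v. integral {0..a} (\<lambda>r. ?g r * of_real (tpow 1 (min r \<tau>) v))) l"
      "has_lcs_integral s X (\<lambda>r. s (?g r) (S r (C x))) 0 a l"
      using S_weighted_integral[OF Cx c] by blast
    have "rep (C x) (\<lambda>v. of_real (?P v a - ?P v 0)) l"
    proof (rule rep_cong[OF l(1)])
      fix v
      have "((\<lambda>r. complex_of_real ((t + u - r) ^ (k + 1) / fact (k + 1) * tpow 1 r v)) has_integral of_real (?P v a - ?P v 0)) {0..a}"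
        by (rule has_integral_of_real[OF kernel_prim_integral[OF a(1)]])
      then have "((\<lambda>r. ?g r * of_real (tpow 1 (min r \<tau>) v)) has_integral of_real (?P v a - ?P v 0)) {0..a}"
        by (rule has_integral_eq[rotated]) (use a tu in \<open>simp add: min_absorb1\<close>)
      then show "integral {0..a} (\<lambda>r. ?g r * of_real (tpow 1 (min r \<tau>) v)) = of_real (?P v a - ?P v 0)"
        by (rule integral_unique)
    qed
    moreover have "has_lcs_integral s X ?h 0 a l"
    proof (rule has_lcs_integral_cong[OF l(2)])
      fix r assume "r \<in> {0..a}"
      then have "gfun (real (k + 2)) (t + u - r) = (t + u - r) ^ (k + 1) / fact (k + 1)"
        using gfun_nat[of "t + u - r" "k + 1"] a by simp
      then show "s (?g r) (S r (C x)) = ?h r" by simp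
    qed
    ultimately show ?thesis by blast
  qed
  obtain I1 where I1: "rep (C x) (\<lambda>v. of_real (?P v (t + u) - ?P v 0)) I1" "has_lcs_integral s X ?h 0 (t + u) I1"
    using I[of "t + u"] t u by auto
  obtain I2 where I2: "rep (C x) (\<lambda>v. of_real (?P v t - ?P v 0)) I2" "has_lcs_integral s X ?h 0 t I2"
    using I[of t] t u by auto
  obtain I3 where I3: "rep (C x) (\<lambda>v. of_real (?P v u - ?P v 0)) I3" "has_lcs_integral s X ?h 0 u I3"
    using I[of u] t u by auto
  have rI: "rep (C x) (kernel_limit t u) (I1 - I2 - I3)"
  proof (rule rep_cong[OF rep_diff[OF Cx rep_diff[OF Cx I1(1) I2(1)] I3(1)]])
    fix v assume "v \<in> {0..M}"
    then show "complex_of_real (?P v (t + u) - ?P v 0) - of_real (?P v t - ?P v 0) - of_real (?P v u - ?P v 0) = kernel_limit t u v"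
      unfolding kernel_limit_def using semigroup_kernel_identity[OF t u, of v k] by simp
  qed
  have tu': "t \<le> \<tau>" "u \<le> \<tau>" using t u tu by auto
  have "limitin X (\<lambda>j. G (power_test M k t j) (G (power_test M k u j) x)) (I1 - I2 - I3) sequentially"
  proof (rule rep_tendsto[OF Cx rI])
    fix j
    have f: "power_test M k t j \<in> test_functions" "power_test M k u j \<in> test_functions"
      using power_test_test_function tu' by blast+
    have j: "1 / real (Suc j) \<le> 1" by simp
    have "t + 1 / real (Suc j) \<le> M" "u + 1 / real (Suc j) \<le> M" using tu' j M_def by linarith+
    from conv0_test[OF power_test_test[OF this(1)] power_test_test[OF this(2)], of k k]
    have "conv0 (power_test M k t j) (power_test M k u j) \<in> DM"
    proof (rule test_functions_on_mono)
      have "t + 1 / real (Suc j) + (u + 1 / real (Suc j)) < M" "2 < M" using tu j M_def tau by linarith+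
      then show "{-1 + -1..t + 1 / real (Suc j) + (u + 1 / real (Suc j))} \<subseteq> {-M<..<M}"
        by (auto simp del: of_nat_Suc)
    qed
    from rep_test[OF this Cx] G_conv[OF f, of x]
    show "rep (C x) (\<lambda>v. (-1) ^ k * nderiv k (conv0 (power_test M k t j) (power_test M k u j)) v) (G (power_test M k t j) (G (power_test M k u j) x))"
      by simp
  next
    fix e :: real assume e: "e > 0"
    from uniform_limitD[OF uniform_limit_conv0_power_test[OF t tu'(1) u tu'(2)] e]
    show "eventually (\<lambda>n. \<forall>v\<in>{0..M}. cmod ((-1) ^ k * nderiv k (conv0 (power_test M k t n) (power_test M k u n)) v - kernel_limit t u v) \<le> e) sequentially"
      by eventually_elim (auto simp: dist_norm less_imp_le)
  qed
  then have "S t (S u x) = I1 - I2 - I3" by (rule seq_unique[OF S_product_limit[OF x t tu'(1,2)]])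
  then show ?thesis using I1(2) I2(2) I3(2) by blast
qed

lemma S_integrated_semigroup: "integrated_C_semigroup s X C (real (k + 2)) (ereal \<tau>) S"
  unfolding integrated_C_semigroup_def Let_def
proof (intro conjI ballI allI impI)
  fix x t u assume "x \<in> TS" "0 \<le> t \<and> 0 \<le> u \<and> ereal (t + u) < ereal \<tau>"
  then show "\<exists>I1 I2 I3. has_lcs_integral s X (\<lambda>r. s (of_real (gfun (real (k + 2)) (t + u - r))) (S r (C x))) 0 (t + u) I1 \<and>
    has_lcs_integral s X (\<lambda>r. s (of_real (gfun (real (k + 2)) (t + u - r))) (S r (C x))) 0 t I2 \<and>
    has_lcs_integral s X (\<lambda>r. s (of_real (gfun (real (k + 2)) (t + u - r))) (S r (C x))) 0 u I3 \<and>
    S t (S u x) = I1 - I2 - I3"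
    using S_semigroup[of x t u] by simp
qed (use tau S_strongly_continuous S_C in auto)

text \<open>
  If \<open>S\<close> vanishes at \<open>x\<close>, so does \<open>G \<phi> x\<close> for every \<open>\<phi>\<close> supported in \<open>(-\<tau>, \<tau>)\<close>, and a \<open>\<phi>\<close> whose only nonzero derivative
  at \<open>0\<close> is the \<open>i\<close>-th isolates \<open>T i x\<close>. Conversely, the approximants of \<open>S t x\<close> come from test functions whose
  derivatives of order at least \<open>k + 2\<close> vanish at \<open>0\<close>.
\<close>

lemma S_vanishes_iff:
  assumes x: "x \<in> TS" and m: "m \<ge> k + 1"
    and T: "\<And>\<phi>. \<phi> \<in> test_functions \<Longrightarrow> G \<phi> x = (\<Sum>j\<le>m. s ((-1) ^ j * nderiv j \<phi> 0) (T j x))"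
  shows "(\<forall>t. 0 \<le> t \<and> t < \<tau> \<longrightarrow> S t x = 0) \<longleftrightarrow> (\<forall>i\<le>k + 1. T i x = 0)"
proof safe
  fix i assume S0: "\<forall>t. 0 \<le> t \<and> t < \<tau> \<longrightarrow> S t x = 0" and i: "i \<le> k + 1"
  obtain \<phi> where \<phi>: "\<phi> \<in> test_functions_on {-(\<tau>/2)..\<tau>/2}" "\<And>j. nderiv j \<phi> 0 = (if j = i then 1 else 0)"
    using test_function_with_jet[of "\<tau> / 2" i] tau by auto
  have \<phi>\<tau>: "\<phi> \<in> test_functions_on {-\<tau><..<\<tau>}" by (rule test_functions_on_mono[OF \<phi>(1)]) (use tau in auto)
  obtain I J where I: "\<forall>b\<ge>0. has_lcs_integral s X (\<lambda>r. s (nderiv (k + 2) \<phi> r) (S r x)) 0 b (J b)"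
    "limitin X J I at_top" "G \<phi> x = s ((-1) ^ (k + 2)) I"
    using S_represents_G[OF \<phi>\<tau> x] unfolding has_lcs_integral_at_top_def by blast
  have z: "s (nderiv (k + 2) \<phi> r) (S r x) = 0" if "r \<ge> 0" for r
  proof (cases "r < \<tau>")
    case True then show ?thesis using S0 that by simp
  next
    case False
    then have "nderiv (k + 2) \<phi> r = 0" by (intro nderiv_zero_outside[OF \<phi>\<tau>]) auto
    then show ?thesis by (simp only: scale_zero_left)
  qed
  have J0: "J b = 0" if "b \<ge> 0" for b
  proof -
    have "has_lcs_integral s X (\<lambda>r. 0) 0 b (J b)"
      by (rule has_lcs_integral_cong[OF I(1)[rule_format, OF that]]) (use z in auto)
    then have "limitin X (\<lambda>_. 0) (J b) (division_filter {0..b})" by (simp add: has_lcs_integral_def split_beta)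
    moreover have "limitin X (\<lambda>_. 0) 0 (division_filter {0..b})" using TS_0 by (simp add: limitin_def)
    moreover have "division_filter {0..b} \<noteq> bot" using division_filter_not_empty[of 0 b] by simp
    ultimately show ?thesis by (rule limitin_unique[OF hausdorff])
  qed
  have "eventually (\<lambda>b. J b = 0) at_top" using J0 by (rule eventually_at_top_linorderI)
  then have "limitin X (\<lambda>b::real. 0) I at_top" by (rule limitin_transform_eventually[OF _ I(2)])
  moreover have "limitin X (\<lambda>b. 0) 0 (at_top :: real filter)" using TS_0 by (simp add: limitin_def)
  ultimately have "I = 0" by (rule limitin_unique[OF hausdorff]) simp
  then have "0 = (\<Sum>j\<le>m. s ((-1) ^ j * nderiv j \<phi> 0) (T j x))"
    using I(3) T[OF test_functions_on_test[OF \<phi>(1)]] by simp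
  also have "\<dots> = (\<Sum>j\<le>m. if j = i then s ((-1) ^ i) (T i x) else 0)"
    by (intro sum.cong refl) (simp add: \<phi>(2))
  also have "\<dots> = s ((-1) ^ i) (T i x)" using i m by simp
  finally show "T i x = 0" by (simp add: scale_eq_0_iff)
next
  fix t assume T0: "\<forall>i\<le>k + 1. T i x = 0" and t: "0 \<le> t" "t < \<tau>"
  show "S t x = 0"
  proof (cases "t = 0")
    case True
    have "rep x (\<lambda>v. 0) (S t x)"
      by (rule rep_cong[OF S_rep[OF x]]) (use True tau in \<open>simp add: tpow_def\<close>)
    then show ?thesis using rep_unique[OF x _ rep_zero[OF x]] by blast
  next
    case False
    have "G (power_test M k t j) x = 0" for j
    proof -
      have f: "power_test M k t j \<in> test_functions" using t by (intro power_test_test_function) simp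
      have "s ((-1) ^ i * nderiv i (power_test M k t j) 0) (T i x) = 0" (is "?t i = 0") for i
        using T0 nderiv_power_test_zero[of t k i M j] t False by (cases "i \<le> k + 1") auto
      then show ?thesis unfolding T[OF f] by (intro sum.neutral ballI)
    qed
    moreover have "limitin X (\<lambda>j. G (power_test M k t j) x) (S t x) sequentially"
      using G_power_test_S[OF x, of t] t by (simp add: min_absorb1)
    ultimately have "limitin X (\<lambda>j. 0) (S t x) sequentially" by simp
    moreover have "limitin X (\<lambda>j. 0) 0 sequentially" using TS_0 by (simp add: limitin_def)
    ultimately show ?thesis by (rule seq_unique)
  qed
qed

end

theorem theorem4p6:
  fixes s :: "complex \<Rightarrow> 'e::ab_group_add \<Rightarrow> 'e"
    and E :: "'e topology"
    and C :: "'e \<Rightarrow> 'e"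
    and G :: "(real \<Rightarrow> complex) \<Rightarrow> 'e \<Rightarrow> 'e"
    and \<A> :: "('e \<times> 'e) set"
  assumes "complex_lcs s E" and "barreled s E" and "Hausdorff_space E" and "seq_complete E"
    and "C \<in> end_ops s E"
    and "pre_CDS s E C G"
    and "\<A> = generator E G"
    and "finite_order (fscale s) (op_space s E) G"
  shows "\<forall>\<tau>::real. \<tau> > 0 \<longrightarrow> (\<exists>(n::nat) S. n \<ge> 1 \<and>
     integrated_C_semigroup s E C (real n) (ereal \<tau>) S \<and>
     (\<forall>\<phi>\<in>test_functions_on {-\<tau><..<\<tau>}. \<forall>x\<in>topspace E.
        \<exists>I. has_lcs_integral_at_top s E (\<lambda>r. s (nderiv n \<phi> r) (S r x)) 0 I \<and>
            G \<phi> x = s ((-1) ^ n) I) \<and>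
     integrated_C_existence_family s E C (real n) (ereal \<tau>) S \<A> \<and>
     (let N = kernel_space E G in
        admissible (fscale s) (op_space s (subtopology E N)) \<longrightarrow>
        (\<forall>m T. m \<ge> n - 1 \<and>
           (\<forall>j\<le>m. T j \<in> end_ops s (subtopology E N)) \<and>
           (\<forall>\<phi>\<in>test_functions. \<forall>x\<in>N. G \<phi> x = (\<Sum>j\<le>m. delta_tensor (fscale s) j (T j) \<phi>) x) \<longrightarrow>
           (\<forall>x\<in>N. (\<forall>t. 0 \<le> t \<and> t < \<tau> \<longrightarrow> S t x = 0) \<longleftrightarrow> (\<forall>i\<le>n - 1. T i x = 0)))))"
proof (intro allI impI)
  fix \<tau> :: real assume tau: "\<tau> > 0"
  define M where "M = \<tau> + 3"
  have M: "M > 0" "M > 1" using tau by (simp_all add: M_def)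
  interpret complex_lcs s E by (rule assms(1))
  interpret pre_cds s E C G by unfold_locales (use assms in auto)
  have "finite_order_on (fscale s) (op_space s E) M G"
    using assms(8) M(1) by (simp add: finite_order_def)
  from order_estimate_full[OF M(1) this] obtain k where
    k: "\<forall>p. cseminorm s E p \<longrightarrow> (\<exists>q. cseminorm s E q \<and> (\<forall>x\<in>topspace E. \<forall>\<phi>\<in>test_functions_on {-M<..<M}.
      \<forall>c. (\<forall>v\<in>{-M..M}. cmod (nderiv k \<phi> v) \<le> c) \<longrightarrow> p (G \<phi> x) \<le> c * q x))" ..
  interpret finite_order_cds s E C G \<tau> M k
    by unfold_locales (fact tau M_def order_estimate[OF M(2) k])+
  show "\<exists>(n::nat) S. n \<ge> 1 \<and>
     integrated_C_semigroup s E C (real n) (ereal \<tau>) S \<and>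
     (\<forall>\<phi>\<in>test_functions_on {-\<tau><..<\<tau>}. \<forall>x\<in>topspace E.
        \<exists>I. has_lcs_integral_at_top s E (\<lambda>r. s (nderiv n \<phi> r) (S r x)) 0 I \<and>
            G \<phi> x = s ((-1) ^ n) I) \<and>
     integrated_C_existence_family s E C (real n) (ereal \<tau>) S \<A> \<and>
     (let N = kernel_space E G in
        admissible (fscale s) (op_space s (subtopology E N)) \<longrightarrow>
        (\<forall>m T. m \<ge> n - 1 \<and>
           (\<forall>j\<le>m. T j \<in> end_ops s (subtopology E N)) \<and>
           (\<forall>\<phi>\<in>test_functions. \<forall>x\<in>N. G \<phi> x = (\<Sum>j\<le>m. delta_tensor (fscale s) j (T j) \<phi>) x) \<longrightarrow>
           (\<forall>x\<in>N. (\<forall>t. 0 \<le> t \<and> t < \<tau> \<longrightarrow> S t x = 0) \<longleftrightarrow> (\<forall>i\<le>n - 1. T i x = 0))))"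
    unfolding Let_def
  proof (intro exI[of _ "k + 2"] exI[of _ S] conjI ballI impI allI)
    show "integrated_C_existence_family s E C (real (k + 2)) (ereal \<tau>) S \<A>"
      unfolding assms(7) by (rule S_existence_family)
    fix m T x
    assume T: "m \<ge> k + 2 - 1 \<and> (\<forall>j\<le>m. T j \<in> end_ops s (subtopology E (kernel_space E G))) \<and>
      (\<forall>\<phi>\<in>test_functions. \<forall>x\<in>kernel_space E G. G \<phi> x = (\<Sum>j\<le>m. delta_tensor (fscale s) j (T j) \<phi>) x)"
      and x: "x \<in> kernel_space E G"
    have xT: "x \<in> topspace E" using x by (simp add: kernel_space_def)
    have TT: "G \<phi> x = (\<Sum>j\<le>m. s ((-1) ^ j * nderiv j \<phi> 0) (T j x))" if "\<phi> \<in> test_functions" for \<phi>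
      using T x that by (simp add: sum_fun_eval delta_tensor_def fscale_def)
    have "k + 1 \<le> m" using T by simp
    from S_vanishes_iff[of x m T, OF xT this TT]
    show "(\<forall>t. 0 \<le> t \<and> t < \<tau> \<longrightarrow> S t x = 0) \<longleftrightarrow> (\<forall>i\<le>k + 2 - 1. T i x = 0)" by simp
  qed (use S_integrated_semigroup S_represents_G in auto)
qed

end
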